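(* The category $\mathrm{FinRel}$, whose objects are finite sets and whose morphisms are relations between them, is the PROP for special bicommutative bimonoids. That is, for every symmetric monoidal category $\mathcal{C}$, the category of algebras of $\mathrm{FinRel}$ over $\mathcal{C}$ is equivalent to the category of special bicommutative bimonoids in $\mathcal{C}$ and bimonoid homomorphisms between them.
   Context: A PROP is a (strict) symmetric monoidal category whose objects are the natural numbers and whose tensor product on objects is addition. An algebra of a PROP $\mathcal{T}$ over a symmetric monoidal category $\mathcal{C}$ is a (strong) symmetric monoidal functor $\mathcal{T}\to\mathcal{C}$; morphisms of algebras are monoidal natural transformations. $\mathcal{T}$ is called the PROP for a kind of structure if, for each $\mathcal{C}$, the category of algebras of $\mathcal{T}$ over $\mathcal{C}$ is equivalent to the category of such structures in $\mathcal{C}$. $\mathrm{FinRel}$ is made into a PROP by choosing one representative finite set of each cardinality, with tensor product given by disjoint union (of sets and of relations), the usual composition of relations, and the evident symmetry. Let $\mathcal{C}$ be a symmetric monoidal category with unit $I$ and symmetry $\tau$ (associators and unitors are suppressed). A commutative monoid in $\mathcal{C}$ is an object $A$ with morphisms $\mu_A: A\otimes A\to A$, $\eta_A: I\to A$ satisfying associativity, the unit laws and commutativity. A cocommutative comonoid is an object $A$ with $\Delta_A: A\to A\otimes A$, $\epsilon_A: A\to I$ satisfying the dual axioms. A bicommutative bimonoid is an object that is both a commutative monoid and a cocommutative comonoid such that $\Delta_A\mu_A=(\mu_A\otimes\mu_A)(1_A\otimes\tau_{AA}\otimes 1_A)(\Delta_A\otimes\Delta_A)$, $\Delta_A\eta_A=\eta_A\otimes\eta_A$,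 $\epsilon_A\mu_A=\epsilon_A\otimes\epsilon_A$, $\epsilon_A\eta_A=1_I$. It is special if $\mu_A\Delta_A=1_A$. A bimonoid homomorphism $f:A\to B$ is a morphism of $\mathcal{C}$ that is both a monoid homomorphism ($\mu_B(f\otimes f)=f\mu_A$, $f\eta_A=\eta_B$) and a comonoid homomorphism ($\Delta_B f=(f\otimes f)\Delta_A$, $\epsilon_B f=\epsilon_A$). *)

theory Defs
  imports Main "HOL-Library.FuncSet"
begin

text \<open>
  Composition is written in the usual (right-to-left) order and is only meaningful
  for composable arrows; its value elsewhere is unspecified.
\<close>

record ('o, 'm) category =
  Obj :: "'o set"
  Arr :: "'m set"
  Dom :: "'m \<Rightarrow> 'o"
  Cod :: "'m \<Rightarrow> 'o"
  Ident :: "'o \<Rightarrow> 'm" ("\<one>\<index>")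
  Comp :: "'m \<Rightarrow> 'm \<Rightarrow> 'm" (infixr "\<cdot>\<index>" 65)

definition Hom :: "('o, 'm, 'z) category_scheme \<Rightarrow> 'o \<Rightarrow> 'o \<Rightarrow> 'm set" where
  "Hom C a b = {f \<in> Arr C. Dom C f = a \<and> Cod C f = b}"

locale category =
  fixes C :: "('o, 'm, 'z) category_scheme" (structure)
  assumes Dom_in_Obj: "f \<in> Arr C \<Longrightarrow> Dom C f \<in> Obj C"
    and Cod_in_Obj: "f \<in> Arr C \<Longrightarrow> Cod C f \<in> Obj C"
    and Ident_in_Hom: "a \<in> Obj C \<Longrightarrow> \<one> a \<in> Hom C a a"
    and Comp_in_Hom: "\<lbrakk>f \<in> Hom C a b; g \<in> Hom C b c\<rbrakk> \<Longrightarrow> g \<cdot> f \<in> Hom C a c"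
    and Comp_assoc: "\<lbrakk>f \<in> Hom C a b; g \<in> Hom C b c; h \<in> Hom C c d\<rbrakk>
      \<Longrightarrow> (h \<cdot> g) \<cdot> f = h \<cdot> (g \<cdot> f)"
    and Comp_Ident_left: "f \<in> Hom C a b \<Longrightarrow> \<one> b \<cdot> f = f"
    and Comp_Ident_right: "f \<in> Hom C a b \<Longrightarrow> f \<cdot> \<one> a = f"

definition inverse_arrows :: "('o, 'm, 'z) category_scheme \<Rightarrow> 'm \<Rightarrow> 'm \<Rightarrow> bool" where
  "inverse_arrows C f g \<longleftrightarrow>
     f \<in> Arr C \<and> g \<in> Hom C (Cod C f) (Dom C f) \<and>
     g \<cdot>\<^bsub>C\<^esub> f = \<one>\<^bsub>C\<^esub> (Dom C f) \<and> f \<cdot>\<^bsub>C\<^esub> g = \<one>\<^bsub>C\<^esub> (Cod C f)"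

definition iso_arrow :: "('o, 'm, 'z) category_scheme \<Rightarrow> 'm \<Rightarrow> bool" where
  "iso_arrow C f \<longleftrightarrow> (\<exists>g. inverse_arrows C f g)"

definition inv_arrow :: "('o, 'm, 'z) category_scheme \<Rightarrow> 'm \<Rightarrow> 'm" where
  "inv_arrow C f = (THE g. inverse_arrows C f g)"

record ('o1, 'm1, 'o2, 'm2) cat_map =
  FObj :: "'o1 \<Rightarrow> 'o2"
  FArr :: "'m1 \<Rightarrow> 'm2"

locale cat_functor = A: category A + B: category B
  for A :: "('o1, 'm1, 'z1) category_scheme"
    and B :: "('o2, 'm2, 'z2) category_scheme"
    and F :: "('o1, 'm1, 'o2, 'm2, 'z3) cat_map_scheme" +
  assumes FObj_in_Obj: "a \<in> Obj A \<Longrightarrow> FObj F a \<in> Obj B"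
    and FArr_in_Hom: "f \<in> Hom A a b \<Longrightarrow> FArr F f \<in> Hom B (FObj F a) (FObj F b)"
    and FArr_Ident: "a \<in> Obj A \<Longrightarrow> FArr F (\<one>\<^bsub>A\<^esub> a) = \<one>\<^bsub>B\<^esub> (FObj F a)"
    and FArr_Comp: "\<lbrakk>f \<in> Hom A a b; g \<in> Hom A b c\<rbrakk>
      \<Longrightarrow> FArr F (g \<cdot>\<^bsub>A\<^esub> f) = FArr F g \<cdot>\<^bsub>B\<^esub> FArr F f"

definition id_functor :: "('o, 'm, 'o, 'm) cat_map" where
  "id_functor = \<lparr>FObj = (\<lambda>a. a), FArr = (\<lambda>f. f)\<rparr>"

definition comp_functor ::
  "('o2, 'm2, 'o3, 'm3, 'z2) cat_map_scheme \<Rightarrow> ('o1, 'm1, 'o2, 'm2, 'z1) cat_map_scheme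
    \<Rightarrow> ('o1, 'm1, 'o3, 'm3) cat_map" where
  "comp_functor G F =
     \<lparr>FObj = (\<lambda>a. FObj G (FObj F a)), FArr = (\<lambda>f. FArr G (FArr F f))\<rparr>"

locale natural_transformation = F: cat_functor A B F + G: cat_functor A B G
  for A :: "('o1, 'm1, 'z1) category_scheme"
    and B :: "('o2, 'm2, 'z2) category_scheme"
    and F :: "('o1, 'm1, 'o2, 'm2, 'z3) cat_map_scheme"
    and G :: "('o1, 'm1, 'o2, 'm2, 'z4) cat_map_scheme"
    and \<eta> :: "'o1 \<Rightarrow> 'm2" +
  assumes component_in_Hom: "a \<in> Obj A \<Longrightarrow> \<eta> a \<in> Hom B (FObj F a) (FObj G a)"
    and naturality: "f \<in> Hom A a b \<Longrightarrow> \<eta> b \<cdot>\<^bsub>B\<^esub> FArr F f = FArr G f \<cdot>\<^bsub>B\<^esub> \<eta> a"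

locale natural_isomorphism = natural_transformation +
  assumes component_iso: "a \<in> Obj A \<Longrightarrow> iso_arrow B (\<eta> a)"

definition equivalent_categories ::
  "('o1, 'm1, 'z1) category_scheme \<Rightarrow> ('o2, 'm2, 'z2) category_scheme \<Rightarrow> bool" where
  "equivalent_categories A B \<longleftrightarrow>
     category A \<and> category B \<and>
     (\<exists>(F :: ('o1, 'm1, 'o2, 'm2) cat_map) (G :: ('o2, 'm2, 'o1, 'm1) cat_map) \<eta> \<epsilon>.
        cat_functor A B F \<and> cat_functor B A G \<and>
        natural_isomorphism A A id_functor (comp_functor G F) \<eta> \<and>
        natural_isomorphism B B (comp_functor F G) id_functor \<epsilon>)"

record ('o, 'm) sm_category = "('o, 'm) category" +
  TObj :: "'o \<Rightarrow> 'o \<Rightarrow> 'o" (infixr "\<otimes>\<index>" 70)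
  TArr :: "'m \<Rightarrow> 'm \<Rightarrow> 'm" (infixr "\<boxtimes>\<index>" 70)
  Unit :: "'o" ("\<I>\<index>")
  Assoc :: "'o \<Rightarrow> 'o \<Rightarrow> 'o \<Rightarrow> 'm" ("\<alpha>\<index>")
  LUnit :: "'o \<Rightarrow> 'm" ("\<l>\<index>")
  RUnit :: "'o \<Rightarrow> 'm" ("\<r>\<index>")
  Symm :: "'o \<Rightarrow> 'o \<Rightarrow> 'm" ("\<tau>\<index>")

text \<open>
  The associators and unitors are kept explicit. They are oriented as
  \<open>\<alpha> a b c : (a \<otimes> b) \<otimes> c \<rightarrow> a \<otimes> (b \<otimes> c)\<close>, \<open>\<l> a : \<I> \<otimes> a \<rightarrow> a\<close> and \<open>\<r> a : a \<otimes> \<I> \<rightarrow> a\<close>.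
\<close>

locale symmetric_monoidal_category = category C
  for C :: "('o, 'm, 'z) sm_category_scheme" (structure) +
  assumes Unit_in_Obj: "\<I> \<in> Obj C"
    and TObj_in_Obj: "\<lbrakk>a \<in> Obj C; b \<in> Obj C\<rbrakk> \<Longrightarrow> a \<otimes> b \<in> Obj C"
    and TArr_in_Hom: "\<lbrakk>f \<in> Hom C a b; g \<in> Hom C c d\<rbrakk> \<Longrightarrow> f \<boxtimes> g \<in> Hom C (a \<otimes> c) (b \<otimes> d)"
    and TArr_Ident: "\<lbrakk>a \<in> Obj C; b \<in> Obj C\<rbrakk> \<Longrightarrow> \<one> a \<boxtimes> \<one> b = \<one> (a \<otimes> b)"
    and TArr_Comp: "\<lbrakk>f \<in> Hom C a b; g \<in> Hom C b c; f' \<in> Hom C a' b'; g' \<in> Hom C b' c'\<rbrakk>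
      \<Longrightarrow> (g \<cdot> f) \<boxtimes> (g' \<cdot> f') = (g \<boxtimes> g') \<cdot> (f \<boxtimes> f')"
    and Assoc_in_Hom: "\<lbrakk>a \<in> Obj C; b \<in> Obj C; c \<in> Obj C\<rbrakk>
      \<Longrightarrow> \<alpha> a b c \<in> Hom C ((a \<otimes> b) \<otimes> c) (a \<otimes> (b \<otimes> c))"
    and Assoc_iso: "\<lbrakk>a \<in> Obj C; b \<in> Obj C; c \<in> Obj C\<rbrakk> \<Longrightarrow> iso_arrow C (\<alpha> a b c)"
    and Assoc_natural: "\<lbrakk>f \<in> Hom C a a'; g \<in> Hom C b b'; h \<in> Hom C c c'\<rbrakk>
      \<Longrightarrow> \<alpha> a' b' c' \<cdot> ((f \<boxtimes> g) \<boxtimes> h) = (f \<boxtimes> (g \<boxtimes> h)) \<cdot> \<alpha> a b c"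
    and LUnit_in_Hom: "a \<in> Obj C \<Longrightarrow> \<l> a \<in> Hom C (\<I> \<otimes> a) a"
    and LUnit_iso: "a \<in> Obj C \<Longrightarrow> iso_arrow C (\<l> a)"
    and LUnit_natural: "f \<in> Hom C a b \<Longrightarrow> \<l> b \<cdot> (\<one> \<I> \<boxtimes> f) = f \<cdot> \<l> a"
    and RUnit_in_Hom: "a \<in> Obj C \<Longrightarrow> \<r> a \<in> Hom C (a \<otimes> \<I>) a"
    and RUnit_iso: "a \<in> Obj C \<Longrightarrow> iso_arrow C (\<r> a)"
    and RUnit_natural: "f \<in> Hom C a b \<Longrightarrow> \<r> b \<cdot> (f \<boxtimes> \<one> \<I>) = f \<cdot> \<r> a"
    and Symm_in_Hom: "\<lbrakk>a \<in> Obj C; b \<in> Obj C\<rbrakk> \<Longrightarrow> \<tau> a b \<in> Hom C (a \<otimes> b) (b \<otimes> a)"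
    and Symm_natural: "\<lbrakk>f \<in> Hom C a a'; g \<in> Hom C b b'\<rbrakk>
      \<Longrightarrow> \<tau> a' b' \<cdot> (f \<boxtimes> g) = (g \<boxtimes> f) \<cdot> \<tau> a b"
    and Symm_Symm: "\<lbrakk>a \<in> Obj C; b \<in> Obj C\<rbrakk> \<Longrightarrow> \<tau> b a \<cdot> \<tau> a b = \<one> (a \<otimes> b)"
    and pentagon: "\<lbrakk>a \<in> Obj C; b \<in> Obj C; c \<in> Obj C; d \<in> Obj C\<rbrakk>
      \<Longrightarrow> (\<one> a \<boxtimes> \<alpha> b c d) \<cdot> \<alpha> a (b \<otimes> c) d \<cdot> (\<alpha> a b c \<boxtimes> \<one> d)
          = \<alpha> a b (c \<otimes> d) \<cdot> \<alpha> (a \<otimes> b) c d"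
    and triangle: "\<lbrakk>a \<in> Obj C; b \<in> Obj C\<rbrakk>
      \<Longrightarrow> (\<one> a \<boxtimes> \<l> b) \<cdot> \<alpha> a \<I> b = \<r> a \<boxtimes> \<one> b"
    and hexagon: "\<lbrakk>a \<in> Obj C; b \<in> Obj C; c \<in> Obj C\<rbrakk>
      \<Longrightarrow> \<alpha> b c a \<cdot> \<tau> a (b \<otimes> c) \<cdot> \<alpha> a b c
          = (\<one> b \<boxtimes> \<tau> a c) \<cdot> \<alpha> b a c \<cdot> (\<tau> a b \<boxtimes> \<one> c)"

locale strict_symmetric_monoidal_category = symmetric_monoidal_category +
  assumes TObj_assoc: "\<lbrakk>a \<in> Obj C; b \<in> Obj C; c \<in> Obj C\<rbrakk> \<Longrightarrow> (a \<otimes> b) \<otimes> c = a \<otimes> (b \<otimes> c)"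
    and TObj_Unit_left: "a \<in> Obj C \<Longrightarrow> \<I> \<otimes> a = a"
    and TObj_Unit_right: "a \<in> Obj C \<Longrightarrow> a \<otimes> \<I> = a"
    and Assoc_Ident: "\<lbrakk>a \<in> Obj C; b \<in> Obj C; c \<in> Obj C\<rbrakk> \<Longrightarrow> \<alpha> a b c = \<one> (a \<otimes> (b \<otimes> c))"
    and LUnit_Ident: "a \<in> Obj C \<Longrightarrow> \<l> a = \<one> a"
    and RUnit_Ident: "a \<in> Obj C \<Longrightarrow> \<r> a = \<one> a"

locale prop_category = strict_symmetric_monoidal_category T
  for T :: "(nat, 'm, 'z) sm_category_scheme" (structure) +
  assumes Obj_nat: "Obj T = UNIV"
    and TObj_add: "m \<otimes> n = m + n"

record ('o1, 'm1, 'o2, 'm2) mon_map = "('o1, 'm1, 'o2, 'm2) cat_map" +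
  Phi :: "'o1 \<Rightarrow> 'o1 \<Rightarrow> 'm2"
  Phi0 :: "'m2"

locale symmetric_monoidal_functor =
  T: symmetric_monoidal_category T + C: symmetric_monoidal_category C + cat_functor T C F
  for T :: "('o1, 'm1, 'z1) sm_category_scheme"
    and C :: "('o2, 'm2, 'z2) sm_category_scheme"
    and F :: "('o1, 'm1, 'o2, 'm2, 'z3) mon_map_scheme" +
  assumes Phi_in_Hom: "\<lbrakk>a \<in> Obj T; b \<in> Obj T\<rbrakk>
      \<Longrightarrow> Phi F a b \<in> Hom C (FObj F a \<otimes>\<^bsub>C\<^esub> FObj F b) (FObj F (a \<otimes>\<^bsub>T\<^esub> b))"
    and Phi_iso: "\<lbrakk>a \<in> Obj T; b \<in> Obj T\<rbrakk> \<Longrightarrow> iso_arrow C (Phi F a b)"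
    and Phi_natural: "\<lbrakk>f \<in> Hom T a a'; g \<in> Hom T b b'\<rbrakk>
      \<Longrightarrow> Phi F a' b' \<cdot>\<^bsub>C\<^esub> (FArr F f \<boxtimes>\<^bsub>C\<^esub> FArr F g) = FArr F (f \<boxtimes>\<^bsub>T\<^esub> g) \<cdot>\<^bsub>C\<^esub> Phi F a b"
    and Phi0_in_Hom: "Phi0 F \<in> Hom C \<I>\<^bsub>C\<^esub> (FObj F \<I>\<^bsub>T\<^esub>)"
    and Phi0_iso: "iso_arrow C (Phi0 F)"
    and Phi_Assoc: "\<lbrakk>a \<in> Obj T; b \<in> Obj T; c \<in> Obj T\<rbrakk>
      \<Longrightarrow> FArr F (\<alpha>\<^bsub>T\<^esub> a b c) \<cdot>\<^bsub>C\<^esub> Phi F (a \<otimes>\<^bsub>T\<^esub> b) c \<cdot>\<^bsub>C\<^esub> (Phi F a b \<boxtimes>\<^bsub>C\<^esub> \<one>\<^bsub>C\<^esub> (FObj F c))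
          = Phi F a (b \<otimes>\<^bsub>T\<^esub> c) \<cdot>\<^bsub>C\<^esub> (\<one>\<^bsub>C\<^esub> (FObj F a) \<boxtimes>\<^bsub>C\<^esub> Phi F b c)
            \<cdot>\<^bsub>C\<^esub> \<alpha>\<^bsub>C\<^esub> (FObj F a) (FObj F b) (FObj F c)"
    and Phi_LUnit: "a \<in> Obj T
      \<Longrightarrow> FArr F (\<l>\<^bsub>T\<^esub> a) \<cdot>\<^bsub>C\<^esub> Phi F \<I>\<^bsub>T\<^esub> a \<cdot>\<^bsub>C\<^esub> (Phi0 F \<boxtimes>\<^bsub>C\<^esub> \<one>\<^bsub>C\<^esub> (FObj F a)) = \<l>\<^bsub>C\<^esub> (FObj F a)"
    and Phi_RUnit: "a \<in> Obj T
      \<Longrightarrow> FArr F (\<r>\<^bsub>T\<^esub> a) \<cdot>\<^bsub>C\<^esub> Phi F a \<I>\<^bsub>T\<^esub> \<cdot>\<^bsub>C\<^esub> (\<one>\<^bsub>C\<^esub> (FObj F a) \<boxtimes>\<^bsub>C\<^esub> Phi0 F) = \<r>\<^bsub>C\<^esub> (FObj F a)"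
    and Phi_Symm: "\<lbrakk>a \<in> Obj T; b \<in> Obj T\<rbrakk>
      \<Longrightarrow> FArr F (\<tau>\<^bsub>T\<^esub> a b) \<cdot>\<^bsub>C\<^esub> Phi F a b = Phi F b a \<cdot>\<^bsub>C\<^esub> \<tau>\<^bsub>C\<^esub> (FObj F a) (FObj F b)"

locale monoidal_natural_transformation =
  F: symmetric_monoidal_functor T C F + G: symmetric_monoidal_functor T C G +
  natural_transformation T C F G \<eta>
  for T :: "('o1, 'm1, 'z1) sm_category_scheme"
    and C :: "('o2, 'm2, 'z2) sm_category_scheme"
    and F :: "('o1, 'm1, 'o2, 'm2, 'z3) mon_map_scheme"
    and G :: "('o1, 'm1, 'o2, 'm2, 'z4) mon_map_scheme"
    and \<eta> :: "'o1 \<Rightarrow> 'm2" +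
  assumes component_Phi: "\<lbrakk>a \<in> Obj T; b \<in> Obj T\<rbrakk>
      \<Longrightarrow> \<eta> (a \<otimes>\<^bsub>T\<^esub> b) \<cdot>\<^bsub>C\<^esub> Phi F a b = Phi G a b \<cdot>\<^bsub>C\<^esub> (\<eta> a \<boxtimes>\<^bsub>C\<^esub> \<eta> b)"
    and component_Phi0: "\<eta> \<I>\<^bsub>T\<^esub> \<cdot>\<^bsub>C\<^esub> Phi0 F = Phi0 G"

text \<open>
  Maps are normalised to \<^const>\<open>undefined\<close> off their intended domain, so that equality of
  algebras (and of morphisms of algebras) is equality of the underlying functors
  (transformations). A morphism carries its source and target. All objects of a PROP
  are natural numbers, so no condition on object maps, coherence maps or families of
  components is needed.
\<close>

definition algebras ::
  "(nat, 'm1, 'z1) sm_category_scheme \<Rightarrow> ('o2, 'm2, 'z2) sm_category_scheme \<Rightarrow>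
   ((nat, 'm1, 'o2, 'm2) mon_map,
    (nat, 'm1, 'o2, 'm2) mon_map \<times> (nat, 'm1, 'o2, 'm2) mon_map \<times> (nat \<Rightarrow> 'm2)) category"
where
  "algebras T C =
     \<lparr>Obj = {F. symmetric_monoidal_functor T C F \<and> FArr F \<in> extensional (Arr T)},
      Arr = {(F, G, \<eta>). FArr F \<in> extensional (Arr T) \<and> FArr G \<in> extensional (Arr T) \<and>
                        monoidal_natural_transformation T C F G \<eta>},
      Dom = (\<lambda>(F, G, \<eta>). F),
      Cod = (\<lambda>(F, G, \<eta>). G),
      Ident = (\<lambda>F. (F, F, \<lambda>n. \<one>\<^bsub>C\<^esub> (FObj F n))),
      Comp = (\<lambda>(G', H, \<theta>) (F, G, \<eta>). (F, H, \<lambda>n. \<theta> n \<cdot>\<^bsub>C\<^esub> \<eta> n))\<rparr>"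

record ('o, 'm) bimonoid =
  Carrier :: "'o"
  Mult :: "'m"
  Eta :: "'m"
  Comult :: "'m"
  Counit :: "'m"

locale commutative_monoid_in = symmetric_monoidal_category C
  for C :: "('o, 'm, 'z) sm_category_scheme" (structure)
    and A :: 'o and \<mu> :: 'm and \<eta> :: 'm +
  assumes carrier_in_Obj: "A \<in> Obj C"
    and mult_in_Hom: "\<mu> \<in> Hom C (A \<otimes> A) A"
    and unit_in_Hom: "\<eta> \<in> Hom C \<I> A"
    and mult_assoc: "\<mu> \<cdot> (\<mu> \<boxtimes> \<one> A) = \<mu> \<cdot> (\<one> A \<boxtimes> \<mu>) \<cdot> \<alpha> A A A"
    and mult_unit_left: "\<mu> \<cdot> (\<eta> \<boxtimes> \<one> A) = \<l> A"
    and mult_unit_right: "\<mu> \<cdot> (\<one> A \<boxtimes> \<eta>) = \<r> A"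
    and mult_comm: "\<mu> \<cdot> \<tau> A A = \<mu>"

locale cocommutative_comonoid_in = symmetric_monoidal_category C
  for C :: "('o, 'm, 'z) sm_category_scheme" (structure)
    and A :: 'o and \<Delta> :: 'm and \<epsilon> :: 'm +
  assumes cocarrier_in_Obj: "A \<in> Obj C"
    and comult_in_Hom: "\<Delta> \<in> Hom C A (A \<otimes> A)"
    and counit_in_Hom: "\<epsilon> \<in> Hom C A \<I>"
    and comult_coassoc: "\<alpha> A A A \<cdot> (\<Delta> \<boxtimes> \<one> A) \<cdot> \<Delta> = (\<one> A \<boxtimes> \<Delta>) \<cdot> \<Delta>"
    and comult_counit_left: "\<l> A \<cdot> (\<epsilon> \<boxtimes> \<one> A) \<cdot> \<Delta> = \<one> A"
    and comult_counit_right: "\<r> A \<cdot> (\<one> A \<boxtimes> \<epsilon>) \<cdot> \<Delta> = \<one> A"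
    and comult_cocomm: "\<tau> A A \<cdot> \<Delta> = \<Delta>"

text \<open>
  The arrow written \<open>1 \<otimes> \<tau> \<otimes> 1\<close> when associators are suppressed, as an endomorphism
  of \<open>(A \<otimes> A) \<otimes> (A \<otimes> A)\<close>.
\<close>

definition middle_swap :: "('o, 'm, 'z) sm_category_scheme \<Rightarrow> 'o \<Rightarrow> 'm" where
  "middle_swap C A =
     inv_arrow C (\<alpha>\<^bsub>C\<^esub> A A (A \<otimes>\<^bsub>C\<^esub> A)) \<cdot>\<^bsub>C\<^esub>
     (\<one>\<^bsub>C\<^esub> A \<boxtimes>\<^bsub>C\<^esub> \<alpha>\<^bsub>C\<^esub> A A A) \<cdot>\<^bsub>C\<^esub>
     (\<one>\<^bsub>C\<^esub> A \<boxtimes>\<^bsub>C\<^esub> (\<tau>\<^bsub>C\<^esub> A A \<boxtimes>\<^bsub>C\<^esub> \<one>\<^bsub>C\<^esub> A)) \<cdot>\<^bsub>C\<^esub>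
     (\<one>\<^bsub>C\<^esub> A \<boxtimes>\<^bsub>C\<^esub> inv_arrow C (\<alpha>\<^bsub>C\<^esub> A A A)) \<cdot>\<^bsub>C\<^esub>
     \<alpha>\<^bsub>C\<^esub> A A (A \<otimes>\<^bsub>C\<^esub> A)"

locale bicommutative_bimonoid =
  commutative_monoid_in C "Carrier A" "Mult A" "Eta A" +
  cocommutative_comonoid_in C "Carrier A" "Comult A" "Counit A"
  for C :: "('o, 'm, 'z) sm_category_scheme" (structure)
    and A :: "('o, 'm) bimonoid" +
  assumes comult_mult: "Comult A \<cdot> Mult A
      = (Mult A \<boxtimes> Mult A) \<cdot> middle_swap C (Carrier A) \<cdot> (Comult A \<boxtimes> Comult A)"
    and comult_unit: "Comult A \<cdot> Eta A = (Eta A \<boxtimes> Eta A) \<cdot> inv_arrow C (\<l> \<I>)"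
    and counit_mult: "Counit A \<cdot> Mult A = \<l> \<I> \<cdot> (Counit A \<boxtimes> Counit A)"
    and counit_unit: "Counit A \<cdot> Eta A = \<one> \<I>"

locale special_bicommutative_bimonoid = bicommutative_bimonoid +
  assumes special: "Mult A \<cdot> Comult A = \<one> (Carrier A)"

definition bimonoid_hom ::
  "('o, 'm, 'z) sm_category_scheme \<Rightarrow> ('o, 'm) bimonoid \<Rightarrow> ('o, 'm) bimonoid \<Rightarrow> 'm \<Rightarrow> bool"
where
  "bimonoid_hom C A B f \<longleftrightarrow>
     f \<in> Hom C (Carrier A) (Carrier B) \<and>
     Mult B \<cdot>\<^bsub>C\<^esub> (f \<boxtimes>\<^bsub>C\<^esub> f) = f \<cdot>\<^bsub>C\<^esub> Mult A \<and>
     f \<cdot>\<^bsub>C\<^esub> Eta A = Eta B \<and>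
     Comult B \<cdot>\<^bsub>C\<^esub> f = (f \<boxtimes>\<^bsub>C\<^esub> f) \<cdot>\<^bsub>C\<^esub> Comult A \<and>
     Counit B \<cdot>\<^bsub>C\<^esub> f = Counit A"

definition special_bicommutative_bimonoids ::
  "('o, 'm, 'z) sm_category_scheme \<Rightarrow>
   (('o, 'm) bimonoid, ('o, 'm) bimonoid \<times> ('o, 'm) bimonoid \<times> 'm) category"
where
  "special_bicommutative_bimonoids C =
     \<lparr>Obj = {A. special_bicommutative_bimonoid C A},
      Arr = {(A, B, f). special_bicommutative_bimonoid C A \<and>
                        special_bicommutative_bimonoid C B \<and> bimonoid_hom C A B f},
      Dom = (\<lambda>(A, B, f). A),
      Cod = (\<lambda>(A, B, f). B),
      Ident = (\<lambda>A. (A, A, \<one>\<^bsub>C\<^esub> (Carrier A))),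
      Comp = (\<lambda>(B', D, g) (A, B, f). (A, D, g \<cdot>\<^bsub>C\<^esub> f))\<rparr>"

text \<open>
  The chosen representative of cardinality \<open>n\<close> is \<open>{..<n}\<close>, identified with \<open>n\<close> itself; an
  arrow from \<open>m\<close> to \<open>n\<close> is a triple \<open>(m, R, n)\<close> with \<open>R \<subseteq> {..<m} \<times> {..<n}\<close>. The disjoint
  union of \<open>{..<m}\<close> and \<open>{..<n}\<close> is realised as \<open>{..<m + n}\<close>, the second summand being
  shifted by \<open>m\<close>. The relation product \<open>R O S\<close> applies \<open>R\<close> first.
\<close>

definition rel_sum ::
  "nat \<Rightarrow> nat \<Rightarrow> (nat \<times> nat) set \<Rightarrow> (nat \<times> nat) set \<Rightarrow> (nat \<times> nat) set" where
  "rel_sum m n R S = R \<union> {(m + i, n + j) | i j. (i, j) \<in> S}"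

definition rel_swap :: "nat \<Rightarrow> nat \<Rightarrow> (nat \<times> nat) set" where
  "rel_swap m n = {(i, n + i) | i. i < m} \<union> {(m + j, j) | j. j < n}"

definition FinRel :: "(nat, nat \<times> (nat \<times> nat) set \<times> nat) sm_category" where
  "FinRel =
     \<lparr>Obj = UNIV,
      Arr = {(m, R, n). R \<subseteq> {..<m} \<times> {..<n}},
      Dom = (\<lambda>(m, R, n). m),
      Cod = (\<lambda>(m, R, n). n),
      Ident = (\<lambda>n. (n, Id_on {..<n}, n)),
      Comp = (\<lambda>(n', S, k) (m, R, n). (m, R O S, k)),
      TObj = (\<lambda>m n. m + n),
      TArr = (\<lambda>(m, R, n) (m', S, n'). (m + m', rel_sum m n R S, n + n')),
      Unit = 0,
      Assoc = (\<lambda>m n k. (m + n + k, Id_on {..<m + n + k}, m + n + k)),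
      LUnit = (\<lambda>n. (n, Id_on {..<n}, n)),
      RUnit = (\<lambda>n. (n, Id_on {..<n}, n)),
      Symm = (\<lambda>m n. (m + n, rel_swap m n, n + m))\<rparr>"

end

theory Submission
  imports Defs
begin

text \<open>
  Evaluation at the object 1 sends an algebra of the PROP of relations to a special bicommutative
  bimonoid. It is fully faithful because relations are generated by the bimonoid structure on 1
  and the symmetries, so a bimonoid homomorphism extends uniquely along the tensor powers.
  For a bimonoid \<open>A\<close>, the tensor powers of \<open>A\<close> form a strict PROP in which arrows that are
  homomorphisms of monoids and of comonoids admit biproducts. Such an arrow is determined by its
  matrix of entries \<open>1 \<rightarrow> 1\<close>; a relation is sent to the unique one with the corresponding 0-1 matrix,
  and functoriality is matrix multiplication with \<open>1 + 1 = 1\<close>.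
\<close>

section \<open>Categories and symmetric monoidal categories\<close>

text \<open>A presentation of relations by generators and equations would require normal forms for
  diagrams and a check of every equation. Two weaker facts replace it. Generation alone
  (\<open>FinRel_induct\<close>) gives existence: naturality of an extended homomorphism and the
  presence of a representing arrow are both preserved by composition and sum. Matrix entries
  determine an arrow that respects both structures, which gives uniqueness, and every functor law
  becomes a comparison of two arrows with the same entries. The associators of \<open>C\<close>
  would obstruct this calculus. They are confined to the comparison between the tensor powers of
  \<open>A\<close> and a strict PROP, whose arrows carry their exponents because different powers of
  \<open>A\<close> may be the same object. The power with exponent 1 is \<open>A\<close> itself, so
  the algebra built from a bimonoid evaluates to exactly that bimonoid. Evaluation is thus
  surjective on objects, not merely up to isomorphism, and a quasi-inverse is obtained by
  choice.\<close>

lemma Hom_iff: "f \<in> Hom C a b \<longleftrightarrow> f \<in> Arr C \<and> Dom C f = a \<and> Cod C f = b"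
  by (simp add: Hom_def)

context category
begin

lemma Dom_Obj [simp]: "f \<in> Arr C \<Longrightarrow> Dom C f \<in> Obj C"
  by (rule Dom_in_Obj)

lemma Cod_Obj [simp]: "f \<in> Arr C \<Longrightarrow> Cod C f \<in> Obj C"
  by (rule Cod_in_Obj)

lemma Ident_simps [simp]:
  assumes "a \<in> Obj C"
  shows "\<one> a \<in> Arr C" "Dom C (\<one> a) = a" "Cod C (\<one> a) = a"
  using Ident_in_Hom[OF assms] by (simp_all add: Hom_iff)

lemma Comp_simps [simp]:
  assumes "f \<in> Arr C" "g \<in> Arr C" "Dom C g = Cod C f"
  shows "g \<cdot> f \<in> Arr C" "Dom C (g \<cdot> f) = Dom C f" "Cod C (g \<cdot> f) = Cod C g"
  using Comp_in_Hom[of f "Dom C f" "Cod C f" g "Cod C g"] assms by (simp_all add: Hom_iff)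

lemma Comp_assoc_Arr [simp]:
  assumes "f \<in> Arr C" "g \<in> Arr C" "h \<in> Arr C" "Dom C g = Cod C f" "Dom C h = Cod C g"
  shows "(h \<cdot> g) \<cdot> f = h \<cdot> g \<cdot> f"
  using assms by (intro Comp_assoc) (auto simp: Hom_iff)

lemma Comp_Ident_Arr [simp]:
  assumes "f \<in> Arr C"
  shows "Cod C f = b \<Longrightarrow> \<one> b \<cdot> f = f" "Dom C f = a \<Longrightarrow> f \<cdot> \<one> a = f"
  using assms Comp_Ident_left[of f _ b] Comp_Ident_right[of f a] by (auto simp: Hom_iff)

text \<open>Simplification nests composites to the right, where the left-hand side of an equation
  \<open>x \<cdot> y = z\<close> survives only as the head of a longer composite.
  \<open>Comp_chain[OF eq]\<close> is the same equation in a form that rewrites there.\<close>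

lemma Comp_chain:
  assumes "x \<cdot> y = z" "x \<in> Arr C" "y \<in> Arr C" "k \<in> Arr C" "Dom C x = Cod C y" "Dom C y = Cod C k"
  shows "x \<cdot> y \<cdot> k = z \<cdot> k"
  using assms(2-) by (simp flip: assms(1))

lemma inverse_arrows_iff:
  "inverse_arrows C f g \<longleftrightarrow> f \<in> Arr C \<and> g \<in> Arr C \<and> Dom C g = Cod C f \<and> Cod C g = Dom C f
     \<and> g \<cdot> f = \<one> (Dom C f) \<and> f \<cdot> g = \<one> (Cod C f)"
  by (auto simp: inverse_arrows_def Hom_iff)

lemma inverse_arrows_sym: "inverse_arrows C f g \<Longrightarrow> inverse_arrows C g f"
  by (auto simp: inverse_arrows_iff)

lemma inv_arrow_eq:
  assumes "inverse_arrows C f g"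
  shows "inv_arrow C f = g"
  unfolding inv_arrow_def
proof (rule the_equality)
  fix h assume h: "inverse_arrows C f h"
  have "h = h \<cdot> (f \<cdot> g)"
    using h assms by (simp add: inverse_arrows_iff)
  also have "\<dots> = (h \<cdot> f) \<cdot> g"
    using h assms by (subst Comp_assoc_Arr) (auto simp: inverse_arrows_iff)
  also have "\<dots> = g"
    using h assms by (simp add: inverse_arrows_iff)
  finally show "h = g" .
qed fact

lemma inverse_arrows_inv: "iso_arrow C f \<Longrightarrow> inverse_arrows C f (inv_arrow C f)"
  using inv_arrow_eq by (auto simp: iso_arrow_def)

lemma inverse_arrows_iso: "inverse_arrows C f g \<Longrightarrow> iso_arrow C f"
  by (auto simp: iso_arrow_def)

lemma iso_Arr [simp]: "iso_arrow C f \<Longrightarrow> f \<in> Arr C"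
  by (auto simp: iso_arrow_def inverse_arrows_iff)

lemma inv_simps [simp]:
  assumes "iso_arrow C f"
  shows "inv_arrow C f \<in> Arr C" "Dom C (inv_arrow C f) = Cod C f"
    "Cod C (inv_arrow C f) = Dom C f" "inv_arrow C f \<cdot> f = \<one> (Dom C f)"
    "f \<cdot> inv_arrow C f = \<one> (Cod C f)"
  using inverse_arrows_inv[OF assms] by (auto simp: inverse_arrows_iff)

lemma inv_chain [simp]:
  assumes "iso_arrow C f" "k \<in> Arr C"
  shows "Cod C k = Dom C f \<Longrightarrow> inv_arrow C f \<cdot> f \<cdot> k = k"
    "Cod C k = Cod C f \<Longrightarrow> f \<cdot> inv_arrow C f \<cdot> k = k"
  using assms by (simp_all flip: Comp_assoc_Arr)

lemma iso_Ident [simp]: "a \<in> Obj C \<Longrightarrow> iso_arrow C (\<one> a)"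
  by (rule inverse_arrows_iso[of _ "\<one> a"]) (simp add: inverse_arrows_iff)

lemma inv_Ident [simp]: "a \<in> Obj C \<Longrightarrow> inv_arrow C (\<one> a) = \<one> a"
  by (rule inv_arrow_eq) (simp add: inverse_arrows_iff)

lemma inverse_arrows_Comp:
  assumes "iso_arrow C f" "iso_arrow C g" "Dom C g = Cod C f"
  shows "inverse_arrows C (g \<cdot> f) (inv_arrow C f \<cdot> inv_arrow C g)"
  using assms by (simp add: inverse_arrows_iff)

lemma iso_Comp [simp]:
  "\<lbrakk>iso_arrow C f; iso_arrow C g; Dom C g = Cod C f\<rbrakk> \<Longrightarrow> iso_arrow C (g \<cdot> f)"
  by (rule inverse_arrows_iso[OF inverse_arrows_Comp])

lemma inv_Comp:
  "\<lbrakk>iso_arrow C f; iso_arrow C g; Dom C g = Cod C f\<rbrakk>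
    \<Longrightarrow> inv_arrow C (g \<cdot> f) = inv_arrow C f \<cdot> inv_arrow C g"
  by (rule inv_arrow_eq[OF inverse_arrows_Comp])

lemma iso_inv [simp]: "iso_arrow C f \<Longrightarrow> iso_arrow C (inv_arrow C f)"
  by (rule inverse_arrows_iso[OF inverse_arrows_sym[OF inverse_arrows_inv]])

lemma iso_cancel_right:
  assumes "g \<cdot> f = h \<cdot> f" "iso_arrow C f" "g \<in> Arr C" "h \<in> Arr C" "Dom C g = Cod C f" "Dom C h = Cod C f"
  shows "g = h"
proof -
  have "(g \<cdot> f) \<cdot> inv_arrow C f = (h \<cdot> f) \<cdot> inv_arrow C f"
    by (simp add: assms(1))
  then show ?thesis using assms(2-) by simp
qed

lemma iso_cancel_left:
  assumes "f \<cdot> g = f \<cdot> h" "iso_arrow C f" "g \<in> Arr C" "h \<in> Arr C" "Cod C g = Dom C f" "Cod C h = Dom C f"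
  shows "g = h"
proof -
  have "inv_arrow C f \<cdot> f \<cdot> g = inv_arrow C f \<cdot> f \<cdot> h"
    by (simp add: assms(1))
  then show ?thesis using assms(2-) by simp
qed

end

section \<open>Symmetric monoidal categories: rewriting rules and coherence of the unitors\<close>

context symmetric_monoidal_category
begin

lemmas Unit_Obj [simp] = Unit_in_Obj
lemmas TObj_Obj [simp] = TObj_in_Obj
lemmas TArr_Ident_simp [simp] = TArr_Ident

lemma TArr_simps [simp]:
  assumes "f \<in> Arr C" "g \<in> Arr C"
  shows "f \<boxtimes> g \<in> Arr C" "Dom C (f \<boxtimes> g) = Dom C f \<otimes> Dom C g" "Cod C (f \<boxtimes> g) = Cod C f \<otimes> Cod C g"
  using TArr_in_Hom[of f "Dom C f" "Cod C f" g "Dom C g" "Cod C g"] assms by (simp_all add: Hom_iff)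

lemma TArr_Comp_Arr:
  assumes "f \<in> Arr C" "g \<in> Arr C" "Dom C g = Cod C f" "f' \<in> Arr C" "g' \<in> Arr C" "Dom C g' = Cod C f'"
  shows "(g \<boxtimes> g') \<cdot> (f \<boxtimes> f') = (g \<cdot> f) \<boxtimes> (g' \<cdot> f')"
  using assms by (intro TArr_Comp[symmetric]) (auto simp: Hom_iff)

lemma TArr_Comp_chain:
  assumes "f \<in> Arr C" "g \<in> Arr C" "Dom C g = Cod C f" "f' \<in> Arr C" "g' \<in> Arr C" "Dom C g' = Cod C f'"
    "k \<in> Arr C" "Cod C k = Dom C f \<otimes> Dom C f'"
  shows "(g \<boxtimes> g') \<cdot> (f \<boxtimes> f') \<cdot> k = ((g \<cdot> f) \<boxtimes> (g' \<cdot> f')) \<cdot> k"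
  using assms by (intro Comp_chain TArr_Comp_Arr) auto

lemma inverse_arrows_TArr:
  assumes "iso_arrow C f" "iso_arrow C g"
  shows "inverse_arrows C (f \<boxtimes> g) (inv_arrow C f \<boxtimes> inv_arrow C g)"
  using assms by (simp add: inverse_arrows_iff TArr_Comp_Arr)

lemma iso_TArr [simp]: "\<lbrakk>iso_arrow C f; iso_arrow C g\<rbrakk> \<Longrightarrow> iso_arrow C (f \<boxtimes> g)"
  by (rule inverse_arrows_iso[OF inverse_arrows_TArr])

lemma inv_TArr:
  "\<lbrakk>iso_arrow C f; iso_arrow C g\<rbrakk> \<Longrightarrow> inv_arrow C (f \<boxtimes> g) = inv_arrow C f \<boxtimes> inv_arrow C g"
  by (rule inv_arrow_eq[OF inverse_arrows_TArr])

lemma Assoc_simps [simp]: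
  assumes "a \<in> Obj C" "b \<in> Obj C" "c \<in> Obj C"
  shows "\<alpha> a b c \<in> Arr C" "Dom C (\<alpha> a b c) = (a \<otimes> b) \<otimes> c" "Cod C (\<alpha> a b c) = a \<otimes> b \<otimes> c"
    "iso_arrow C (\<alpha> a b c)"
  using Assoc_in_Hom[OF assms] Assoc_iso[OF assms] by (simp_all add: Hom_iff)

lemma LUnit_simps [simp]:
  assumes "a \<in> Obj C"
  shows "\<l> a \<in> Arr C" "Dom C (\<l> a) = \<I> \<otimes> a" "Cod C (\<l> a) = a" "iso_arrow C (\<l> a)"
  using LUnit_in_Hom[OF assms] LUnit_iso[OF assms] by (simp_all add: Hom_iff)

lemma RUnit_simps [simp]:
  assumes "a \<in> Obj C"
  shows "\<r> a \<in> Arr C" "Dom C (\<r> a) = a \<otimes> \<I>" "Cod C (\<r> a) = a" "iso_arrow C (\<r> a)"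
  using RUnit_in_Hom[OF assms] RUnit_iso[OF assms] by (simp_all add: Hom_iff)

lemma Symm_simps [simp]:
  assumes "a \<in> Obj C" "b \<in> Obj C"
  shows "\<tau> a b \<in> Arr C" "Dom C (\<tau> a b) = a \<otimes> b" "Cod C (\<tau> a b) = b \<otimes> a"
    "\<tau> b a \<cdot> \<tau> a b = \<one> (a \<otimes> b)"
  using Symm_in_Hom[OF assms] Symm_Symm[OF assms] by (simp_all add: Hom_iff)

lemma inverse_arrows_Symm: "\<lbrakk>a \<in> Obj C; b \<in> Obj C\<rbrakk> \<Longrightarrow> inverse_arrows C (\<tau> a b) (\<tau> b a)"
  by (simp add: inverse_arrows_iff)

lemma iso_Symm [simp]: "\<lbrakk>a \<in> Obj C; b \<in> Obj C\<rbrakk> \<Longrightarrow> iso_arrow C (\<tau> a b)"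
  by (rule inverse_arrows_iso[OF inverse_arrows_Symm])

lemma Assoc_natural_Arr:
  assumes "f \<in> Arr C" "g \<in> Arr C" "h \<in> Arr C"
    "a = Cod C f" "b = Cod C g" "c = Cod C h"
  shows "\<alpha> a b c \<cdot> ((f \<boxtimes> g) \<boxtimes> h) = (f \<boxtimes> g \<boxtimes> h) \<cdot> \<alpha> (Dom C f) (Dom C g) (Dom C h)"
  using assms by (intro Assoc_natural) (auto simp: Hom_iff)

lemma Symm_natural_Arr:
  assumes "f \<in> Arr C" "g \<in> Arr C" "a = Cod C f" "b = Cod C g"
  shows "\<tau> a b \<cdot> (f \<boxtimes> g) = (g \<boxtimes> f) \<cdot> \<tau> (Dom C f) (Dom C g)"
  using assms by (intro Symm_natural) (auto simp: Hom_iff)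

lemma LUnit_natural_Arr: "\<lbrakk>f \<in> Arr C; b = Cod C f\<rbrakk> \<Longrightarrow> \<l> b \<cdot> (\<one> \<I> \<boxtimes> f) = f \<cdot> \<l> (Dom C f)"
  by (intro LUnit_natural) (auto simp: Hom_iff)

lemma RUnit_natural_Arr: "\<lbrakk>f \<in> Arr C; b = Cod C f\<rbrakk> \<Longrightarrow> \<r> b \<cdot> (f \<boxtimes> \<one> \<I>) = f \<cdot> \<r> (Dom C f)"
  by (intro RUnit_natural) (auto simp: Hom_iff)

text \<open>Kelly's consequences of the pentagon and the triangle.\<close>

lemma TArr_Unit_faithful:
  assumes "f \<in> Arr C" "g \<in> Arr C" "Dom C f = Dom C g" "Cod C f = Cod C g"
  shows "\<one> \<I> \<boxtimes> f = \<one> \<I> \<boxtimes> g \<Longrightarrow> f = g" "f \<boxtimes> \<one> \<I> = g \<boxtimes> \<one> \<I> \<Longrightarrow> f = g"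
proof -
  show "f = g" if "\<one> \<I> \<boxtimes> f = \<one> \<I> \<boxtimes> g"
    using assms LUnit_natural_Arr[of f "Cod C f"] LUnit_natural_Arr[of g "Cod C f"] that
    by (intro iso_cancel_right[of f "\<l> (Dom C f)" g]) auto
  show "f = g" if "f \<boxtimes> \<one> \<I> = g \<boxtimes> \<one> \<I>"
    using assms RUnit_natural_Arr[of f "Cod C f"] RUnit_natural_Arr[of g "Cod C f"] that
    by (intro iso_cancel_right[of f "\<r> (Dom C f)" g]) auto
qed

text \<open>Tensoring with \<open>\<I>\<close> is faithful since the unitor is a natural
  isomorphism, so the equation may be checked after tensoring with \<open>\<one> \<I>\<close> on the
  right. There the pentagon at \<open>a\<close>, \<open>b\<close>, \<open>\<I>\<close>,
  \<open>\<I>\<close> and two triangles apply, and the remaining \<open>\<alpha> a b \<I>\<close>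
  cancels.\<close>

lemma RUnit_TObj:
  assumes [simp]: "a \<in> Obj C" "b \<in> Obj C"
  shows "(\<one> a \<boxtimes> \<r> b) \<cdot> \<alpha> a b \<I> = \<r> (a \<otimes> b)"
proof (rule TArr_Unit_faithful(2))
  have "\<alpha> a b \<I> \<cdot> (\<r> (a \<otimes> b) \<boxtimes> \<one> \<I>) = \<alpha> a b \<I> \<cdot> ((\<one> a \<boxtimes> \<one> b) \<boxtimes> \<l> \<I>) \<cdot> \<alpha> (a \<otimes> b) \<I> \<I>"
    by (simp add: triangle)
  also have "\<dots> = (\<one> a \<boxtimes> \<one> b \<boxtimes> \<l> \<I>) \<cdot> \<alpha> a b (\<I> \<otimes> \<I>) \<cdot> \<alpha> (a \<otimes> b) \<I> \<I>"
    by (subst Comp_chain[OF Assoc_natural_Arr]) (simp_all del: TArr_Ident_simp)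
  also have "\<dots> = (\<one> a \<boxtimes> ((\<one> b \<boxtimes> \<l> \<I>) \<cdot> \<alpha> b \<I> \<I>)) \<cdot> \<alpha> a (b \<otimes> \<I>) \<I> \<cdot> (\<alpha> a b \<I> \<boxtimes> \<one> \<I>)"
    by (simp flip: pentagon add: TArr_Comp_chain)
  also have "\<dots> = ((\<one> a \<boxtimes> (\<r> b \<boxtimes> \<one> \<I>)) \<cdot> \<alpha> a (b \<otimes> \<I>) \<I>) \<cdot> (\<alpha> a b \<I> \<boxtimes> \<one> \<I>)"
    by (simp add: triangle)
  also have "\<dots> = (\<alpha> a b \<I> \<cdot> ((\<one> a \<boxtimes> \<r> b) \<boxtimes> \<one> \<I>)) \<cdot> (\<alpha> a b \<I> \<boxtimes> \<one> \<I>)"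
    by (subst Assoc_natural_Arr) simp_all
  also have "\<dots> = \<alpha> a b \<I> \<cdot> (((\<one> a \<boxtimes> \<r> b) \<cdot> \<alpha> a b \<I>) \<boxtimes> \<one> \<I>)"
    by (simp add: TArr_Comp_Arr)
  finally show "((\<one> a \<boxtimes> \<r> b) \<cdot> \<alpha> a b \<I>) \<boxtimes> \<one> \<I> = \<r> (a \<otimes> b) \<boxtimes> \<one> \<I>"
    by (rule iso_cancel_left[OF sym]) simp_all
qed simp_all

lemma LUnit_TObj:
  assumes [simp]: "a \<in> Obj C" "b \<in> Obj C"
  shows "\<l> (a \<otimes> b) \<cdot> \<alpha> \<I> a b = \<l> a \<boxtimes> \<one> b"
proof (rule TArr_Unit_faithful(1))
  \<comment> \<open>The part of the pentagon at \<open>\<I>\<close>, \<open>\<I>\<close>,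
    \<open>a\<close>, \<open>b\<close> that precedes the associator in question; it is invertible
    and is cancelled at the end.\<close>
  let ?k = "\<alpha> \<I> (\<I> \<otimes> a) b \<cdot> (\<alpha> \<I> \<I> a \<boxtimes> \<one> b)"
  have "(\<one> \<I> \<boxtimes> (\<l> (a \<otimes> b) \<cdot> \<alpha> \<I> a b)) \<cdot> ?k = (\<one> \<I> \<boxtimes> \<l> (a \<otimes> b)) \<cdot> \<alpha> \<I> \<I> (a \<otimes> b) \<cdot> \<alpha> (\<I> \<otimes> \<I>) a b"
    by (simp flip: pentagon add: TArr_Comp_chain)
  also have "\<dots> = (\<r> \<I> \<boxtimes> \<one> a \<boxtimes> \<one> b) \<cdot> \<alpha> (\<I> \<otimes> \<I>) a b"
    by (subst Comp_chain[OF triangle]) simp_all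
  also have "\<dots> = \<alpha> \<I> a b \<cdot> ((\<r> \<I> \<boxtimes> \<one> a) \<boxtimes> \<one> b)"
    by (subst Assoc_natural_Arr) simp_all
  also have "\<dots> = \<alpha> \<I> a b \<cdot> (((\<one> \<I> \<boxtimes> \<l> a) \<boxtimes> \<one> b) \<cdot> (\<alpha> \<I> \<I> a \<boxtimes> \<one> b))"
    by (simp add: TArr_Comp_Arr triangle)
  also have "\<dots> = (\<one> \<I> \<boxtimes> \<l> a \<boxtimes> \<one> b) \<cdot> ?k"
    by (subst Comp_chain[OF Assoc_natural_Arr]) simp_all
  finally show "\<one> \<I> \<boxtimes> (\<l> (a \<otimes> b) \<cdot> \<alpha> \<I> a b) = \<one> \<I> \<boxtimes> \<l> a \<boxtimes> \<one> b"
    by (rule iso_cancel_right) auto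
qed simp_all

lemma LUnit_Unit: "\<l> \<I> = \<r> \<I>"
proof (rule TArr_Unit_faithful(2))
  \<comment> \<open>Naturality of \<open>\<l>\<close> at the arrow \<open>\<l> \<I>\<close> itself,
    with the invertible \<open>\<l> \<I>\<close> cancelled.\<close>
  have "\<one> \<I> \<boxtimes> \<l> \<I> = \<l> (\<I> \<otimes> \<I>)"
    by (rule iso_cancel_left[of "\<l> \<I>"]) (simp_all add: LUnit_natural_Arr)
  then show "\<l> \<I> \<boxtimes> \<one> \<I> = \<r> \<I> \<boxtimes> \<one> \<I>"
    by (simp flip: triangle LUnit_TObj)
qed simp_all

end

section \<open>The endomorphism PROP of an object\<close>

text \<open>The separate clause for exponent 1 makes that power \<open>A\<close> on the nose rather
  than \<open>A \<otimes> \<I>\<close>. The structure maps of a bimonoid on \<open>A\<close> are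
  then arrows between powers without any unitor.\<close>

fun obj_power :: "('o, 'm, 'z) sm_category_scheme \<Rightarrow> 'o \<Rightarrow> nat \<Rightarrow> 'o" where
  "obj_power C A 0 = \<I>\<^bsub>C\<^esub>"
| "obj_power C A (Suc 0) = A"
| "obj_power C A (Suc (Suc n)) = A \<otimes>\<^bsub>C\<^esub> obj_power C A (Suc n)"

text \<open>The canonical isomorphism from the product of the powers \<open>m\<close> and
  \<open>n\<close> to the power \<open>m + n\<close>, which moves brackets to the right. For
  \<open>m = 1\<close> and \<open>n = 0\<close> the target is \<open>A\<close> and not
  \<open>A \<otimes> \<I>\<close>, whence the extra right unitor.\<close>

fun power_join :: "('o, 'm, 'z) sm_category_scheme \<Rightarrow> 'o \<Rightarrow> nat \<Rightarrow> nat \<Rightarrow> 'm" where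
  "power_join C A 0 n = \<l>\<^bsub>C\<^esub> (obj_power C A n)"
| "power_join C A (Suc 0) n = (if n = 0 then \<r>\<^bsub>C\<^esub> A else \<one>\<^bsub>C\<^esub> (A \<otimes>\<^bsub>C\<^esub> obj_power C A n))"
| "power_join C A (Suc (Suc m)) n =
    (\<one>\<^bsub>C\<^esub> A \<boxtimes>\<^bsub>C\<^esub> power_join C A (Suc m) n) \<cdot>\<^bsub>C\<^esub> \<alpha>\<^bsub>C\<^esub> A (obj_power C A (Suc m)) (obj_power C A n)"

text \<open>This PROP is strict because rebracketing is absorbed into \<^const>\<open>power_join\<close>.\<close>

definition endo_prop ::
  "('o, 'm, 'z) sm_category_scheme \<Rightarrow> 'o \<Rightarrow> (nat, nat \<times> 'm \<times> nat) sm_category" where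
  "endo_prop C A =
     \<lparr>Obj = UNIV,
      Arr = {(m, f, n). f \<in> Hom C (obj_power C A m) (obj_power C A n)},
      Dom = (\<lambda>(m, f, n). m),
      Cod = (\<lambda>(m, f, n). n),
      Ident = (\<lambda>n. (n, \<one>\<^bsub>C\<^esub> (obj_power C A n), n)),
      Comp = (\<lambda>(n', g, k) (m, f, n). (m, g \<cdot>\<^bsub>C\<^esub> f, k)),
      TObj = (\<lambda>m n. m + n),
      TArr = (\<lambda>(m, f, n) (m', f', n').
        (m + m', power_join C A n n' \<cdot>\<^bsub>C\<^esub> (f \<boxtimes>\<^bsub>C\<^esub> f') \<cdot>\<^bsub>C\<^esub> inv_arrow C (power_join C A m m'), n + n')),
      Unit = 0,
      Assoc = (\<lambda>m n k. (m + n + k, \<one>\<^bsub>C\<^esub> (obj_power C A (m + n + k)), m + n + k)),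
      LUnit = (\<lambda>n. (n, \<one>\<^bsub>C\<^esub> (obj_power C A n), n)),
      RUnit = (\<lambda>n. (n, \<one>\<^bsub>C\<^esub> (obj_power C A n), n)),
      Symm = (\<lambda>m n. (m + n, power_join C A n m \<cdot>\<^bsub>C\<^esub> \<tau>\<^bsub>C\<^esub> (obj_power C A m) (obj_power C A n)
        \<cdot>\<^bsub>C\<^esub> inv_arrow C (power_join C A m n), n + m))\<rparr>"

locale sm_object = symmetric_monoidal_category C
  for C :: "('o, 'm, 'z) sm_category_scheme" (structure) +
  fixes A :: 'o
  assumes A_Obj [simp]: "A \<in> Obj C"
begin

abbreviation X where "X \<equiv> obj_power C A"
abbreviation \<phi> where "\<phi> \<equiv> power_join C A"

lemma X_Obj [simp]: "X n \<in> Obj C"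
  by (induction n rule: induct_nat_012) auto

lemma power_join_simps [simp]:
  "\<phi> m n \<in> Arr C" "Dom C (\<phi> m n) = X m \<otimes> X n" "Cod C (\<phi> m n) = X (m + n)"
proof -
  have "\<phi> m n \<in> Hom C (X m \<otimes> X n) (X (m + n))"
  proof (induction m rule: induct_nat_012)
    case 1
    show ?case by (cases n) (auto simp: Hom_iff)
  next
    case (ge2 m)
    then show ?case by (auto simp: Hom_iff)
  qed (auto simp: Hom_iff)
  then show "\<phi> m n \<in> Arr C" "Dom C (\<phi> m n) = X m \<otimes> X n" "Cod C (\<phi> m n) = X (m + n)"
    by (simp_all add: Hom_iff)
qed

lemma power_join_iso [simp]: "iso_arrow C (\<phi> m n)"
  by (induction m rule: induct_nat_012) (auto simp del: obj_power.simps)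

text \<open>The recursion runs over the left exponent, so the unit on the right needs proof: the two
  unitors agree at \<open>\<I>\<close>, and the right unitor of a product is the right unitor of its
  last factor up to the associator.\<close>

lemma power_join_0_right: "\<phi> n 0 = \<r> (X n)"
  by (induction n rule: induct_nat_012) (auto simp: LUnit_Unit RUnit_TObj)

text \<open>All the coherence behind the strict PROP is in this equation. The case
  \<open>m = 0\<close> is the compatibility of the left unitor with products, \<open>m = 1\<close>
  is the triangle when \<open>n = 0\<close> and immediate otherwise, and the inductive step is the
  pentagon between two uses of naturality of the associator.\<close>

lemma power_join_assoc:
  "\<phi> (m + n) k \<cdot> (\<phi> m n \<boxtimes> \<one> (X k)) = \<phi> m (n + k) \<cdot> (\<one> (X m) \<boxtimes> \<phi> n k) \<cdot> \<alpha> (X m) (X n) (X k)"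
proof (induction m rule: induct_nat_012)
  case 0
  show ?case
    by (simp add: Comp_chain[OF LUnit_natural_Arr] LUnit_TObj)
next
  case 1
  show ?case
  proof (cases n)
    case 0
    then show ?thesis by (cases k) (simp_all add: triangle del: obj_power.simps(3))
  next
    case (Suc n')
    then show ?thesis by simp
  qed
next
  case (ge2 m)
  let ?m = "Suc m"
  have "\<phi> (Suc ?m + n) k \<cdot> (\<phi> (Suc ?m) n \<boxtimes> \<one> (X k))
      = (\<one> A \<boxtimes> \<phi> (?m + n) k) \<cdot> \<alpha> A (X (?m + n)) (X k)
        \<cdot> (((\<one> A \<boxtimes> \<phi> ?m n) \<boxtimes> \<one> (X k)) \<cdot> (\<alpha> A (X ?m) (X n) \<boxtimes> \<one> (X k)))"
    by (simp add: TArr_Comp_Arr)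
  also have "\<dots> = (\<one> A \<boxtimes> \<phi> (?m + n) k) \<cdot> (\<one> A \<boxtimes> (\<phi> ?m n \<boxtimes> \<one> (X k)))
      \<cdot> \<alpha> A (X ?m \<otimes> X n) (X k) \<cdot> (\<alpha> A (X ?m) (X n) \<boxtimes> \<one> (X k))"
    by (subst Comp_chain[OF Assoc_natural_Arr]) (simp_all del: obj_power.simps)
  also have "\<dots> = (\<one> A \<boxtimes> (\<phi> (?m + n) k \<cdot> (\<phi> ?m n \<boxtimes> \<one> (X k))))
      \<cdot> \<alpha> A (X ?m \<otimes> X n) (X k) \<cdot> (\<alpha> A (X ?m) (X n) \<boxtimes> \<one> (X k))"
    by (simp add: TArr_Comp_chain del: obj_power.simps power_join.simps)
  also have "\<dots> = (\<one> A \<boxtimes> \<phi> ?m (n + k)) \<cdot> (\<one> A \<boxtimes> \<one> (X ?m) \<boxtimes> \<phi> n k) \<cdot> (\<one> A \<boxtimes> \<alpha> (X ?m) (X n) (X k))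
      \<cdot> \<alpha> A (X ?m \<otimes> X n) (X k) \<cdot> (\<alpha> A (X ?m) (X n) \<boxtimes> \<one> (X k))"
    using ge2(2) by (simp add: TArr_Comp_chain del: obj_power.simps power_join.simps)
  also have "\<dots> = (\<one> A \<boxtimes> \<phi> ?m (n + k)) \<cdot> (\<one> A \<boxtimes> \<one> (X ?m) \<boxtimes> \<phi> n k)
      \<cdot> \<alpha> A (X ?m) (X n \<otimes> X k) \<cdot> \<alpha> (A \<otimes> X ?m) (X n) (X k)"
    by (simp add: pentagon del: obj_power.simps power_join.simps)
  also have "\<dots> = (\<one> A \<boxtimes> \<phi> ?m (n + k)) \<cdot> \<alpha> A (X ?m) (X (n + k))
      \<cdot> ((\<one> A \<boxtimes> \<one> (X ?m)) \<boxtimes> \<phi> n k) \<cdot> \<alpha> (A \<otimes> X ?m) (X n) (X k)"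
    by (subst Comp_chain[OF Assoc_natural_Arr]) (simp_all del: obj_power.simps TArr_Ident_simp)
  finally show ?case
    by simp
qed

lemma power_join_assoc_inv:
  "(inv_arrow C (\<phi> m n) \<boxtimes> \<one> (X k)) \<cdot> inv_arrow C (\<phi> (m + n) k)
    = inv_arrow C (\<alpha> (X m) (X n) (X k)) \<cdot> (\<one> (X m) \<boxtimes> inv_arrow C (\<phi> n k)) \<cdot> inv_arrow C (\<phi> m (n + k))"
proof -
  have "inv_arrow C (\<phi> (m + n) k \<cdot> (\<phi> m n \<boxtimes> \<one> (X k)))
    = inv_arrow C (\<phi> m (n + k) \<cdot> (\<one> (X m) \<boxtimes> \<phi> n k) \<cdot> \<alpha> (X m) (X n) (X k))"
    by (simp only: power_join_assoc)
  then show ?thesis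
    by (simp add: inv_Comp inv_TArr add.assoc)
qed

section \<open>The tensor powers of an object as a strict PROP\<close>

abbreviation T where "T \<equiv> endo_prop C A"

lemma endo_prop_simps [simp]:
  "Obj T = UNIV"
  "(m, f, n) \<in> Arr T \<longleftrightarrow> f \<in> Arr C \<and> Dom C f = X m \<and> Cod C f = X n"
  "Dom T (m, f, n) = m" "Cod T (m, f, n) = n"
  "Ident T n = (n, \<one> (X n), n)"
  "Comp T (n', g, k) (m, f, n) = (m, g \<cdot> f, k)"
  "TObj T m n = m + n"
  "TArr T (m, f, n) (m', f', n')
     = (m + m', \<phi> n n' \<cdot> (f \<boxtimes> f') \<cdot> inv_arrow C (\<phi> m m'), n + n')"
  "Unit T = 0"
  "Assoc T m n k = (m + n + k, \<one> (X (m + n + k)), m + n + k)"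
  "LUnit T n = (n, \<one> (X n), n)"
  "RUnit T n = (n, \<one> (X n), n)"
  "Symm T m n = (m + n, \<phi> n m \<cdot> \<tau> (X m) (X n) \<cdot> inv_arrow C (\<phi> m n), n + m)"
  by (simp_all add: endo_prop_def Hom_iff)

declare obj_power.simps [simp del] power_join.simps [simp del]

lemma endo_category: "category T"
  by unfold_locales (auto simp: Hom_iff)

text \<open>The tensor product of the PROP is that of \<open>C\<close> conjugated by joins.
  \<open>power_join_assoc\<close> on the left and its inverse on the right produce an associator and
  its inverse, which cancel by naturality.\<close>

lemma TArr_endo_assoc:
  assumes "f \<in> Arr C" "Dom C f = X m" "Cod C f = X m'"
    and "g \<in> Arr C" "Dom C g = X n" "Cod C g = X n'"
    and "h \<in> Arr C" "Dom C h = X k" "Cod C h = X k'"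
  shows "\<phi> (m' + n') k' \<cdot> ((\<phi> m' n' \<cdot> (f \<boxtimes> g) \<cdot> inv_arrow C (\<phi> m n)) \<boxtimes> h) \<cdot> inv_arrow C (\<phi> (m + n) k)
    = \<phi> m' (n' + k') \<cdot> (f \<boxtimes> (\<phi> n' k' \<cdot> (g \<boxtimes> h) \<cdot> inv_arrow C (\<phi> n k))) \<cdot> inv_arrow C (\<phi> m (n + k))"
    (is "?lhs = ?rhs")
proof -
  have "?lhs = (\<phi> (m' + n') k' \<cdot> (\<phi> m' n' \<boxtimes> \<one> (X k')))
      \<cdot> ((f \<boxtimes> g) \<boxtimes> h) \<cdot> (inv_arrow C (\<phi> m n) \<boxtimes> \<one> (X k)) \<cdot> inv_arrow C (\<phi> (m + n) k)"
    using assms by (simp add: TArr_Comp_chain)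
  also have "\<dots> = \<phi> m' (n' + k') \<cdot> (\<one> (X m') \<boxtimes> \<phi> n' k') \<cdot> (\<alpha> (X m') (X n') (X k') \<cdot> ((f \<boxtimes> g) \<boxtimes> h))
    \<cdot> inv_arrow C (\<alpha> (X m) (X n) (X k)) \<cdot> (\<one> (X m) \<boxtimes> inv_arrow C (\<phi> n k)) \<cdot> inv_arrow C (\<phi> m (n + k))"
    using assms by (simp add: power_join_assoc power_join_assoc_inv add.assoc)
  also have "\<dots> = ?rhs"
    using assms by (simp add: Assoc_natural_Arr TArr_Comp_chain)
  finally show ?thesis .
qed

text \<open>After the inner joins cancel, the associativity of joins exposes the hexagon of
  \<open>C\<close>. Naturality of the symmetry at the join \<open>\<phi> b c\<close> then turns
  \<open>X b \<otimes> X c\<close> into \<open>X (b + c)\<close>.\<close>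

lemma Symm_endo_hexagon:
  "\<phi> b (c + a) \<cdot> (\<one> (X b) \<boxtimes> (\<phi> c a \<cdot> \<tau> (X a) (X c) \<cdot> inv_arrow C (\<phi> a c)))
    \<cdot> inv_arrow C (\<phi> b (a + c)) \<cdot> \<phi> (b + a) c
    \<cdot> ((\<phi> b a \<cdot> \<tau> (X a) (X b) \<cdot> inv_arrow C (\<phi> a b)) \<boxtimes> \<one> (X c)) \<cdot> inv_arrow C (\<phi> (a + b) c)
    = \<phi> (b + c) a \<cdot> \<tau> (X a) (X (b + c)) \<cdot> inv_arrow C (\<phi> a (b + c))" (is "?lhs = ?rhs")
proof -
  let ?\<psi> = "\<lambda>m n. inv_arrow C (\<phi> m n)"
  have "?lhs = \<phi> b (c + a) \<cdot> (\<one> (X b) \<boxtimes> (\<phi> c a \<cdot> \<tau> (X a) (X c) \<cdot> ?\<psi> a c))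
    \<cdot> ?\<psi> b (a + c) \<cdot> (\<phi> (b + a) c \<cdot> (\<phi> b a \<boxtimes> \<one> (X c)))
    \<cdot> (\<tau> (X a) (X b) \<boxtimes> \<one> (X c)) \<cdot> ((?\<psi> a b \<boxtimes> \<one> (X c)) \<cdot> ?\<psi> (a + b) c)"
    by (simp add: TArr_Comp_chain add.assoc)
  also have "\<dots> = \<phi> b (c + a) \<cdot> (\<one> (X b) \<boxtimes> \<phi> c a) \<cdot> ((\<one> (X b) \<boxtimes> \<tau> (X a) (X c)) \<cdot> \<alpha> (X b) (X a) (X c)
    \<cdot> (\<tau> (X a) (X b) \<boxtimes> \<one> (X c))) \<cdot> inv_arrow C (\<alpha> (X a) (X b) (X c)) \<cdot> (\<one> (X a) \<boxtimes> ?\<psi> b c) \<cdot> ?\<psi> a (b + c)"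
    by (simp add: power_join_assoc power_join_assoc_inv TArr_Comp_chain add.assoc)
  also have "\<dots> = (\<phi> b (c + a) \<cdot> (\<one> (X b) \<boxtimes> \<phi> c a) \<cdot> \<alpha> (X b) (X c) (X a))
    \<cdot> \<tau> (X a) (X b \<otimes> X c) \<cdot> (\<one> (X a) \<boxtimes> ?\<psi> b c) \<cdot> ?\<psi> a (b + c)"
    by (simp flip: hexagon add: add.assoc)
  also have "\<dots> = \<phi> (b + c) a \<cdot> ((\<phi> b c \<boxtimes> \<one> (X a)) \<cdot> \<tau> (X a) (X b \<otimes> X c)) \<cdot> (\<one> (X a) \<boxtimes> ?\<psi> b c) \<cdot> ?\<psi> a (b + c)"
    by (simp flip: power_join_assoc add: add.assoc)
  also have "(\<phi> b c \<boxtimes> \<one> (X a)) \<cdot> \<tau> (X a) (X b \<otimes> X c) = \<tau> (X a) (X (b + c)) \<cdot> (\<one> (X a) \<boxtimes> \<phi> b c)"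
    by (simp add: Symm_natural_Arr)
  finally show ?thesis
    by (simp add: TArr_Comp_chain)
qed

lemma endo_smc: "symmetric_monoidal_category T"
proof -
  interpret T: category T by (rule endo_category)
  have iso: "iso_arrow T (n, \<one> (X n), n)" for n
    using T.iso_Ident[of n] by simp
  show ?thesis
  proof unfold_locales
    fix f a a' g b b' h c c'
    assume "f \<in> Hom T a a'" "g \<in> Hom T b b'" "h \<in> Hom T c c'"
    then show "Comp T (Assoc T a' b' c') (TArr T (TArr T f g) h)
        = Comp T (TArr T f (TArr T g h)) (Assoc T a b c)"
      using TArr_endo_assoc[of "fst (snd f)" a a' "fst (snd g)" b b' "fst (snd h)" c c']
      by (cases f; cases g; cases h) (simp add: Hom_iff add.assoc)
  next
    fix f a b
    assume "f \<in> Hom T a b"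
    then show "Comp T (LUnit T b) (TArr T (Ident T (Unit T)) f) = Comp T f (LUnit T a)"
      by (cases f) (simp add: Hom_iff power_join.simps obj_power.simps Comp_chain[OF LUnit_natural_Arr])
  next
    fix f a b
    assume "f \<in> Hom T a b"
    then show "Comp T (RUnit T b) (TArr T f (Ident T (Unit T))) = Comp T f (RUnit T a)"
      by (cases f)
        (simp add: Hom_iff power_join_0_right obj_power.simps Comp_chain[OF RUnit_natural_Arr])
  next
    fix f a a' g b b'
    assume "f \<in> Hom T a a'" "g \<in> Hom T b b'"
    then show "Comp T (Symm T a' b') (TArr T f g) = Comp T (TArr T g f) (Symm T a b)"
      by (cases f; cases g) (simp add: Hom_iff Comp_chain[OF Symm_natural_Arr])
  next
    fix a b :: nat
    show "Comp T (Symm T b a) (Symm T a b) = Ident T (TObj T a b)"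
      by (simp add: Comp_chain[OF Symm_simps(4)])
  next
    fix a b c :: nat
    show "Comp T (Assoc T b c a) (Comp T (Symm T a (TObj T b c)) (Assoc T a b c))
      = Comp T (TArr T (Ident T b) (Symm T a c)) (Comp T (Assoc T b a c) (TArr T (Symm T a b) (Ident T c)))"
      by (simp add: Symm_endo_hexagon add.assoc)
  qed (auto simp: iso Hom_iff add.assoc TArr_Comp_chain)
qed

lemma endo_prop_category: "prop_category T"
proof -
  interpret T: symmetric_monoidal_category T by (rule endo_smc)
  show ?thesis
    by unfold_locales (simp_all add: add.assoc)
qed

text \<open>Strictness of the PROP is paid for here: the joins that were absorbed into its tensor
  product return as the structure isomorphisms of the functor back to \<open>C\<close>.\<close>

definition endo_functor :: "(nat, nat \<times> 'm \<times> nat, 'o, 'm) mon_map" where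
  "endo_functor = \<lparr>FObj = X, FArr = (\<lambda>(m, f, n). f), Phi = \<phi>, Phi0 = \<one> \<I>\<rparr>"

lemma endo_functor_simps [simp]:
  "FObj endo_functor = X" "FArr endo_functor (m, f, n) = f"
  "Phi endo_functor = \<phi>" "Phi0 endo_functor = \<one> \<I>"
  by (simp_all add: endo_functor_def)

lemma endo_functor_smf: "symmetric_monoidal_functor T C endo_functor"
proof -
  interpret T: symmetric_monoidal_category T by (rule endo_smc)
  show ?thesis
  proof unfold_locales
    fix a b c :: nat
    show "FArr endo_functor (Assoc T a b c) \<cdot> Phi endo_functor (TObj T a b) c
        \<cdot> (Phi endo_functor a b \<boxtimes> \<one> (FObj endo_functor c))
      = Phi endo_functor a (TObj T b c) \<cdot> (\<one> (FObj endo_functor a) \<boxtimes> Phi endo_functor b c)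
        \<cdot> \<alpha> (FObj endo_functor a) (FObj endo_functor b) (FObj endo_functor c)"
      by (simp add: power_join_assoc add.assoc)
  next
    fix a :: nat
    show "FArr endo_functor (LUnit T a) \<cdot> Phi endo_functor (Unit T) a
        \<cdot> (Phi0 endo_functor \<boxtimes> \<one> (FObj endo_functor a)) = \<l> (FObj endo_functor a)"
      by (simp add: power_join.simps)
  next
    fix a :: nat
    show "FArr endo_functor (RUnit T a) \<cdot> Phi endo_functor a (Unit T)
        \<cdot> (\<one> (FObj endo_functor a) \<boxtimes> Phi0 endo_functor) = \<r> (FObj endo_functor a)"
      by (simp add: power_join_0_right)
  qed (auto simp: Hom_iff obj_power.simps)
qed

end

section \<open>Bimonoids in a PROP as biproduct structures\<close>

context prop_category
begin

lemma prop_Obj [simp]: "Obj T = UNIV" by (rule Obj_nat)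
lemma prop_TObj [simp]: "m \<otimes> n = m + n" by (rule TObj_add)

lemma prop_Unit [simp]: "\<I> = 0"
  using TObj_Unit_left[of 0] by simp

lemma prop_Assoc [simp]: "\<alpha> a b c = \<one> (a + b + c)"
  using Assoc_Ident[of a b c] by (simp add: add.assoc)

lemma prop_LUnit [simp]: "\<l> a = \<one> a" by (simp add: LUnit_Ident)
lemma prop_RUnit [simp]: "\<r> a = \<one> a" by (simp add: RUnit_Ident)

lemma TArr_assoc [simp]:
  "\<lbrakk>f \<in> Arr T; g \<in> Arr T; h \<in> Arr T\<rbrakk> \<Longrightarrow> (f \<boxtimes> g) \<boxtimes> h = f \<boxtimes> g \<boxtimes> h"
  using Assoc_natural_Arr[of f g h "Cod T f" "Cod T g" "Cod T h"] by (simp add: add.assoc)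

lemma TArr_0_left [simp]: "f \<in> Arr T \<Longrightarrow> \<one> 0 \<boxtimes> f = f"
  using LUnit_natural_Arr[of f] by simp

lemma TArr_0_right [simp]: "f \<in> Arr T \<Longrightarrow> f \<boxtimes> \<one> 0 = f"
  using RUnit_natural_Arr[of f] by simp

lemma TArr_Ident_Ident [simp]: "f \<in> Arr T \<Longrightarrow> \<one> a \<boxtimes> \<one> b \<boxtimes> f = \<one> (a + b) \<boxtimes> f"
  by (simp flip: TArr_assoc)

lemma Symm_add_right: "\<tau> a (b + c) = (\<one> b \<boxtimes> \<tau> a c) \<cdot> (\<tau> a b \<boxtimes> \<one> c)"
proof -
  show ?thesis
    using hexagon[of a b c] by (simp add: add.assoc)
qed

text \<open>Only one hexagon is an axiom. The other follows by comparing inverses: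
  \<open>\<tau> c (a + b)\<close> is invertible and decomposes by \<open>Symm_add_right\<close>, so
  both sides are compared after composing with it.\<close>

lemma Symm_add_left: "\<tau> (a + b) c = (\<tau> a c \<boxtimes> \<one> b) \<cdot> (\<one> a \<boxtimes> \<tau> b c)"
proof (rule iso_cancel_right)
  have "((\<tau> a c \<boxtimes> \<one> b) \<cdot> (\<one> a \<boxtimes> \<tau> b c)) \<cdot> \<tau> c (a + b)
    = (\<tau> a c \<boxtimes> \<one> b) \<cdot> (\<one> a \<boxtimes> \<tau> b c) \<cdot> (\<one> a \<boxtimes> \<tau> c b) \<cdot> (\<tau> c a \<boxtimes> \<one> b)"
    by (simp add: Symm_add_right add.assoc)
  also have "\<dots> = \<one> (c + (a + b))"
    by (simp add: TArr_Comp_chain) (simp add: TArr_Comp_Arr add.assoc)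
  finally show "\<tau> (a + b) c \<cdot> \<tau> c (a + b) = ((\<tau> a c \<boxtimes> \<one> b) \<cdot> (\<one> a \<boxtimes> \<tau> b c)) \<cdot> \<tau> c (a + b)"
    by simp
qed (simp_all add: add.assoc)

text \<open>The hexagon with two zeros says that \<open>\<tau> a 0\<close> is idempotent, and an
  idempotent isomorphism is an identity.\<close>

lemma Symm_0 [simp]: "\<tau> a 0 = \<one> a" "\<tau> 0 a = \<one> a"
proof -
  show *: "\<tau> a 0 = \<one> a"
    by (rule iso_cancel_left[of "\<tau> a 0"]) (use Symm_add_right[of a 0 0] in simp_all)
  show "\<tau> 0 a = \<one> a"
    using Symm_simps(4)[of a 0] by (simp add: *)
qed

end

text \<open>Comonoids are monoids in the opposite PROP, so every fact about monoids dualises.\<close>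

definition opposite_prop :: "(nat, 'm, 'z) sm_category_scheme \<Rightarrow> (nat, 'm, 'z) sm_category_scheme" where
  "opposite_prop T = T\<lparr>Dom := Cod T, Cod := Dom T, Comp := (\<lambda>g f. f \<cdot>\<^bsub>T\<^esub> g), Symm := (\<lambda>a b. \<tau>\<^bsub>T\<^esub> b a)\<rparr>"

lemma opposite_prop_simps [simp]:
  "Obj (opposite_prop T) = Obj T" "Arr (opposite_prop T) = Arr T"
  "Dom (opposite_prop T) = Cod T" "Cod (opposite_prop T) = Dom T"
  "Ident (opposite_prop T) = Ident T" "Comp (opposite_prop T) g f = Comp T f g"
  "TObj (opposite_prop T) = TObj T" "TArr (opposite_prop T) = TArr T"
  "Unit (opposite_prop T) = Unit T" "Assoc (opposite_prop T) = Assoc T"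
  "LUnit (opposite_prop T) = LUnit T" "RUnit (opposite_prop T) = RUnit T"
  "Symm (opposite_prop T) a b = Symm T b a"
  by (simp_all add: opposite_prop_def)

lemma (in prop_category) opposite_prop_category: "prop_category (opposite_prop T)"
proof -
  have iso: "iso_arrow (opposite_prop T) (\<one> n)" for n
    unfolding iso_arrow_def by (rule exI[of _ "\<one> n"]) (simp add: inverse_arrows_def Hom_iff)
  show ?thesis
  proof unfold_locales
    fix f a a' g b b'
    assume "f \<in> Hom (opposite_prop T) a a'" "g \<in> Hom (opposite_prop T) b b'"
    then show "Comp (opposite_prop T) (Symm (opposite_prop T) a' b') (TArr (opposite_prop T) f g)
      = Comp (opposite_prop T) (TArr (opposite_prop T) g f) (Symm (opposite_prop T) a b)"
      using Symm_natural_Arr[of g f b a] by (auto simp: Hom_iff)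
  next
    \<comment> \<open>Reversing arrows exchanges the two hexagons, so this one is
      \<open>Symm_add_left\<close> in the original PROP.\<close>
    fix a b c
    show "Comp (opposite_prop T) (Assoc (opposite_prop T) b c a)
        (Comp (opposite_prop T) (Symm (opposite_prop T) a (TObj (opposite_prop T) b c)) (Assoc (opposite_prop T) a b c))
      = Comp (opposite_prop T) (TArr (opposite_prop T) (Ident (opposite_prop T) b) (Symm (opposite_prop T) a c))
        (Comp (opposite_prop T) (Assoc (opposite_prop T) b a c)
          (TArr (opposite_prop T) (Symm (opposite_prop T) a b) (Ident (opposite_prop T) c)))"
      by (simp add: Symm_add_left add.assoc)
  qed (auto simp: Hom_iff iso add.assoc TArr_Comp_Arr)
qed

section \<open>The structure induced on every object by a commutative monoid on 1\<close>

context prop_category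
begin

lemma Ident_TArr_Comp:
  "\<lbrakk>f \<in> Arr T; g \<in> Arr T; Dom T g = Cod T f\<rbrakk> \<Longrightarrow> \<one> a \<boxtimes> (g \<cdot> f) = (\<one> a \<boxtimes> g) \<cdot> (\<one> a \<boxtimes> f)"
  by (simp add: TArr_Comp_Arr)

lemma TArr_Comp_Ident:
  "\<lbrakk>f \<in> Arr T; g \<in> Arr T; Dom T g = Cod T f\<rbrakk> \<Longrightarrow> (g \<cdot> f) \<boxtimes> \<one> a = (g \<boxtimes> \<one> a) \<cdot> (f \<boxtimes> \<one> a)"
  by (simp add: TArr_Comp_Arr)

text \<open>The usual multiplication on a tensor product of two monoids. It is defined for arbitrary
  arrows \<open>f\<close> and \<open>g\<close>, so that its associativity is a statement about
  permutations only.\<close>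

definition join :: "nat \<Rightarrow> nat \<Rightarrow> 'm \<Rightarrow> 'm \<Rightarrow> 'm" where
  "join a b f g = (f \<boxtimes> g) \<cdot> (\<one> a \<boxtimes> \<tau> b a \<boxtimes> \<one> b)"

lemma join_simps [simp]:
  assumes "f \<in> Arr T" "g \<in> Arr T" "Dom T f = a + a" "Dom T g = b + b"
  shows "join a b f g \<in> Arr T" "Dom T (join a b f g) = a + b + (a + b)"
    "Cod T (join a b f g) = Cod T f + Cod T g"
  using assms by (simp_all add: join_def add.assoc)

lemma join_0 [simp]:
  assumes "f \<in> Arr T" "Dom T f = b + b"
  shows "join 0 b (\<one> 0) f = f"
  using assms by (simp add: join_def)

lemma join_assoc:
  assumes [simp]: "f \<in> Arr T" "g \<in> Arr T" "h \<in> Arr T"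
    "Dom T f = a + a" "Dom T g = b + b" "Dom T h = c + c"
  shows "join (a + b) c (join a b f g) h = join a (b + c) f (join b c g h)"
proof -
  \<comment> \<open>The outermost \<open>a\<close> and \<open>c\<close> stay fixed. What remains is
    the permutation taking \<open>b\<close>, \<open>c\<close>, \<open>a\<close>, \<open>b\<close> to
    \<open>a\<close>, \<open>b\<close>, \<open>b\<close>, \<open>c\<close>; the two bracketings
    factor it differently and \<open>?p\<close> is a common form.\<close>
  let ?p = "(\<tau> b a \<boxtimes> \<tau> c b) \<cdot> (\<one> b \<boxtimes> \<tau> c a \<boxtimes> \<one> b)"
  have 1: "(\<tau> b a \<boxtimes> \<one> (b + c)) \<cdot> (\<one> b \<boxtimes> \<tau> c (a + b)) = ?p"
    by (simp add: Symm_add_right Ident_TArr_Comp) (simp add: TArr_Comp_chain ac_simps)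
  have 2: "(\<one> (a + b) \<boxtimes> \<tau> c b) \<cdot> (\<tau> (b + c) a \<boxtimes> \<one> b) = ?p"
    by (simp add: Symm_add_left TArr_Comp_Ident) (simp add: TArr_Comp_chain ac_simps)
  have "join (a + b) c (join a b f g) h
      = ((f \<boxtimes> g) \<boxtimes> h) \<cdot> ((\<one> a \<boxtimes> \<tau> b a \<boxtimes> \<one> b) \<boxtimes> \<one> (c + c)) \<cdot> (\<one> (a + b) \<boxtimes> \<tau> c (a + b) \<boxtimes> \<one> c)"
    by (simp add: join_def TArr_Comp_chain ac_simps del: TArr_assoc)
  also have "\<dots> = (f \<boxtimes> g \<boxtimes> h) \<cdot> (\<one> a \<boxtimes> ((\<tau> b a \<boxtimes> \<one> (b + c)) \<cdot> (\<one> b \<boxtimes> \<tau> c (a + b))) \<boxtimes> \<one> c)"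
    by (simp add: Ident_TArr_Comp TArr_Comp_Ident ac_simps)
  finally have 3: "join (a + b) c (join a b f g) h = \<dots>" .
  have "join a (b + c) f (join b c g h)
      = (f \<boxtimes> (g \<boxtimes> h)) \<cdot> (\<one> (a + a) \<boxtimes> (\<one> b \<boxtimes> \<tau> c b \<boxtimes> \<one> c)) \<cdot> (\<one> a \<boxtimes> \<tau> (b + c) a \<boxtimes> \<one> (b + c))"
    by (simp add: join_def TArr_Comp_chain ac_simps del: TArr_Ident_Ident)
  also have "\<dots> = (f \<boxtimes> g \<boxtimes> h) \<cdot> (\<one> a \<boxtimes> ((\<one> (a + b) \<boxtimes> \<tau> c b) \<cdot> (\<tau> (b + c) a \<boxtimes> \<one> b)) \<boxtimes> \<one> c)"
    by (simp add: Ident_TArr_Comp TArr_Comp_Ident ac_simps)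
  finally have 4: "join a (b + c) f (join b c g h) = \<dots>" .
  show ?thesis by (simp only: 1 2 3 4)
qed

end

locale prop_monoid = prop_category T
  for T :: "(nat, 'm, 'z) sm_category_scheme" (structure) +
  fixes \<mu> \<eta> :: 'm
  assumes \<mu>_Hom: "\<mu> \<in> Hom T 2 1"
    and \<eta>_Hom: "\<eta> \<in> Hom T 0 1"
    and \<mu>_assoc: "\<mu> \<cdot> (\<mu> \<boxtimes> \<one> 1) = \<mu> \<cdot> (\<one> 1 \<boxtimes> \<mu>)"
    and \<mu>_\<eta>_left: "\<mu> \<cdot> (\<eta> \<boxtimes> \<one> 1) = \<one> 1"
    and \<mu>_\<eta>_right: "\<mu> \<cdot> (\<one> 1 \<boxtimes> \<eta>) = \<one> 1"
    and \<mu>_comm: "\<mu> \<cdot> \<tau> 1 1 = \<mu>"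
begin

lemma \<mu>_\<eta>_simps [simp]:
  "\<mu> \<in> Arr T" "Dom T \<mu> = Suc (Suc 0)" "Cod T \<mu> = Suc 0"
  "\<eta> \<in> Arr T" "Dom T \<eta> = 0" "Cod T \<eta> = Suc 0"
  using \<mu>_Hom \<eta>_Hom by (simp_all add: Hom_iff)

primrec mult :: "nat \<Rightarrow> 'm" where
  "mult 0 = \<one> 0"
| "mult (Suc n) = join 1 n \<mu> (mult n)"

primrec unit :: "nat \<Rightarrow> 'm" where
  "unit 0 = \<one> 0"
| "unit (Suc n) = \<eta> \<boxtimes> unit n"

lemma mult_simps [simp]: "mult n \<in> Arr T" "Dom T (mult n) = n + n" "Cod T (mult n) = n"
  by (induction n) auto

lemma unit_simps [simp]: "unit n \<in> Arr T" "Dom T (unit n) = 0" "Cod T (unit n) = n"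
  by (induction n) auto

declare mult.simps [simp del] unit.simps [simp del]

lemma mult_0 [simp]: "mult 0 = \<one> 0" by (simp add: mult.simps)
lemma unit_0 [simp]: "unit 0 = \<one> 0" by (simp add: unit.simps)
lemma mult_1 [simp]: "mult (Suc 0) = \<mu>" by (simp add: mult.simps join_def)
lemma unit_1 [simp]: "unit (Suc 0) = \<eta>" by (simp add: unit.simps)

lemma mult_add: "mult (a + b) = join a b (mult a) (mult b)"
proof (induction a)
  case (Suc a)
  then show ?case
    using join_assoc[of \<mu> "mult a" "mult b" 1 a b] by (simp add: mult.simps)
qed simp

lemma unit_add: "unit (a + b) = unit a \<boxtimes> unit b"
  by (induction a) (simp_all add: unit.simps)

text \<open>A unit slides through the middle swap by naturality, because the symmetry with the
  object 0 is an identity. The unit laws of \<open>f\<close> and \<open>g\<close> then act on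
  separate factors.\<close>

lemma join_unit:
  assumes [simp]: "f \<in> Arr T" "g \<in> Arr T" "Dom T f = a + a" "Dom T g = b + b" "Cod T f = a" "Cod T g = b"
    and f: "f \<cdot> (unit a \<boxtimes> \<one> a) = \<one> a" "f \<cdot> (\<one> a \<boxtimes> unit a) = \<one> a"
    and g: "g \<cdot> (unit b \<boxtimes> \<one> b) = \<one> b" "g \<cdot> (\<one> b \<boxtimes> unit b) = \<one> b"
  shows "join a b f g \<cdot> (unit (a + b) \<boxtimes> \<one> (a + b)) = \<one> (a + b)"
    and "join a b f g \<cdot> (\<one> (a + b) \<boxtimes> unit (a + b)) = \<one> (a + b)"
proof -
  have "join a b f g \<cdot> (unit (a + b) \<boxtimes> \<one> (a + b))
    = (f \<boxtimes> g) \<cdot> (\<one> a \<boxtimes> \<tau> b a \<boxtimes> \<one> b) \<cdot> (unit a \<boxtimes> (unit b \<boxtimes> \<one> a) \<boxtimes> \<one> b)"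
    by (simp add: join_def unit_add)
  also have "\<dots> = (f \<boxtimes> g) \<cdot> (unit a \<boxtimes> (\<tau> b a \<cdot> (unit b \<boxtimes> \<one> a)) \<boxtimes> \<one> b)"
    by (simp add: TArr_Comp_Arr del: TArr_assoc)
  also have "\<dots> = (f \<boxtimes> g) \<cdot> ((unit a \<boxtimes> \<one> a) \<boxtimes> (unit b \<boxtimes> \<one> b))"
    by (simp add: Symm_natural_Arr)
  also have "\<dots> = \<one> (a + b)"
    by (simp add: TArr_Comp_Arr f g del: TArr_assoc)
  finally show "join a b f g \<cdot> (unit (a + b) \<boxtimes> \<one> (a + b)) = \<one> (a + b)" .
  have "join a b f g \<cdot> (\<one> (a + b) \<boxtimes> unit (a + b))
    = (f \<boxtimes> g) \<cdot> (\<one> a \<boxtimes> \<tau> b a \<boxtimes> \<one> b) \<cdot> (\<one> a \<boxtimes> (\<one> b \<boxtimes> unit a) \<boxtimes> unit b)"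
    by (simp add: join_def unit_add)
  also have "\<dots> = (f \<boxtimes> g) \<cdot> (\<one> a \<boxtimes> (\<tau> b a \<cdot> (\<one> b \<boxtimes> unit a)) \<boxtimes> unit b)"
    by (simp add: TArr_Comp_Arr del: TArr_assoc TArr_Ident_Ident)
  also have "\<dots> = (f \<boxtimes> g) \<cdot> ((\<one> a \<boxtimes> unit a) \<boxtimes> (\<one> b \<boxtimes> unit b))"
    by (simp add: Symm_natural_Arr)
  also have "\<dots> = \<one> (a + b)"
    by (simp add: TArr_Comp_Arr f g del: TArr_assoc)
  finally show "join a b f g \<cdot> (\<one> (a + b) \<boxtimes> unit (a + b)) = \<one> (a + b)" .
qed

lemma mult_unit:
  "mult n \<cdot> (unit n \<boxtimes> \<one> n) = \<one> n" "mult n \<cdot> (\<one> n \<boxtimes> unit n) = \<one> n"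
proof (induction n)
  case (Suc n)
  show "mult (Suc n) \<cdot> (unit (Suc n) \<boxtimes> \<one> (Suc n)) = \<one> (Suc n)"
    "mult (Suc n) \<cdot> (\<one> (Suc n) \<boxtimes> unit (Suc n)) = \<one> (Suc n)"
    using join_unit[of \<mu> "mult n" 1 n] Suc \<mu>_\<eta>_left \<mu>_\<eta>_right by (simp_all add: mult.simps)
qed simp_all

section \<open>Monoid homomorphisms: closure under composition, sums and symmetries\<close>

definition mon_hom :: "'m \<Rightarrow> bool" where
  "mon_hom f \<longleftrightarrow> f \<in> Arr T \<and> f \<cdot> mult (Dom T f) = mult (Cod T f) \<cdot> (f \<boxtimes> f)
     \<and> f \<cdot> unit (Dom T f) = unit (Cod T f)"

lemma mon_hom_Arr [simp]: "mon_hom f \<Longrightarrow> f \<in> Arr T"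
  by (simp add: mon_hom_def)

lemma mon_homI:
  assumes "f \<in> Arr T" "Dom T f = a" "Cod T f = b" "f \<cdot> mult a = mult b \<cdot> (f \<boxtimes> f)" "f \<cdot> unit a = unit b"
  shows "mon_hom f"
  using assms by (simp add: mon_hom_def)

lemma mon_hom_mult: "\<lbrakk>mon_hom f; Dom T f = a\<rbrakk> \<Longrightarrow> f \<cdot> mult a = mult (Cod T f) \<cdot> (f \<boxtimes> f)"
  by (auto simp: mon_hom_def)

lemma mon_hom_unit_eq: "\<lbrakk>mon_hom f; Dom T f = a\<rbrakk> \<Longrightarrow> f \<cdot> unit a = unit (Cod T f)"
  by (auto simp: mon_hom_def)

lemma mon_hom_Ident [simp]: "mon_hom (\<one> n)"
  by (rule mon_homI[of _ n n]) simp_all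

lemma mon_hom_Comp [simp]:
  assumes [simp]: "mon_hom f" "mon_hom g" and eq: "Dom T g = Cod T f"
  shows "mon_hom (g \<cdot> f)"
proof (rule mon_homI[of _ "Dom T f" "Cod T g"])
  have "(g \<cdot> f) \<cdot> mult (Dom T f) = (g \<cdot> mult (Cod T f)) \<cdot> (f \<boxtimes> f)"
    using eq by (simp add: mon_hom_mult[of f])
  also have "\<dots> = mult (Cod T g) \<cdot> ((g \<cdot> f) \<boxtimes> (g \<cdot> f))"
    by (subst mon_hom_mult) (simp_all add: eq TArr_Comp_Arr)
  finally show "(g \<cdot> f) \<cdot> mult (Dom T f) = mult (Cod T g) \<cdot> ((g \<cdot> f) \<boxtimes> (g \<cdot> f))" .
qed (use eq in \<open>simp_all add: mon_hom_unit_eq\<close>)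

text \<open>The homomorphism laws of \<open>f\<close> and \<open>g\<close> move both past their
  multiplications; what is left is that \<open>f \<boxtimes> g\<close> commutes with the middle
  swap, which is naturality of the symmetry.\<close>

lemma mon_hom_TArr [simp]:
  assumes "mon_hom f" "mon_hom g"
  shows "mon_hom (f \<boxtimes> g)"
proof -
  let ?a = "Dom T f" and ?b = "Dom T g" and ?a' = "Cod T f" and ?b' = "Cod T g"
  have f: "f \<in> Arr T" "f \<cdot> mult ?a = mult ?a' \<cdot> (f \<boxtimes> f)" "f \<cdot> unit ?a = unit ?a'"
    and g: "g \<in> Arr T" "g \<cdot> mult ?b = mult ?b' \<cdot> (g \<boxtimes> g)" "g \<cdot> unit ?b = unit ?b'"
    using assms by (simp_all add: mon_hom_mult mon_hom_unit_eq)
  have "(f \<boxtimes> g) \<cdot> mult (?a + ?b) = ((f \<cdot> mult ?a) \<boxtimes> (g \<cdot> mult ?b)) \<cdot> (\<one> ?a \<boxtimes> \<tau> ?b ?a \<boxtimes> \<one> ?b)"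
    using f(1) g(1) by (simp add: mult_add join_def TArr_Comp_chain add.assoc)
  also have "\<dots> = (mult ?a' \<boxtimes> mult ?b') \<cdot> (f \<boxtimes> (f \<boxtimes> g) \<boxtimes> g) \<cdot> (\<one> ?a \<boxtimes> \<tau> ?b ?a \<boxtimes> \<one> ?b)"
    using f(1) g(1) unfolding f(2) g(2) by (simp flip: TArr_Comp_Arr add: add.assoc)
  also have "\<dots> = (mult ?a' \<boxtimes> mult ?b') \<cdot> (f \<boxtimes> ((f \<boxtimes> g) \<cdot> \<tau> ?b ?a) \<boxtimes> g)"
    using f(1) g(1) by (simp add: TArr_Comp_Arr del: TArr_assoc)
  also have "(f \<boxtimes> g) \<cdot> \<tau> ?b ?a = \<tau> ?b' ?a' \<cdot> (g \<boxtimes> f)"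
    using f(1) g(1) by (simp add: Symm_natural_Arr)
  also have "f \<boxtimes> (\<tau> ?b' ?a' \<cdot> (g \<boxtimes> f)) \<boxtimes> g = (\<one> ?a' \<boxtimes> \<tau> ?b' ?a' \<boxtimes> \<one> ?b') \<cdot> ((f \<boxtimes> g) \<boxtimes> (f \<boxtimes> g))"
  proof -
    have "f \<boxtimes> (\<tau> ?b' ?a' \<cdot> (g \<boxtimes> f)) \<boxtimes> g = (\<one> ?a' \<boxtimes> \<tau> ?b' ?a' \<boxtimes> \<one> ?b') \<cdot> (f \<boxtimes> (g \<boxtimes> f) \<boxtimes> g)"
      using f(1) g(1) by (simp add: TArr_Comp_Arr del: TArr_assoc)
    then show ?thesis
      using f(1) g(1) by simp
  qed
  also have "(mult ?a' \<boxtimes> mult ?b') \<cdot> (\<one> ?a' \<boxtimes> \<tau> ?b' ?a' \<boxtimes> \<one> ?b') \<cdot> ((f \<boxtimes> g) \<boxtimes> (f \<boxtimes> g))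
      = mult (?a' + ?b') \<cdot> ((f \<boxtimes> g) \<boxtimes> (f \<boxtimes> g))"
    using f(1) g(1) by (simp add: mult_add join_def add.assoc)
  finally have mult: "(f \<boxtimes> g) \<cdot> mult (?a + ?b) = mult (?a' + ?b') \<cdot> ((f \<boxtimes> g) \<boxtimes> (f \<boxtimes> g))" .
  have "(f \<boxtimes> g) \<cdot> unit (?a + ?b) = unit (?a' + ?b')"
    using f(1) g(1) by (simp add: unit_add TArr_Comp_Arr f(3) g(3))
  with mult show ?thesis
    using f(1) g(1) by (intro mon_homI) auto
qed

text \<open>Naturality reduces the claim to an equation of permutations. Expanding
  \<open>\<tau> (a + a) (b + b)\<close> by both hexagons puts a factor \<open>\<tau> a b\<close>
  next to the middle swap \<open>\<tau> b a\<close>, and the two cancel.\<close>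

lemma mon_hom_Symm [simp]: "mon_hom (\<tau> a b)"
proof -
  have 1: "\<tau> (a + a) (b + b) \<cdot> (\<one> a \<boxtimes> \<tau> b a \<boxtimes> \<one> b) = (\<one> b \<boxtimes> \<tau> a b \<boxtimes> \<one> a) \<cdot> (\<tau> a b \<boxtimes> \<tau> a b)"
  proof -
    have "\<tau> (a + a) (b + b) \<cdot> (\<one> a \<boxtimes> \<tau> b a \<boxtimes> \<one> b)
      = (\<one> b \<boxtimes> \<tau> a b \<boxtimes> \<one> a) \<cdot> (\<one> (b + a) \<boxtimes> \<tau> a b) \<cdot> (\<tau> a b \<boxtimes> \<one> (a + b))
        \<cdot> (\<one> a \<boxtimes> \<tau> a b \<boxtimes> \<one> b) \<cdot> (\<one> a \<boxtimes> \<tau> b a \<boxtimes> \<one> b)"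
      by (simp add: Symm_add_right Symm_add_left Ident_TArr_Comp TArr_Comp_Ident ac_simps)
    also have "(\<one> a \<boxtimes> \<tau> a b \<boxtimes> \<one> b) \<cdot> (\<one> a \<boxtimes> \<tau> b a \<boxtimes> \<one> b) = \<one> (a + b + (a + b))"
      by (simp add: TArr_Comp_Arr ac_simps)
    finally show ?thesis
      by (simp add: TArr_Comp_Arr ac_simps)
  qed
  have "\<tau> a b \<cdot> mult (a + b) = (mult b \<boxtimes> mult a) \<cdot> \<tau> (a + a) (b + b) \<cdot> (\<one> a \<boxtimes> \<tau> b a \<boxtimes> \<one> b)"
    by (simp add: mult_add join_def Comp_chain[OF Symm_natural_Arr] add.assoc)
  also have "\<dots> = mult (b + a) \<cdot> (\<tau> a b \<boxtimes> \<tau> a b)"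
    by (simp add: 1 mult_add join_def add.assoc)
  finally have mult: "\<tau> a b \<cdot> mult (a + b) = mult (b + a) \<cdot> (\<tau> a b \<boxtimes> \<tau> a b)" .
  have "\<tau> a b \<cdot> unit (a + b) = unit (b + a)"
    by (simp add: unit_add Symm_natural_Arr)
  with mult show ?thesis
    by (intro mon_homI[of _ "a + b" "b + a"]) auto
qed

lemma mon_hom_\<eta> [simp]: "mon_hom \<eta>"
proof -
  have "\<mu> \<cdot> (\<eta> \<boxtimes> \<eta>) = (\<mu> \<cdot> (\<eta> \<boxtimes> \<one> 1)) \<cdot> \<eta>"
    using TArr_Comp_Arr[of "\<one> 0" \<eta> \<eta> "\<one> 1"] by simp
  then show ?thesis
    unfolding \<mu>_\<eta>_left by (intro mon_homI[of _ 0 1]) simp_all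
qed

text \<open>Commutativity enters here. A fourfold product can be rebracketed so that its two middle
  factors are multiplied together before the others, and the swap of these two is then absorbed by
  \<open>\<mu>_comm\<close>.\<close>

lemma mon_hom_\<mu> [simp]: "mon_hom \<mu>"
proof -
  have 1: "\<mu> \<cdot> (\<mu> \<boxtimes> \<mu>) = \<mu> \<cdot> (\<one> 1 \<boxtimes> \<mu>) \<cdot> (\<one> 1 \<boxtimes> \<mu> \<boxtimes> \<one> 1)"
  proof -
    have "\<mu> \<cdot> (\<mu> \<boxtimes> \<mu>) = (\<mu> \<cdot> (\<mu> \<boxtimes> \<one> 1)) \<cdot> (\<one> 2 \<boxtimes> \<mu>)"
      by (simp add: TArr_Comp_Arr numeral_2_eq_2)
    also have "\<dots> = \<mu> \<cdot> (\<one> 1 \<boxtimes> \<mu>) \<cdot> (\<one> 1 \<boxtimes> (\<one> 1 \<boxtimes> \<mu>))"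
      unfolding \<mu>_assoc by (simp add: numeral_2_eq_2)
    also have "\<dots> = \<mu> \<cdot> (\<one> 1 \<boxtimes> (\<mu> \<cdot> (\<one> 1 \<boxtimes> \<mu>)))"
      by (simp add: TArr_Comp_Arr del: TArr_Ident_Ident)
    also have "\<dots> = \<mu> \<cdot> (\<one> 1 \<boxtimes> (\<mu> \<cdot> (\<mu> \<boxtimes> \<one> 1)))"
      by (simp only: \<mu>_assoc)
    finally show ?thesis
      by (simp add: TArr_Comp_Arr)
  qed
  have "(\<mu> \<boxtimes> \<one> 1) \<cdot> (\<tau> 1 1 \<boxtimes> \<one> 1) = \<mu> \<boxtimes> \<one> 1"
    using \<mu>_comm by (simp add: TArr_Comp_Arr)
  then have 2: "(\<one> 1 \<boxtimes> \<mu> \<boxtimes> \<one> 1) \<cdot> (\<one> 1 \<boxtimes> \<tau> 1 1 \<boxtimes> \<one> 1) = \<one> 1 \<boxtimes> \<mu> \<boxtimes> \<one> 1"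
    by (simp add: TArr_Comp_Arr)
  have "\<mu> \<cdot> mult (1 + 1) = (\<mu> \<cdot> (\<mu> \<boxtimes> \<mu>)) \<cdot> (\<one> 1 \<boxtimes> \<tau> 1 1 \<boxtimes> \<one> 1)"
    by (subst mult_add) (simp add: join_def)
  also have "\<dots> = \<mu> \<cdot> (\<mu> \<boxtimes> \<mu>)"
    unfolding 1 using 2 by simp
  finally have 3: "\<mu> \<cdot> mult (1 + 1) = \<mu> \<cdot> (\<mu> \<boxtimes> \<mu>)" .
  have "\<mu> \<cdot> unit (1 + 1) = \<mu> \<cdot> (\<eta> \<boxtimes> \<eta>)"
    by (subst unit_add) simp
  also have "\<dots> = \<eta>"
    using mon_hom_mult[OF mon_hom_\<eta>, of 0] by simp
  finally show ?thesis
    using 3 by (intro mon_homI[of _ "1 + 1" 1]) simp_all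
qed

lemma mon_hom_unit [simp]: "mon_hom (unit n)"
  by (induction n) (simp_all add: unit.simps)

text \<open>The \<open>i\<close>-th injection \<open>1 \<rightarrow> n\<close>; meaningful for \<open>i < n\<close> only.\<close>

primrec inj :: "nat \<Rightarrow> nat \<Rightarrow> 'm" where
  "inj 0 i = \<one> 0"
| "inj (Suc n) i = (case i of 0 \<Rightarrow> \<one> 1 \<boxtimes> unit n | Suc i \<Rightarrow> \<eta> \<boxtimes> inj n i)"

declare inj.simps [simp del]

lemma inj_Suc: "inj (Suc n) 0 = \<one> 1 \<boxtimes> unit n" "inj (Suc n) (Suc i) = \<eta> \<boxtimes> inj n i"
  by (simp_all add: inj.simps)

lemma inj_simps [simp]:
  assumes "i < n"
  shows "inj n i \<in> Arr T" "Dom T (inj n i) = Suc 0" "Cod T (inj n i) = n" "mon_hom (inj n i)"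
  using assms
proof (induction n arbitrary: i)
  case (Suc n)
  {
    case 1 then show ?case by (cases i) (auto simp: inj_Suc Suc)
  next
    case 2 then show ?case by (cases i) (auto simp: inj_Suc Suc)
  next
    case 3 then show ?case by (cases i) (auto simp: inj_Suc Suc)
  next
    case 4 then show ?case by (cases i) (auto simp: inj_Suc Suc)
  }
qed simp_all

lemma inj_add_left: "i < a \<Longrightarrow> inj (a + b) i = inj a i \<boxtimes> unit b"
  by (induction a arbitrary: i) (auto simp: inj.simps unit_add split: nat.split)

lemma inj_add_right: "i < b \<Longrightarrow> inj (a + b) (a + i) = unit a \<boxtimes> inj b i"
  by (induction a) (auto simp: inj_Suc unit.simps)

end

section \<open>Special bicommutative bimonoids in a PROP and addition of arrows\<close>

locale prop_bimonoid =
  prop_monoid T \<mu> \<eta> + D: prop_monoid "opposite_prop T" \<Delta> \<epsilon>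
  for T :: "(nat, 'm, 'z) sm_category_scheme" (structure) and \<mu> \<eta> \<Delta> \<epsilon> :: 'm +
  assumes \<Delta>_\<mu>: "\<Delta> \<cdot> \<mu> = (\<mu> \<boxtimes> \<mu>) \<cdot> (\<one> 1 \<boxtimes> \<tau> 1 1 \<boxtimes> \<one> 1) \<cdot> (\<Delta> \<boxtimes> \<Delta>)"
    and \<Delta>_\<eta>: "\<Delta> \<cdot> \<eta> = \<eta> \<boxtimes> \<eta>"
    and \<epsilon>_\<mu>: "\<epsilon> \<cdot> \<mu> = \<epsilon> \<boxtimes> \<epsilon>"
    and \<epsilon>_\<eta>: "\<epsilon> \<cdot> \<eta> = \<one> 0"
    and \<mu>_\<Delta>: "\<mu> \<cdot> \<Delta> = \<one> 1"
begin

abbreviation comult where "comult \<equiv> D.mult"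
abbreviation counit where "counit \<equiv> D.unit"
abbreviation proj where "proj \<equiv> D.inj"
abbreviation comon_hom where "comon_hom \<equiv> D.mon_hom"

lemma \<Delta>_\<epsilon>_simps [simp]:
  "\<Delta> \<in> Arr T" "Dom T \<Delta> = Suc 0" "Cod T \<Delta> = Suc (Suc 0)"
  "\<epsilon> \<in> Arr T" "Dom T \<epsilon> = Suc 0" "Cod T \<epsilon> = 0"
  using D.\<mu>_\<eta>_simps by simp_all

lemma comult_simps [simp]: "comult n \<in> Arr T" "Dom T (comult n) = n" "Cod T (comult n) = n + n"
  using D.mult_simps[of n] by simp_all

lemma counit_simps [simp]: "counit n \<in> Arr T" "Dom T (counit n) = n" "Cod T (counit n) = 0"
  using D.unit_simps[of n] by simp_all

lemma proj_simps [simp]: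
  assumes "i < n"
  shows "proj n i \<in> Arr T" "Dom T (proj n i) = n" "Cod T (proj n i) = Suc 0"
  using D.inj_simps[OF assms] by simp_all

lemma comon_hom_Arr [simp]: "comon_hom f \<Longrightarrow> f \<in> Arr T"
  using D.mon_hom_Arr by simp

lemma comult_add:
  "comult (a + b) = (\<one> a \<boxtimes> \<tau> a b \<boxtimes> \<one> b) \<cdot> (comult a \<boxtimes> comult b)"
  by (simp add: D.mult_add D.join_def)

lemma comon_homI:
  assumes "f \<in> Arr T" "Dom T f = a" "Cod T f = b" "comult b \<cdot> f = (f \<boxtimes> f) \<cdot> comult a"
    "counit b \<cdot> f = counit a"
  shows "comon_hom f"
  using assms by (simp add: D.mon_hom_def)

lemma comon_hom_comult: "\<lbrakk>comon_hom f; Cod T f = b\<rbrakk> \<Longrightarrow> comult b \<cdot> f = (f \<boxtimes> f) \<cdot> comult (Dom T f)"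
  using D.mon_hom_mult[of f b] by simp

lemma comon_hom_counit: "\<lbrakk>comon_hom f; Cod T f = b\<rbrakk> \<Longrightarrow> counit b \<cdot> f = counit (Dom T f)"
  using D.mon_hom_unit_eq[of f b] by simp

lemma comon_hom_Comp [simp]:
  "\<lbrakk>comon_hom f; comon_hom g; Dom T g = Cod T f\<rbrakk> \<Longrightarrow> comon_hom (g \<cdot> f)"
  using D.mon_hom_Comp[of g f] by simp

lemma comon_hom_TArr [simp]: "\<lbrakk>comon_hom f; comon_hom g\<rbrakk> \<Longrightarrow> comon_hom (f \<boxtimes> g)"
  using D.mon_hom_TArr[of f g] by simp

lemma comon_hom_Symm [simp]: "comon_hom (\<tau> a b)"
  using D.mon_hom_Symm[of b a] by simp

lemma comon_hom_Ident [simp]: "comon_hom (\<one> n)"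
  using D.mon_hom_Ident[of n] by simp

lemma comult_counit: "(counit n \<boxtimes> \<one> n) \<cdot> comult n = \<one> n" "(\<one> n \<boxtimes> counit n) \<cdot> comult n = \<one> n"
  using D.mult_unit[of n] by simp_all

lemma mult_2: "mult 2 = (\<mu> \<boxtimes> \<mu>) \<cdot> (\<one> 1 \<boxtimes> \<tau> 1 1 \<boxtimes> \<one> 1)"
  using mult_add[of 1 1] by (simp add: join_def numeral_2_eq_2)

lemma comult_2: "comult 2 = (\<one> 1 \<boxtimes> \<tau> 1 1 \<boxtimes> \<one> 1) \<cdot> (\<Delta> \<boxtimes> \<Delta>)"
  using comult_add[of 1 1] by (simp add: numeral_2_eq_2)

lemma unit_2: "unit 2 = \<eta> \<boxtimes> \<eta>"
  using unit_add[of 1 1] by (simp add: numeral_2_eq_2)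

lemma counit_2: "counit 2 = \<epsilon> \<boxtimes> \<epsilon>"
  using D.unit_add[of 1 1] by (simp add: numeral_2_eq_2)

text \<open>The four compatibility axioms can be read in two ways: with \<open>comult 2\<close> and
  \<open>counit 2\<close> they say that \<open>\<mu>\<close> and \<open>\<eta>\<close> are comonoid
  homomorphisms, with \<open>mult 2\<close> and \<open>unit 2\<close> that \<open>\<Delta>\<close>
  and \<open>\<epsilon>\<close> are monoid homomorphisms.\<close>

lemma comon_hom_\<mu> [simp]: "comon_hom \<mu>"
  using \<Delta>_\<mu> \<epsilon>_\<mu> by (intro comon_homI[of _ 2 1]) (simp_all add: comult_2 counit_2)

lemma comon_hom_\<eta> [simp]: "comon_hom \<eta>"
  using \<Delta>_\<eta> \<epsilon>_\<eta> by (intro comon_homI[of _ 0 1]) simp_all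

lemma mon_hom_\<Delta> [simp]: "mon_hom \<Delta>"
  using \<Delta>_\<mu> \<Delta>_\<eta> by (intro mon_homI[of _ 1 2]) (simp_all add: mult_2 unit_2)

lemma mon_hom_\<epsilon> [simp]: "mon_hom \<epsilon>"
  using \<epsilon>_\<mu> \<epsilon>_\<eta> by (intro mon_homI[of _ 1 0]) simp_all

lemma comon_hom_unit [simp]: "comon_hom (unit n)"
  by (induction n) (simp_all add: unit.simps)

lemma mon_hom_counit [simp]: "mon_hom (counit n)"
  by (induction n) (simp_all add: D.unit.simps)

lemma comon_hom_inj [simp]: "i < n \<Longrightarrow> comon_hom (inj n i)"
  by (induction n arbitrary: i) (auto simp: inj.simps split: nat.split)

lemma mon_hom_proj [simp]: "i < n \<Longrightarrow> mon_hom (proj n i)"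
  by (induction n arbitrary: i) (auto simp: D.inj.simps split: nat.split)

lemma counit_unit: "counit n \<cdot> unit n = \<one> 0"
  by (simp add: comon_hom_counit)

text \<open>Convolution makes the hom-sets additive: composition with monoid homomorphisms on the left
  and comonoid homomorphisms on the right is linear, and the tensor product becomes a biproduct
  with injections \<open>1 \<otimes> unit\<close> and projections \<open>1 \<otimes> counit\<close>.\<close>

definition zero :: "nat \<Rightarrow> nat \<Rightarrow> 'm" where
  "zero m n = unit n \<cdot> counit m"

definition add :: "'m \<Rightarrow> 'm \<Rightarrow> 'm" where
  "add f g = mult (Cod T f) \<cdot> (f \<boxtimes> g) \<cdot> comult (Dom T f)"

lemma zero_simps [simp]: "zero m n \<in> Arr T" "Dom T (zero m n) = m" "Cod T (zero m n) = n"
  by (simp_all add: zero_def)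

lemma Comp_add:
  assumes [simp]: "mon_hom h" "f \<in> Arr T" "g \<in> Arr T" "Dom T h = b" "Cod T f = b" "Cod T g = b"
    "Dom T f = a" "Dom T g = a"
  shows "h \<cdot> add f g = add (h \<cdot> f) (h \<cdot> g)"
proof -
  have "h \<cdot> add f g = (h \<cdot> mult b) \<cdot> (f \<boxtimes> g) \<cdot> comult a"
    by (simp add: add_def)
  also have "\<dots> = add (h \<cdot> f) (h \<cdot> g)"
    by (subst mon_hom_mult) (simp_all add: add_def TArr_Comp_chain)
  finally show ?thesis .
qed

lemma add_Comp:
  assumes [simp]: "comon_hom k" "f \<in> Arr T" "g \<in> Arr T" "Cod T k = a" "Cod T f = b" "Cod T g = b"
    "Dom T f = a" "Dom T g = a"
  shows "add f g \<cdot> k = add (f \<cdot> k) (g \<cdot> k)"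
  by (simp add: add_def comon_hom_comult TArr_Comp_chain)

lemma add_zero:
  assumes [simp]: "f \<in> Arr T" "Dom T f = m" "Cod T f = n"
  shows "add (zero m n) f = f" "add f (zero m n) = f"
proof -
  have "mult n \<cdot> (zero m n \<boxtimes> f) \<cdot> comult m
    = (mult n \<cdot> (unit n \<boxtimes> \<one> n)) \<cdot> f \<cdot> ((counit m \<boxtimes> \<one> m) \<cdot> comult m)"
  proof -
    have "zero m n \<boxtimes> f = (unit n \<boxtimes> \<one> n) \<cdot> (\<one> 0 \<boxtimes> f) \<cdot> (counit m \<boxtimes> \<one> m)"
      by (simp add: zero_def TArr_Comp_Arr del: TArr_0_left)
    then show ?thesis
      by simp
  qed
  then show "add (zero m n) f = f"
    by (simp add: add_def mult_unit comult_counit)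
  have "mult n \<cdot> (f \<boxtimes> zero m n) \<cdot> comult m
    = (mult n \<cdot> (\<one> n \<boxtimes> unit n)) \<cdot> f \<cdot> ((\<one> m \<boxtimes> counit m) \<cdot> comult m)"
  proof -
    have "f \<boxtimes> zero m n = (\<one> n \<boxtimes> unit n) \<cdot> (f \<boxtimes> \<one> 0) \<cdot> (\<one> m \<boxtimes> counit m)"
      by (simp add: zero_def TArr_Comp_Arr del: TArr_0_right)
    then show ?thesis
      by simp
  qed
  then show "add f (zero m n) = f"
    by (simp add: add_def mult_unit comult_counit)
qed

section \<open>Matrix entries: decomposition of identities, extensionality and products\<close>

lemma add_idem: "add (\<one> 1) (\<one> 1) = \<one> 1"
  using \<mu>_\<Delta> by (simp add: add_def)

text \<open>The biproduct equation: the identity is the sum of the two composites of a projection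
  with its injection. Unfolding the sum leaves \<open>unit \<cdot> counit\<close> on the two middle
  strands, between a swap and its inverse. Naturality exchanges these two, so that each strand
  carries the sum of an identity and a zero.\<close>

lemma Ident_add:
  "\<one> (m + n) = add ((\<one> m \<boxtimes> unit n) \<cdot> (\<one> m \<boxtimes> counit n)) ((unit m \<boxtimes> \<one> n) \<cdot> (counit m \<boxtimes> \<one> n))"
proof -
  let ?z = "\<lambda>n. unit n \<cdot> counit n"
  have "add ((\<one> m \<boxtimes> unit n) \<cdot> (\<one> m \<boxtimes> counit n)) ((unit m \<boxtimes> \<one> n) \<cdot> (counit m \<boxtimes> \<one> n))
    = (mult m \<boxtimes> mult n) \<cdot> (\<one> m \<boxtimes> \<tau> n m \<boxtimes> \<one> n)
      \<cdot> (\<one> m \<boxtimes> (?z n \<boxtimes> ?z m) \<boxtimes> \<one> n) \<cdot> (\<one> m \<boxtimes> \<tau> m n \<boxtimes> \<one> n) \<cdot> (comult m \<boxtimes> comult n)"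
    by (simp add: add_def mult_add join_def comult_add TArr_Comp_Arr)
  also have "\<dots> = (mult m \<boxtimes> mult n) \<cdot> (\<one> m \<boxtimes> (\<tau> n m \<cdot> (?z n \<boxtimes> ?z m) \<cdot> \<tau> m n) \<boxtimes> \<one> n)
      \<cdot> (comult m \<boxtimes> comult n)"
    by (simp add: TArr_Comp_chain TArr_Comp_Arr del: TArr_assoc)
  also have "\<tau> n m \<cdot> (?z n \<boxtimes> ?z m) \<cdot> \<tau> m n = ?z m \<boxtimes> ?z n"
    by (subst Comp_chain[OF Symm_natural_Arr]) simp_all
  also have "(mult m \<boxtimes> mult n) \<cdot> (\<one> m \<boxtimes> (?z m \<boxtimes> ?z n) \<boxtimes> \<one> n) \<cdot> (comult m \<boxtimes> comult n)
    = add (\<one> m) (zero m m) \<boxtimes> add (zero n n) (\<one> n)"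
  proof -
    have "\<one> m \<boxtimes> (?z m \<boxtimes> ?z n) \<boxtimes> \<one> n = (\<one> m \<boxtimes> ?z m) \<boxtimes> (?z n \<boxtimes> \<one> n)"
      by simp
    then show ?thesis
      by (simp add: add_def zero_def TArr_Comp_Arr del: TArr_assoc)
  qed
  also have "\<dots> = \<one> (m + n)"
    by (simp add: add_zero)
  finally show ?thesis ..
qed

text \<open>A monoid homomorphism distributes over \<open>Ident_add\<close>, so it is recovered from
  its column at the summand 0 and its restriction to the other \<open>m\<close> summands; the
  induction treats that restriction. From the object 0 the only monoid homomorphism is the
  unit.\<close>

lemma mon_hom_ext:
  assumes "mon_hom f" "mon_hom g" "Dom T f = m" "Dom T g = m" "Cod T f = Cod T g"
    and "\<And>i. i < m \<Longrightarrow> f \<cdot> inj m i = g \<cdot> inj m i"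
  shows "f = g"
  using assms
proof (induction m arbitrary: f g)
  case 0
  then show ?case
    using mon_hom_unit_eq[of f 0] mon_hom_unit_eq[of g 0] by simp
next
  case (Suc m)
  let ?p1 = "\<one> 1 \<boxtimes> counit m" and ?p2 = "\<epsilon> \<boxtimes> \<one> m"
  have split: "h = add ((h \<cdot> (\<one> 1 \<boxtimes> unit m)) \<cdot> ?p1) ((h \<cdot> (\<eta> \<boxtimes> \<one> m)) \<cdot> ?p2)"
    if "mon_hom h" "Dom T h = Suc m" for h
  proof -
    have "h = h \<cdot> \<one> (1 + m)"
      using that by simp
    also have "\<dots> = add ((h \<cdot> (\<one> 1 \<boxtimes> unit m)) \<cdot> ?p1) ((h \<cdot> (\<eta> \<boxtimes> \<one> m)) \<cdot> ?p2)"
      unfolding Ident_add using that by (subst Comp_add[where b = "Suc m" and a = "Suc m"]) simp_all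
    finally show ?thesis .
  qed
  have "f \<cdot> (\<one> 1 \<boxtimes> unit m) = g \<cdot> (\<one> 1 \<boxtimes> unit m)"
    using Suc.prems(6)[of 0] by (simp add: inj_Suc)
  moreover have "f \<cdot> (\<eta> \<boxtimes> \<one> m) = g \<cdot> (\<eta> \<boxtimes> \<one> m)"
  proof (rule Suc.IH)
    fix i assume i: "i < m"
    have "(\<eta> \<boxtimes> \<one> m) \<cdot> inj m i = inj (Suc m) (Suc i)"
      using i TArr_Comp_Arr[of "\<one> 0" \<eta> "inj m i" "\<one> m"] by (simp add: inj_Suc)
    then show "(f \<cdot> (\<eta> \<boxtimes> \<one> m)) \<cdot> inj m i = (g \<cdot> (\<eta> \<boxtimes> \<one> m)) \<cdot> inj m i"
      using Suc.prems i by simp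
  qed (use Suc.prems in simp_all)
  ultimately show ?case
    using split[of f] split[of g] Suc.prems by metis
qed

lemma opposite_opposite_prop [simp]: "opposite_prop (opposite_prop T) = T"
  by (simp add: opposite_prop_def)

text \<open>The axioms are self-dual: reversing arrows exchanges the monoid and the comonoid.
  Extensionality by columns thereby yields extensionality by rows.\<close>

lemma opposite_prop_bimonoid: "prop_bimonoid (opposite_prop T) \<Delta> \<epsilon> \<mu> \<eta>"
proof -
  interpret Op: prop_monoid "opposite_prop (opposite_prop T)" \<mu> \<eta>
    by simp unfold_locales
  show ?thesis
    by unfold_locales (use \<Delta>_\<mu> \<Delta>_\<eta> \<epsilon>_\<mu> \<epsilon>_\<eta> \<mu>_\<Delta> in simp_all)
qed

lemma comon_hom_ext:
  assumes "comon_hom f" "comon_hom g" "Cod T f = m" "Cod T g = m" "Dom T f = Dom T g"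
    and "\<And>i. i < m \<Longrightarrow> proj m i \<cdot> f = proj m i \<cdot> g"
  shows "f = g"
  using prop_bimonoid.mon_hom_ext[OF opposite_prop_bimonoid, of f g m] assms by simp

text \<open>An image of the Boolean semiring in the endomorphisms of 1, with composition as
  conjunction and \<open>add\<close> as disjunction. It need not be injective, being constant when
  \<open>\<eta> \<cdot> \<epsilon>\<close> is the identity; hence relations are sent to arrows and
  not recovered from them.\<close>

definition truth :: "bool \<Rightarrow> 'm" where
  "truth P = (if P then \<one> 1 else zero 1 1)"

lemma truth_simps [simp]:
  "truth P \<in> Arr T" "Dom T (truth P) = Suc 0" "Cod T (truth P) = Suc 0"
  by (simp_all add: truth_def)

lemma mon_hom_Comp_zero: "\<lbrakk>mon_hom h; Dom T h = n; Cod T h = k\<rbrakk> \<Longrightarrow> h \<cdot> zero m n = zero m k"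
  by (simp add: zero_def Comp_chain[OF mon_hom_unit_eq])

lemma truth_Comp: "truth P \<cdot> truth Q = truth (P \<and> Q)"
  by (auto simp: truth_def mon_hom_Comp_zero) (simp add: zero_def Comp_chain[OF \<epsilon>_\<eta>])

lemma truth_add: "add (truth P) (truth Q) = truth (P \<or> Q)"
  using add_idem add_zero[of _ 1 1] by (auto simp: truth_def)

text \<open>A row times a column. Inserting \<open>Ident_add\<close> at the middle object splits off
  the term at index 0, and the induction handles the rest; linearity needs \<open>h\<close> to be a
  monoid homomorphism and \<open>x\<close> a comonoid homomorphism. For \<open>k = 0\<close> the
  composite passes through the object 0 and is the empty sum.\<close>

lemma Comp_truth:
  assumes "mon_hom h" "comon_hom x" "Dom T h = k" "Cod T h = 1" "Dom T x = 1" "Cod T x = k"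
    and "\<And>l. l < k \<Longrightarrow> h \<cdot> inj k l = truth (P l)"
    and "\<And>l. l < k \<Longrightarrow> proj k l \<cdot> x = truth (Q l)"
  shows "h \<cdot> x = truth (\<exists>l<k. P l \<and> Q l)"
  using assms
proof (induction k arbitrary: h x P Q)
  case 0
  then show ?case
    using mon_hom_unit_eq[of h 0] comon_hom_counit[of x 0] by (simp add: truth_def zero_def)
next
  case (Suc k)
  have inj: "(\<eta> \<boxtimes> \<one> k) \<cdot> inj k i = inj (Suc k) (Suc i)" if "i < k" for i
    using that TArr_Comp_Arr[of "\<one> 0" \<eta> "inj k i" "\<one> k"] by (simp add: inj_Suc)
  have proj: "proj k i \<cdot> (\<epsilon> \<boxtimes> \<one> k) = proj (Suc k) (Suc i)" if "i < k" for i
    using that TArr_Comp_Arr[of \<epsilon> "\<one> 0" "\<one> k" "proj k i"] by (simp add: D.inj_Suc)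
  have proj': "proj k i \<cdot> (\<epsilon> \<boxtimes> \<one> k) \<cdot> x = proj (Suc k) (Suc i) \<cdot> x" if "i < k" for i
    using that proj[OF that] Suc.prems by (subst Comp_chain[OF proj]) simp_all
  have "h \<cdot> x = (h \<cdot> \<one> (1 + k)) \<cdot> x"
    using Suc.prems by simp
  also have "\<dots> = add ((h \<cdot> (\<one> 1 \<boxtimes> unit k)) \<cdot> (\<one> 1 \<boxtimes> counit k) \<cdot> x) ((h \<cdot> (\<eta> \<boxtimes> \<one> k)) \<cdot> (\<epsilon> \<boxtimes> \<one> k) \<cdot> x)"
    unfolding Ident_add using Suc.prems
    by (simp add: Comp_add[where b = "Suc k" and a = "Suc k"] add_Comp[where b = 1 and a = "Suc k"])
  also have "(h \<cdot> (\<one> 1 \<boxtimes> unit k)) \<cdot> (\<one> 1 \<boxtimes> counit k) \<cdot> x = truth (P 0 \<and> Q 0)"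
    using Suc.prems(7,8)[of 0] by (simp add: inj_Suc D.inj_Suc truth_Comp)
  also have "(h \<cdot> (\<eta> \<boxtimes> \<one> k)) \<cdot> (\<epsilon> \<boxtimes> \<one> k) \<cdot> x = truth (\<exists>l<k. P (Suc l) \<and> Q (Suc l))"
    using Suc.prems by (intro Suc.IH) (simp_all add: inj proj')
  finally show ?case
    by (simp add: truth_add Ex_less_Suc2)
qed

text \<open>The matrix entries of \<open>f\<close> are 0 or 1, with the ones at the pairs in \<open>R\<close>. Since \<open>1 + 1 = 1\<close>
  for a special bimonoid, matrix multiplication is composition of relations.\<close>

definition represents :: "'m \<Rightarrow> (nat \<times> nat) set \<Rightarrow> bool" where
  "represents f R \<longleftrightarrow> mon_hom f \<and> comon_hom f \<and>
     (\<forall>i < Dom T f. \<forall>j < Cod T f. proj (Cod T f) j \<cdot> f \<cdot> inj (Dom T f) i = truth ((i, j) \<in> R))"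

lemma representsI:
  assumes "mon_hom f" "comon_hom f" "Dom T f = m" "Cod T f = n"
    "\<And>i j. \<lbrakk>i < m; j < n\<rbrakk> \<Longrightarrow> proj n j \<cdot> f \<cdot> inj m i = truth ((i, j) \<in> R)"
  shows "represents f R"
  using assms by (simp add: represents_def)

lemma representsD:
  assumes "represents f R"
  shows "mon_hom f" "comon_hom f"
    "\<lbrakk>Dom T f = m; Cod T f = n; i < m; j < n\<rbrakk> \<Longrightarrow> proj n j \<cdot> f \<cdot> inj m i = truth ((i, j) \<in> R)"
  using assms by (auto simp: represents_def)

text \<open>Comonoid extensionality reduces equality to rows. A row is again a monoid homomorphism
  because projections are, so monoid extensionality reduces it further to entries.\<close>

lemma represents_unique:
  assumes f: "represents f R" and g: "represents g R" and eq: "Dom T f = Dom T g" "Cod T f = Cod T g"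
  shows "f = g"
proof (rule comon_hom_ext)
  fix j assume j: "j < Cod T g"
  show "proj (Cod T g) j \<cdot> f = proj (Cod T g) j \<cdot> g"
  proof (rule mon_hom_ext[where m = "Dom T g"])
    fix i assume "i < Dom T g"
    then show "(proj (Cod T g) j \<cdot> f) \<cdot> inj (Dom T g) i = (proj (Cod T g) j \<cdot> g) \<cdot> inj (Dom T g) i"
      using representsD[OF f] representsD[OF g] eq j by simp
  qed (use representsD[OF f] representsD[OF g] eq j in simp_all)
qed (use representsD[OF f] representsD[OF g] eq in simp_all)

text \<open>The bound on \<open>R\<close> makes \<open>R O S\<close> pass only through indices below
  \<open>Cod T f\<close>, which are those over which the matrix product sums.\<close>

lemma represents_Comp:
  assumes f: "represents f R" and g: "represents g S" and eq: "Dom T g = Cod T f"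
    and R: "R \<subseteq> UNIV \<times> {..<Cod T f}"
  shows "represents (g \<cdot> f) (R O S)"
proof (rule representsI)
  fix i j assume i: "i < Dom T f" and j: "j < Cod T g"
  have "proj (Cod T g) j \<cdot> (g \<cdot> f) \<cdot> inj (Dom T f) i
    = (proj (Cod T g) j \<cdot> g) \<cdot> (f \<cdot> inj (Dom T f) i)"
    using representsD[OF f] representsD[OF g] eq i j by simp
  also have "\<dots> = truth (\<exists>l<Cod T f. (l, j) \<in> S \<and> (i, l) \<in> R)"
    using representsD[OF f] representsD[OF g] eq i j by (intro Comp_truth) simp_all
  also have "(\<exists>l<Cod T f. (l, j) \<in> S \<and> (i, l) \<in> R) \<longleftrightarrow> (i, j) \<in> R O S"
    using R by auto
  finally show "proj (Cod T g) j \<cdot> (g \<cdot> f) \<cdot> inj (Dom T f) i = truth ((i, j) \<in> R O S)" .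
qed (use representsD[OF f] representsD[OF g] eq in simp_all)

lemma proj_Ident_inj: "\<lbrakk>i < n; j < n\<rbrakk> \<Longrightarrow> proj n j \<cdot> inj n i = truth (i = j)"
proof (induction n arbitrary: i j)
  case (Suc n)
  \<comment> \<open>Off the diagonal, the recursions of \<open>proj\<close> and \<open>inj\<close>
    get out of step and leave one of these two arrows; both factor through the object 0.\<close>
  have zero: "\<eta> \<boxtimes> \<epsilon> = zero 1 1" "\<epsilon> \<boxtimes> \<eta> = zero 1 1"
    using TArr_Comp_Arr[of "\<one> 0" \<eta> \<epsilon> "\<one> 0"] TArr_Comp_Arr[of \<epsilon> "\<one> 0" "\<one> 0" \<eta>]
    by (simp_all add: zero_def)
  have "\<epsilon> \<cdot> \<eta> = \<one> 0" by (rule \<epsilon>_\<eta>)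
  with Suc show ?case
    by (cases i; cases j)
      (simp_all add: inj_Suc D.inj_Suc TArr_Comp_Arr truth_def counit_unit comon_hom_counit
        mon_hom_unit_eq zero)
qed simp

lemma represents_Ident: "represents (\<one> n) (Id_on {..<n})"
  by (rule representsI) (auto simp: proj_Ident_inj Id_on_iff intro!: arg_cong[where f = truth])

text \<open>The matrix is block diagonal: in the other two blocks a counit meets an injection and a
  unit meets a projection, which gives zero. The bound on \<open>R\<close> keeps it out of the three
  blocks where it has no entries.\<close>

lemma represents_TArr:
  assumes f: "represents f R" and g: "represents g S"
    and R: "R \<subseteq> {..<Dom T f} \<times> {..<Cod T f}"
  shows "represents (f \<boxtimes> g) (rel_sum (Dom T f) (Cod T f) R S)"
proof (rule representsI)
  note [simp] = representsD[OF f] representsD[OF g]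
  let ?m = "Dom T f" and ?n = "Cod T f" and ?m' = "Dom T g" and ?n' = "Cod T g"
  fix i j assume i: "i < ?m + ?m'" and j: "j < ?n + ?n'"
  have zero: "\<eta> \<boxtimes> \<epsilon> = zero 1 1" "\<epsilon> \<boxtimes> \<eta> = zero 1 1"
    using TArr_Comp_Arr[of "\<one> 0" \<eta> \<epsilon> "\<one> 0"] TArr_Comp_Arr[of \<epsilon> "\<one> 0" "\<one> 0" \<eta>]
    by (simp_all add: zero_def)
  consider (ll) "i < ?m" "j < ?n" | (lr) j' where "i < ?m" "j' < ?n'" "j = ?n + j'"
    | (rl) i' where "i' < ?m'" "i = ?m + i'" "j < ?n"
    | (rr) i' j' where "i' < ?m'" "i = ?m + i'" "j' < ?n'" "j = ?n + j'"
    using i j by (metis add_less_cancel_left le_Suc_ex not_less)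
  then show "proj (?n + ?n') j \<cdot> (f \<boxtimes> g) \<cdot> inj (?m + ?m') i = truth ((i, j) \<in> rel_sum ?m ?n R S)"
  proof cases
    case ll
    then show ?thesis
      by (simp add: inj_add_left D.inj_add_left TArr_Comp_Arr mon_hom_unit_eq counit_unit) (auto simp: rel_sum_def)
  next
    case lr
    then have "(i, j) \<notin> rel_sum ?m ?n R S" using R by (auto simp: rel_sum_def)
    with lr show ?thesis
      by (simp add: inj_add_left D.inj_add_right TArr_Comp_Arr mon_hom_unit_eq
          comon_hom_counit zero truth_def)
  next
    case rl
    then have "(i, j) \<notin> rel_sum ?m ?n R S" using R by (auto simp: rel_sum_def)
    with rl show ?thesis
      by (simp add: inj_add_right D.inj_add_left TArr_Comp_Arr mon_hom_unit_eq
          comon_hom_counit zero truth_def)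
  next
    case rr
    then have "(i, j) \<in> rel_sum ?m ?n R S \<longleftrightarrow> (i', j') \<in> S" using R by (auto simp: rel_sum_def)
    with rr show ?thesis
      by (simp add: inj_add_right D.inj_add_right TArr_Comp_Arr mon_hom_unit_eq counit_unit)
  qed
qed (use representsD[OF f] representsD[OF g] in simp_all)

text \<open>By naturality the symmetry carries injections to injections, so its entries are entries
  of an identity matrix.\<close>

lemma represents_Symm: "represents (\<tau> m n) (rel_swap m n)"
proof (rule representsI)
  fix i j assume i: "i < m + n" and j: "j < n + m"
  consider "i < m" | i' where "i = m + i'" "i' < n"
    using i by (metis add_less_cancel_left le_Suc_ex not_less)
  then show "proj (n + m) j \<cdot> \<tau> m n \<cdot> inj (m + n) i = truth ((i, j) \<in> rel_swap m n)"
  proof cases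
    case 1
    then have "\<tau> m n \<cdot> inj (m + n) i = inj (n + m) (n + i)"
      by (simp add: inj_add_left inj_add_right Symm_natural_Arr)
    then show ?thesis
      using 1 j by (simp add: proj_Ident_inj) (auto simp: rel_swap_def intro!: arg_cong[where f = truth])
  next
    case 2
    then have "\<tau> m n \<cdot> inj (m + n) i = inj (n + m) i'"
      by (simp add: inj_add_left inj_add_right Symm_natural_Arr)
    then show ?thesis
      using 2 j by (simp add: proj_Ident_inj) (auto simp: rel_swap_def intro!: arg_cong[where f = truth])
  qed
qed simp_all

lemma inj_1: "inj 1 0 = \<one> 1" "proj 1 0 = \<one> 1"
  using inj_Suc[of 0] D.inj_Suc[of 0] by simp_all

lemma represents_\<mu>: "represents \<mu> {(0, 0), (1, 0)}"
proof (rule representsI)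
  fix i j :: nat assume "i < 2" "j < 1"
  moreover have "inj 2 0 = \<one> 1 \<boxtimes> \<eta>" "inj 2 1 = \<eta> \<boxtimes> \<one> 1"
    using inj_Suc[of 1] inj_1 by (simp_all add: numeral_2_eq_2)
  ultimately show "proj 1 j \<cdot> \<mu> \<cdot> inj 2 i = truth ((i, j) \<in> {(0, 0), (1, 0)})"
    using inj_1 \<mu>_\<eta>_left \<mu>_\<eta>_right by (auto simp: less_2_cases_iff truth_def)
qed simp_all

lemma represents_\<Delta>: "represents \<Delta> {(0, 0), (0, 1)}"
proof (rule representsI)
  fix i j :: nat assume "i < 1" "j < 2"
  moreover have "proj 2 0 = \<one> 1 \<boxtimes> \<epsilon>" "proj 2 1 = \<epsilon> \<boxtimes> \<one> 1"
    using D.inj_Suc[of 1] inj_1 by (simp_all add: numeral_2_eq_2)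
  ultimately show "proj 2 j \<cdot> \<Delta> \<cdot> inj 1 i = truth ((i, j) \<in> {(0, 0), (0, 1)})"
    using inj_1 D.\<mu>_\<eta>_left D.\<mu>_\<eta>_right by (auto simp: less_2_cases_iff truth_def)
qed simp_all

lemma represents_\<eta>: "represents \<eta> {}"
  by (rule representsI[of _ 0 1]) simp_all

lemma represents_\<epsilon>: "represents \<epsilon> {}"
  by (rule representsI[of _ 1 0]) simp_all

end

section \<open>The PROP of finite relations\<close>

lemma FinRel_simps [simp]:
  "Obj FinRel = UNIV"
  "(m, R, n) \<in> Arr FinRel \<longleftrightarrow> R \<subseteq> {..<m} \<times> {..<n}"
  "Dom FinRel (m, R, n) = m" "Cod FinRel (m, R, n) = n"
  "Ident FinRel n = (n, Id_on {..<n}, n)"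
  "Comp FinRel (n', S, k) (m, R, n) = (m, R O S, k)"
  "TObj FinRel m n = m + n"
  "TArr FinRel (m, R, n) (m', R', n') = (m + m', rel_sum m n R R', n + n')"
  "Unit FinRel = 0"
  "Assoc FinRel m n k = (m + n + k, Id_on {..<m + n + k}, m + n + k)"
  "LUnit FinRel n = (n, Id_on {..<n}, n)"
  "RUnit FinRel n = (n, Id_on {..<n}, n)"
  "Symm FinRel m n = (m + n, rel_swap m n, n + m)"
  by (simp_all add: FinRel_def)

lemma rel_sum_iff: "(i, j) \<in> rel_sum m n R S \<longleftrightarrow> (i, j) \<in> R \<or> m \<le> i \<and> n \<le> j \<and> (i - m, j - n) \<in> S"
proof -
  have "(\<exists>i' j'. i = m + i' \<and> j = n + j' \<and> (i', j') \<in> S) \<longleftrightarrow> m \<le> i \<and> n \<le> j \<and> (i - m, j - n) \<in> S"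
    by (metis add_diff_cancel_left' le_add1 le_add_diff_inverse)
  then show ?thesis
    by (simp add: rel_sum_def)
qed

lemma rel_swap_iff: "(i, j) \<in> rel_swap m n \<longleftrightarrow> i < m \<and> j = n + i \<or> m \<le> i \<and> i < m + n \<and> j = i - m"
proof -
  have "(\<exists>j'. i = m + j' \<and> j = j' \<and> j' < n) \<longleftrightarrow> m \<le> i \<and> i < m + n \<and> j = i - m"
    by auto
  then show ?thesis
    by (auto simp: rel_swap_def)
qed

lemma rel_sum_mono:
  "\<lbrakk>R \<subseteq> {..<m} \<times> {..<n}; S \<subseteq> {..<m'} \<times> {..<n'}\<rbrakk> \<Longrightarrow> rel_sum m n R S \<subseteq> {..<m + m'} \<times> {..<n + n'}"
  by (fastforce simp: rel_sum_def)

lemma rel_sum_relcomp: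
  assumes "R \<subseteq> {..<m} \<times> {..<n}" "R' \<subseteq> {..<n} \<times> {..<k}"
  shows "rel_sum m n R S O rel_sum n k R' S' = rel_sum m k (R O R') (S O S')"
  using assms by (fastforce simp: rel_sum_def)

lemma rel_sum_assoc: "rel_sum (m + m') (n + n') (rel_sum m n R S) Q = rel_sum m n R (rel_sum m' n' S Q)"
  by (fastforce simp: rel_sum_def add.assoc)

lemma rel_sum_0 [simp]: "rel_sum 0 0 {} R = R" "rel_sum m n R {} = R"
  by (auto simp: rel_sum_def)

lemma rel_sum_Id_on: "rel_sum m m (Id_on {..<m}) (Id_on {..<n}) = Id_on {..<m + n}"
  by (auto simp: rel_sum_iff Id_on_iff)

text \<open>Composites and sums of graphs of functions are graphs, which turns equations between
  structural relations into equations between functions.\<close>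

definition graph_rel :: "nat \<Rightarrow> (nat \<Rightarrow> nat) \<Rightarrow> (nat \<times> nat) set" where
  "graph_rel m f = {(i, f i) | i. i < m}"

lemma graph_rel_iff [simp]: "(i, j) \<in> graph_rel m f \<longleftrightarrow> i < m \<and> j = f i"
  by (auto simp: graph_rel_def)

lemma graph_rel_relcomp: "(\<And>i. i < m \<Longrightarrow> f i < n) \<Longrightarrow> graph_rel m f O graph_rel n g = graph_rel m (g \<circ> f)"
  by (auto simp: relcomp_unfold)

lemma rel_sum_graph_rel:
  "rel_sum m n (graph_rel m f) (graph_rel k g) = graph_rel (m + k) (\<lambda>i. if i < m then f i else n + g (i - m))"
  by (auto simp: rel_sum_iff)

lemma graph_rel_cong: "(\<And>i. i < m \<Longrightarrow> f i = g i) \<Longrightarrow> graph_rel m f = graph_rel m g"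
  by auto

lemma Id_on_graph_rel: "Id_on {..<n} = graph_rel n (\<lambda>i. i)"
  by auto

lemma rel_swap_graph_rel: "rel_swap m n = graph_rel (m + n) (\<lambda>i. if i < m then n + i else i - m)"
  by (auto simp: rel_swap_iff)

lemma rel_swap_subset: "rel_swap m n \<subseteq> {..<m + n} \<times> {..<n + m}"
  by (auto simp: rel_swap_def)

lemma rel_swap_natural:
  assumes "R \<subseteq> {..<m} \<times> {..<m'}" "S \<subseteq> {..<n} \<times> {..<n'}"
  shows "rel_sum m m' R S O rel_swap m' n' = rel_swap m n O rel_sum n n' S R"
proof -
  have "rel_sum m m' R S O rel_swap m' n' = {(i, n' + j) | i j. (i, j) \<in> R} \<union> {(m + i, j) | i j. (i, j) \<in> S}"
    using assms by (fastforce simp: rel_sum_def rel_swap_def)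
  also have "\<dots> = rel_swap m n O rel_sum n n' S R"
    using assms by (fastforce simp: rel_sum_def rel_swap_def)
  finally show ?thesis .
qed

lemma Id_on_relcomp:
  assumes "R \<subseteq> {..<m} \<times> {..<n}"
  shows "Id_on {..<m} O R = R" "R O Id_on {..<n} = R"
  using assms by auto

lemma FinRel_category: "category FinRel"
  by unfold_locales (auto simp: Hom_iff O_assoc Id_on_relcomp)

theorem FinRel_prop_category: "prop_category FinRel"
proof -
  interpret category FinRel by (rule FinRel_category)
  have iso: "iso_arrow FinRel (n, Id_on {..<n}, n)" for n
    using iso_Ident[of n] by simp
  show ?thesis
  proof unfold_locales
    fix f a a' g b b' h c c'
    assume "f \<in> Hom FinRel a a'" "g \<in> Hom FinRel b b'" "h \<in> Hom FinRel c c'"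
    then obtain R S Q where R: "f = (a, R, a')" "g = (b, S, b')" "h = (c, Q, c')"
      "R \<subseteq> {..<a} \<times> {..<a'}" "S \<subseteq> {..<b} \<times> {..<b'}" "Q \<subseteq> {..<c} \<times> {..<c'}"
      by (cases f; cases g; cases h) (auto simp: Hom_iff)
    then show "Comp FinRel (Assoc FinRel a' b' c') (TArr FinRel (TArr FinRel f g) h)
        = Comp FinRel (TArr FinRel f (TArr FinRel g h)) (Assoc FinRel a b c)"
      using rel_sum_mono[of R a a' "rel_sum b b' S Q" "b + c" "b' + c'"] rel_sum_mono[of S b b' Q c c']
      by (simp add: rel_sum_assoc Id_on_relcomp add.assoc)
  next
    fix a b c a' b' c' f g f' g'
    assume "f \<in> Hom FinRel a b" "g \<in> Hom FinRel b c" "f' \<in> Hom FinRel a' b'" "g' \<in> Hom FinRel b' c'"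
    then show "TArr FinRel (Comp FinRel g f) (Comp FinRel g' f')
        = Comp FinRel (TArr FinRel g g') (TArr FinRel f f')"
      by (cases f; cases g; cases f'; cases g') (simp add: Hom_iff rel_sum_relcomp)
  next
    fix f a b c d g
    assume "f \<in> Hom FinRel a b" "g \<in> Hom FinRel c d"
    then show "TArr FinRel f g \<in> Hom FinRel (TObj FinRel a c) (TObj FinRel b d)"
      by (cases f; cases g) (simp add: Hom_iff rel_sum_mono)
  next
    fix f a a' g b b'
    assume "f \<in> Hom FinRel a a'" "g \<in> Hom FinRel b b'"
    then show "Comp FinRel (Symm FinRel a' b') (TArr FinRel f g)
        = Comp FinRel (TArr FinRel g f) (Symm FinRel a b)"
      by (cases f; cases g) (simp add: Hom_iff rel_swap_natural)
  next
    fix a b :: nat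
    show "Comp FinRel (Symm FinRel b a) (Symm FinRel a b) = Ident FinRel (TObj FinRel a b)"
      by (simp add: rel_swap_graph_rel Id_on_graph_rel)
        (subst graph_rel_relcomp, auto intro!: graph_rel_cong)
  next
    fix a b c :: nat
    show "Comp FinRel (Assoc FinRel b c a) (Comp FinRel (Symm FinRel a (TObj FinRel b c)) (Assoc FinRel a b c))
      = Comp FinRel (TArr FinRel (Ident FinRel b) (Symm FinRel a c))
          (Comp FinRel (Assoc FinRel b a c) (TArr FinRel (Symm FinRel a b) (Ident FinRel c)))"
      by (simp add: rel_swap_graph_rel Id_on_graph_rel rel_sum_graph_rel)
        (auto simp: relcomp_unfold)
  qed (auto simp: Hom_iff iso rel_sum_Id_on Id_on_relcomp rel_swap_subset add.assoc simp flip: rel_sum_assoc)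
qed

section \<open>The bimonoid on the one-point set and the relations it generates\<close>

lemma (in prop_category) middle_swap_eq: "middle_swap T a = \<one> a \<boxtimes> \<tau> a a \<boxtimes> \<one> a"
  by (simp add: middle_swap_def add.assoc)

interpretation FinRel: prop_category FinRel
  by (rule FinRel_prop_category)

text \<open>Multiplication is the graph of the codiagonal of the one-point set, comultiplication the
  converse relation.\<close>

definition FinRel_bimonoid :: "(nat, nat \<times> (nat \<times> nat) set \<times> nat) bimonoid" where
  "FinRel_bimonoid = \<lparr>Carrier = 1, Mult = (2, {(0, 0), (1, 0)}, 1), Eta = (0, {}, 1),
     Comult = (1, {(0, 0), (0, 1)}, 2), Counit = (1, {}, 0)\<rparr>"

lemma FinRel_bimonoid_simps [simp]:
  "Carrier FinRel_bimonoid = 1" "Mult FinRel_bimonoid = (2, {(0, 0), (1, 0)}, 1)"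
  "Eta FinRel_bimonoid = (0, {}, 1)"
  "Comult FinRel_bimonoid = (1, {(0, 0), (0, 1)}, 2)" "Counit FinRel_bimonoid = (1, {}, 0)"
  by (simp_all add: FinRel_bimonoid_def)

text \<open>Every relation in the axioms is an explicit finite set, so each axiom is a computation;
  the local rules evaluate sums, images and composites of sets written with
  \<open>insert\<close>.\<close>

lemma FinRel_bimonoid: "special_bicommutative_bimonoid FinRel FinRel_bimonoid"
proof -
  have inv: "inv_arrow FinRel (n, Id_on {..<n}, n) = (n, Id_on {..<n}, n)" for n
    using FinRel.inv_Ident[of n] by simp
  have Id_on_insert: "Id_on (insert a A) = insert (a, a) (Id_on A)" for a :: nat and A
    by auto
  have sum_insert: "rel_sum m n R (insert (a, b) S) = insert (m + a, n + b) (rel_sum m n R S)" for m n R a b S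
    by (auto simp: rel_sum_def)
  have swap: "rel_swap 1 1 = {(0, 1), (1, 0)}"
    by (auto simp: rel_swap_def)
  have comp_insert: "insert (a, b) R O S = Pair a ` (S `` {b}) \<union> R O S" for a b :: nat and R S :: "nat rel"
    by auto
  have Image_insert: "insert (a, b) R `` {c} = (if a = c then insert b (R `` {c}) else R `` {c})"
    for a b c :: nat and R :: "nat rel"
    by auto
  show ?thesis
    by unfold_locales
      (simp_all add: Hom_iff FinRel.middle_swap_eq inv inv[of 0, simplified] lessThan_Suc numeral_eq_Suc Id_on_insert
        sum_insert swap[simplified] comp_insert Image_insert insert_commute)
qed

text \<open>A relation out of a single point duplicates that point. One copy decides about the
  target 0, the other carries the remaining targets, shifted down by one.\<close>

lemma relation_split_column:
  assumes "R \<subseteq> {..<1} \<times> {..<Suc n}"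
  shows "{(0, 0), (0, 1)} O rel_sum 1 1 (if (0, 0) \<in> R then Id_on {..<1} else {}) {(i, j). (i, Suc j) \<in> R} = R"
    (is "_ O ?S = R")
proof -
  have "(i, j) \<in> {(0, 0), (0, 1)} O ?S \<longleftrightarrow> (i, j) \<in> R" for i j
  proof -
    have R: "(i, j) \<in> R \<Longrightarrow> i = 0" for i j using assms by auto
    have "(i, j) \<in> {(0, 0), (0, 1)} O S \<longleftrightarrow> i = 0 \<and> ((0, j) \<in> S \<or> (1, j) \<in> S)" for S :: "nat rel"
      by auto
    then show ?thesis
      by (cases j) (auto simp: rel_sum_iff dest: R)
  qed
  then show ?thesis by (simp only: set_eq_iff split_paired_All simp_thms)
qed

text \<open>The source point 0 and the remaining source points are related to separate copies of the
  target, which the codiagonal \<open>n + n \<rightarrow> n\<close> then identifies.\<close>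

lemma relation_split_row:
  assumes "R \<subseteq> {..<Suc m} \<times> {..<n}"
  shows "rel_sum 1 n {(i, j). (i, j) \<in> R \<and> i = 0} {(i, j). (Suc i, j) \<in> R}
    O graph_rel (n + n) (\<lambda>i. if i < n then i else i - n) = R" (is "?S O ?c = R")
proof -
  have "(i, j) \<in> ?S O ?c \<longleftrightarrow> (i, j) \<in> R" for i j
  proof
    assume "(i, j) \<in> ?S O ?c"
    then show "(i, j) \<in> R"
      using assms by (cases i) (auto simp: rel_sum_iff split: if_splits)
  next
    assume ij: "(i, j) \<in> R"
    then have "j < n" using assms by auto
    then show "(i, j) \<in> ?S O ?c"
      using ij by (cases i) (auto simp: rel_sum_iff intro: relcompI[of _ j] relcompI[of _ "n + j"])
  qed
  then show ?thesis by (simp only: set_eq_iff split_paired_All simp_thms)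
qed

text \<open>This is the recursion \<open>mult (Suc n) = join 1 n \<mu> (mult n)\<close> for
  relations: the codiagonal of \<open>Suc n\<close> points comes from those of 1 and of
  \<open>n\<close> points after a middle swap.\<close>

lemma codiagonal_Suc:
  "rel_sum 1 1 (Id_on {..<1}) (rel_sum (n + 1) (1 + n) (rel_swap n 1) (Id_on {..<n}))
    O rel_sum 2 1 {(0, 0), (1, 0)} (graph_rel (n + n) (\<lambda>i. if i < n then i else i - n))
    = graph_rel (Suc n + Suc n) (\<lambda>i. if i < Suc n then i else i - Suc n)"
proof -
  have mult: "{(0, 0), (1, 0)} = graph_rel 2 (\<lambda>_. 0)"
    by (auto simp: less_2_cases_iff)
  show ?thesis
    unfolding mult rel_swap_graph_rel Id_on_graph_rel rel_sum_graph_rel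
    by (subst graph_rel_relcomp) (auto intro!: graph_rel_cong)
qed

text \<open>Sources are taken apart point by point and reassembled with codiagonals, and a relation
  out of one point is built from duplications. The rule asserts generation only; equations between
  generators do not occur in it. It serves for naturality of an extension and for existence of
  representing arrows.\<close>

lemma FinRel_induct:
  assumes "f \<in> Arr FinRel"
    and Ident: "\<And>n. P (Ident FinRel n)"
    and Symm: "\<And>m n. P (Symm FinRel m n)"
    and mult: "P (Mult FinRel_bimonoid)" and unit: "P (Eta FinRel_bimonoid)"
    and comult: "P (Comult FinRel_bimonoid)" and counit: "P (Counit FinRel_bimonoid)"
    and comp: "\<And>f g. \<lbrakk>f \<in> Arr FinRel; g \<in> Arr FinRel; Dom FinRel g = Cod FinRel f; P f; P g\<rbrakk> \<Longrightarrow> P (Comp FinRel g f)"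
    and tensor: "\<And>f g. \<lbrakk>f \<in> Arr FinRel; g \<in> Arr FinRel; P f; P g\<rbrakk> \<Longrightarrow> P (TArr FinRel f g)"
  shows "P f"
proof -
  have comp': "P (m, R O S, k)" if "P (m, R, n)" "P (n, S, k)" "R \<subseteq> {..<m} \<times> {..<n}" "S \<subseteq> {..<n} \<times> {..<k}"
    for m n k R S
    using comp[of "(m, R, n)" "(n, S, k)"] that by simp
  have tensor': "P (m + m', rel_sum m n R S, n + n')"
    if "P (m, R, n)" "P (m', S, n')" "R \<subseteq> {..<m} \<times> {..<n}" "S \<subseteq> {..<m'} \<times> {..<n'}" for m n m' n' R S
    using tensor[of "(m, R, n)" "(m', S, n')"] that by simp
  have empty: "P (0, {}, n)" for n
  proof (induction n)
    case 0
    show ?case using Ident[of 0] by simp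
  next
    case (Suc n)
    then show ?case using tensor'[of 0 "{}" 1 0 "{}" n] unit by simp
  qed
  let ?c = "\<lambda>n i. if i < n then i else i - n :: nat"
  have codiag: "P (n + n, graph_rel (n + n) (?c n), n)" for n
  proof (induction n)
    case 0
    show ?case using Ident[of 0] by (simp add: graph_rel_def)
  next
    case (Suc n)
    let ?Q = "rel_sum 1 1 (Id_on {..<1}) (rel_sum (n + 1) (1 + n) (rel_swap n 1) (Id_on {..<n}))"
      and ?M = "rel_sum 2 1 {(0, 0), (1, 0)} (graph_rel (n + n) (?c n))"
    have "P (2 + (n + n), ?M, 1 + n)"
      using Suc mult by (intro tensor') auto
    moreover have "P (1 + (n + 1 + n), ?Q, 1 + (1 + n + n))"
      using Ident[of 1] Ident[of n] Symm[of n 1]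
      by (intro tensor' rel_sum_mono rel_swap_subset) (auto simp: rel_swap_subset)
    moreover have "?Q \<subseteq> {..<1 + (n + 1 + n)} \<times> {..<1 + (1 + n + n)}"
      by (intro rel_sum_mono rel_swap_subset) auto
    moreover have "?M \<subseteq> {..<2 + (n + n)} \<times> {..<1 + n}"
      by (intro rel_sum_mono) auto
    ultimately have "P (Suc n + Suc n, ?Q O ?M, Suc n)"
      using comp'[of "1 + (n + 1 + n)" ?Q "2 + (n + n)" ?M "1 + n"] by simp
    also have "rel_sum 1 1 (Id_on {..<1}) (rel_sum (n + 1) (1 + n) (rel_swap n 1) (Id_on {..<n}))
        O rel_sum 2 1 {(0, 0), (1, 0)} (graph_rel (n + n) (?c n)) = graph_rel (Suc n + Suc n) (?c (Suc n))"
      by (rule codiagonal_Suc)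
    finally show ?case by simp
  qed
  have row: "P (1, R, n)" if "R \<subseteq> {..<1} \<times> {..<n}" for R n
    using that
  proof (induction n arbitrary: R)
    case 0
    then show ?case using counit by simp
  next
    case (Suc n)
    let ?R0 = "if (0, 0) \<in> R then Id_on {..<1} else {}" and ?R' = "{(i, j). (i, Suc j) \<in> R}"
    have R': "?R' \<subseteq> {..<1} \<times> {..<n}" and R0: "?R0 \<subseteq> {..<1} \<times> {..<1}" using Suc.prems by auto
    \<comment> \<open>If \<open>(0, 0)\<close> is missing, this is the empty relation on one point:
      the counit followed by the unit, a composite through the object 0.\<close>
    have "P (1, ?R0, 1)"
      using Ident[of 1] comp'[of 1 "{}" 0 "{}" 1] unit counit by simp
    then have "P (2, rel_sum 1 1 ?R0 ?R', Suc n)"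
      using tensor'[OF _ Suc.IH[OF R'] R0 R'] by (simp add: numeral_2_eq_2)
    then have "P (1, {(0, 0), (0, 1)} O rel_sum 1 1 ?R0 ?R', Suc n)"
      using rel_sum_mono[OF R0 R'] comult by (intro comp'[of _ _ 2]) (auto simp: numeral_2_eq_2)
    also have "{(0, 0), (0, 1)} O rel_sum 1 1 ?R0 ?R' = R"
      using Suc.prems by (rule relation_split_column)
    finally show ?case .
  qed
  have "P (m, R, n)" if "R \<subseteq> {..<m} \<times> {..<n}" for R m n
    using that
  proof (induction m arbitrary: R)
    case 0
    then show ?case using empty by simp
  next
    case (Suc m)
    let ?R0 = "{(i, j). (i, j) \<in> R \<and> i = 0}" and ?R' = "{(i, j). (Suc i, j) \<in> R}"
    have R': "?R' \<subseteq> {..<m} \<times> {..<n}" and R0: "?R0 \<subseteq> {..<1} \<times> {..<n}" using Suc.prems by auto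
    have "P (Suc m, rel_sum 1 n ?R0 ?R', n + n)"
      using tensor'[OF row[OF R0] Suc.IH[OF R'] R0 R'] by simp
    then have "P (Suc m, rel_sum 1 n ?R0 ?R' O graph_rel (n + n) (?c n), n)"
      using rel_sum_mono[OF R0 R'] codiag[of n] by (intro comp'[of _ _ "n + n"]) (auto simp: graph_rel_def)
    also have "rel_sum 1 n ?R0 ?R' O graph_rel (n + n) (?c n) = R"
      using Suc.prems by (rule relation_split_row)
    finally show ?case .
  qed
  then show ?thesis
    using assms(1) by (cases f) auto
qed

section \<open>Equivalences and strong monoidal functors\<close>

lemma cat_functor_id: "category A \<Longrightarrow> cat_functor A A id_functor"
  by (simp add: cat_functor_def cat_functor_axioms_def id_functor_def)

lemma cat_functor_comp:
  assumes "cat_functor A B F" "cat_functor B D G"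
  shows "cat_functor A D (comp_functor G F)"
proof -
  interpret F: cat_functor A B F by fact
  interpret G: cat_functor B D G by fact
  show ?thesis
    by unfold_locales
      (auto simp: comp_functor_def F.FArr_Ident G.FArr_Ident F.FArr_Comp F.FObj_in_Obj
        intro: F.FObj_in_Obj G.FObj_in_Obj F.FArr_in_Hom G.FArr_in_Hom G.FArr_Comp)
qed

text \<open>Choice gives sections \<open>s\<close> on objects and \<open>p\<close> on hom-sets, and
  faithfulness makes \<open>p\<close> functorial. Surjectivity on the nose turns the counit into an
  identity; the unit at \<open>a\<close> is the lift of the identity of \<open>FObj F a\<close>,
  inverted by the lift in the opposite direction.\<close>

lemma equivalent_categoriesI:
  fixes F :: "('o1, 'm1, 'o2, 'm2) cat_map"
  assumes "cat_functor A B F"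
    and surj: "\<And>b. b \<in> Obj B \<Longrightarrow> \<exists>a\<in>Obj A. FObj F a = b"
    and faithful: "\<And>a a' f g. \<lbrakk>f \<in> Hom A a a'; g \<in> Hom A a a'; FArr F f = FArr F g\<rbrakk> \<Longrightarrow> f = g"
    and full: "\<And>a a' g. \<lbrakk>a \<in> Obj A; a' \<in> Obj A; g \<in> Hom B (FObj F a) (FObj F a')\<rbrakk>
      \<Longrightarrow> \<exists>f\<in>Hom A a a'. FArr F f = g"
  shows "equivalent_categories A B"
proof -
  interpret F: cat_functor A B F by fact
  define s where "s b = (SOME a. a \<in> Obj A \<and> FObj F a = b)" for b
  define p where "p a a' g = (SOME f. f \<in> Hom A a a' \<and> FArr F f = g)" for a a' g
  have s [simp]: "s b \<in> Obj A" "FObj F (s b) = b" if "b \<in> Obj B" for b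
    using someI_ex[of "\<lambda>a. a \<in> Obj A \<and> FObj F a = b"] surj[OF that] unfolding s_def by blast+
  have p: "p a a' g \<in> Hom A a a'" "FArr F (p a a' g) = g"
    if "a \<in> Obj A" "a' \<in> Obj A" "g \<in> Hom B (FObj F a) (FObj F a')" for a a' g
    using someI_ex[of "\<lambda>f. f \<in> Hom A a a' \<and> FArr F f = g"] full[OF that] unfolding p_def by blast+
  have p_eq: "p a a' g = f" if "f \<in> Hom A a a'" "FArr F f = g" "a \<in> Obj A" "a' \<in> Obj A" for a a' f g
    using p[of a a' g] that F.FArr_in_Hom[of f a a'] by (intro faithful[of _ a a']) auto
  define G where "G = \<lparr>FObj = s, FArr = (\<lambda>g. p (s (Dom B g)) (s (Cod B g)) g)\<rparr>"
  define \<eta> where "\<eta> a = p a (s (FObj F a)) (\<one>\<^bsub>B\<^esub> (FObj F a))" for a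
  have G: "cat_functor B A G"
  proof unfold_locales
    fix f a b assume f: "f \<in> Hom B a b"
    then have "a \<in> Obj B" "b \<in> Obj B" by (auto simp: Hom_iff)
    then show "FArr G f \<in> Hom A (FObj G a) (FObj G b)"
      using f p[of "s a" "s b" f] by (auto simp: G_def Hom_iff)
  next
    fix a assume "a \<in> Obj B"
    then show "FArr G (\<one>\<^bsub>B\<^esub> a) = \<one>\<^bsub>A\<^esub> (FObj G a)"
      unfolding G_def by (auto intro!: p_eq F.A.Ident_in_Hom simp: F.FArr_Ident)
  next
    fix f a b g c assume f: "f \<in> Hom B a b" and g: "g \<in> Hom B b c"
    then have *: "a \<in> Obj B" "b \<in> Obj B" "c \<in> Obj B" by (auto simp: Hom_iff)
    have "p (s a) (s c) (g \<cdot>\<^bsub>B\<^esub> f) = p (s b) (s c) g \<cdot>\<^bsub>A\<^esub> p (s a) (s b) f"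
      using f g * p[of "s a" "s b" f] p[of "s b" "s c" g]
      by (intro p_eq F.A.Comp_in_Hom) (auto simp: F.FArr_Comp)
    then show "FArr G (g \<cdot>\<^bsub>B\<^esub> f) = FArr G g \<cdot>\<^bsub>A\<^esub> FArr G f"
      using f g by (simp add: G_def Hom_iff)
  qed (simp add: G_def)
  interpret G: cat_functor B A G by (rule G)
  have \<eta>: "\<eta> a \<in> Hom A a (s (FObj F a))" "FArr F (\<eta> a) = \<one>\<^bsub>B\<^esub> (FObj F a)" if "a \<in> Obj A" for a
    using p[of a "s (FObj F a)" "\<one>\<^bsub>B\<^esub> (FObj F a)"] that F.FObj_in_Obj F.B.Ident_in_Hom
    by (auto simp: \<eta>_def)
  interpret IA: cat_functor A A id_functor by (rule cat_functor_id) unfold_locales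
  interpret IB: cat_functor B B id_functor by (rule cat_functor_id) unfold_locales
  interpret GF: cat_functor A A "comp_functor G F" by (rule cat_functor_comp) unfold_locales
  interpret FG: cat_functor B B "comp_functor F G" by (rule cat_functor_comp) unfold_locales
  have "natural_isomorphism A A id_functor (comp_functor G F) \<eta>"
  proof unfold_locales
    fix f a b assume f: "f \<in> Hom A a b"
    then have *: "a \<in> Obj A" "b \<in> Obj A" by (auto simp: Hom_iff)
    note Ff = F.FArr_in_Hom[OF f] and GFf = G.FArr_in_Hom[OF F.FArr_in_Hom[OF f]]
    have FGF: "FArr F (FArr G (FArr F f)) = FArr F f"
      using Ff * p[of "s (FObj F a)" "s (FObj F b)" "FArr F f"] F.FObj_in_Obj
      by (simp add: G_def Hom_iff)
    have GFf': "FArr G (FArr F f) \<in> Hom A (s (FObj F a)) (s (FObj F b))"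
      using GFf by (simp add: G_def)
    have "\<eta> b \<cdot>\<^bsub>A\<^esub> f = FArr G (FArr F f) \<cdot>\<^bsub>A\<^esub> \<eta> a"
    proof (rule faithful)
      show "\<eta> b \<cdot>\<^bsub>A\<^esub> f \<in> Hom A a (s (FObj F b))"
        using f \<eta>[OF *(2)] by (auto intro: F.A.Comp_in_Hom)
      show "FArr G (FArr F f) \<cdot>\<^bsub>A\<^esub> \<eta> a \<in> Hom A a (s (FObj F b))"
        using GFf' \<eta>[OF *(1)] by (auto intro: F.A.Comp_in_Hom)
      show "FArr F (\<eta> b \<cdot>\<^bsub>A\<^esub> f) = FArr F (FArr G (FArr F f) \<cdot>\<^bsub>A\<^esub> \<eta> a)"
        using f Ff \<eta>[OF *(1)] \<eta>[OF *(2)] GFf'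
        by (simp add: F.FArr_Comp[of f a b] F.FArr_Comp[of "\<eta> a" a "s (FObj F a)"] FGF Hom_iff)
    qed
    then show "\<eta> b \<cdot>\<^bsub>A\<^esub> FArr id_functor f = FArr (comp_functor G F) f \<cdot>\<^bsub>A\<^esub> \<eta> a"
      by (simp add: id_functor_def comp_functor_def)
  next
    fix a assume a: "a \<in> Obj A"
    let ?b = "s (FObj F a)"
    have b: "?b \<in> Obj A" "FObj F ?b = FObj F a" using a F.FObj_in_Obj by auto
    obtain h where h: "h \<in> Hom A ?b a" "FArr F h = \<one>\<^bsub>B\<^esub> (FObj F a)"
      using full[of ?b a "\<one>\<^bsub>B\<^esub> (FObj F a)"] a b F.FObj_in_Obj F.B.Ident_in_Hom by auto
    have "h \<cdot>\<^bsub>A\<^esub> \<eta> a = \<one>\<^bsub>A\<^esub> a"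
    proof (rule faithful[of _ a a])
      show "FArr F (h \<cdot>\<^bsub>A\<^esub> \<eta> a) = FArr F (\<one>\<^bsub>A\<^esub> a)"
        using h \<eta>[OF a] a F.FObj_in_Obj by (simp add: F.FArr_Comp[of "\<eta> a" a ?b] F.FArr_Ident)
    qed (use h \<eta>[OF a] a F.A.Comp_in_Hom F.A.Ident_in_Hom in auto)
    moreover have "\<eta> a \<cdot>\<^bsub>A\<^esub> h = \<one>\<^bsub>A\<^esub> ?b"
    proof (rule faithful[of _ ?b ?b])
      show "FArr F (\<eta> a \<cdot>\<^bsub>A\<^esub> h) = FArr F (\<one>\<^bsub>A\<^esub> ?b)"
        using h \<eta>[OF a] a b F.FObj_in_Obj by (simp add: F.FArr_Comp[of h ?b a] F.FArr_Ident)
    qed (use h \<eta>[OF a] a b F.A.Comp_in_Hom F.A.Ident_in_Hom in auto)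
    ultimately have "inverse_arrows A (\<eta> a) h"
      using h \<eta>[OF a] by (auto simp: F.A.inverse_arrows_iff Hom_iff)
    then show "iso_arrow A (\<eta> a)"
      by (rule F.A.inverse_arrows_iso)
  qed (use \<eta> in \<open>auto simp: id_functor_def comp_functor_def G_def\<close>)
  moreover have "natural_isomorphism B B (comp_functor F G) id_functor (\<lambda>b. \<one>\<^bsub>B\<^esub> b)"
  proof unfold_locales
    fix f a b assume f: "f \<in> Hom B a b"
    then have "a \<in> Obj B" "b \<in> Obj B" by (auto simp: Hom_iff)
    then have "FArr F (FArr G f) = f"
      using p[of "s a" "s b" f] f by (simp add: G_def Hom_iff)
    then show "\<one>\<^bsub>B\<^esub> b \<cdot>\<^bsub>B\<^esub> FArr (comp_functor F G) f = FArr id_functor f \<cdot>\<^bsub>B\<^esub> \<one>\<^bsub>B\<^esub> a"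
      using f by (simp add: comp_functor_def id_functor_def Hom_iff)
  qed (auto simp: comp_functor_def id_functor_def G_def F.B.Ident_in_Hom)
  ultimately show ?thesis
    unfolding equivalent_categories_def using F.A.category_axioms F.B.category_axioms assms(1) G by blast
qed

section \<open>Strong monoidal functors preserve special bicommutative bimonoids\<close>

definition image_bimonoid ::
  "('o2, 'm2, 'z2) sm_category_scheme \<Rightarrow> ('o1, 'm1, 'o2, 'm2, 'z3) mon_map_scheme
    \<Rightarrow> ('o1, 'm1) bimonoid \<Rightarrow> ('o2, 'm2) bimonoid" where
  "image_bimonoid C F B =
     \<lparr>Carrier = FObj F (Carrier B),
      Mult = FArr F (Mult B) \<cdot>\<^bsub>C\<^esub> Phi F (Carrier B) (Carrier B),
      Eta = FArr F (Eta B) \<cdot>\<^bsub>C\<^esub> Phi0 F,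
      Comult = inv_arrow C (Phi F (Carrier B) (Carrier B)) \<cdot>\<^bsub>C\<^esub> FArr F (Comult B),
      Counit = inv_arrow C (Phi0 F) \<cdot>\<^bsub>C\<^esub> FArr F (Counit B)\<rparr>"

text \<open>This adds no assumption; it only makes the target the structure to which unadorned
  symbols refer, primed symbols referring to the source.\<close>

locale strong_functor = symmetric_monoidal_functor T C F
  for T :: "('o1, 'm1, 'z1) sm_category_scheme"
    and C :: "('o2, 'm2, 'z2) sm_category_scheme" (structure)
    and F :: "('o1, 'm1, 'o2, 'm2, 'z3) mon_map_scheme"
begin

abbreviation tens (infixr "\<otimes>''" 70) where "a \<otimes>' b \<equiv> a \<otimes>\<^bsub>T\<^esub> b"
abbreviation tensA (infixr "\<boxtimes>''" 70) where "f \<boxtimes>' g \<equiv> f \<boxtimes>\<^bsub>T\<^esub> g"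
abbreviation compT (infixr "\<cdot>''" 65) where "f \<cdot>' g \<equiv> f \<cdot>\<^bsub>T\<^esub> g"
abbreviation identT ("\<one>''") where "\<one>' a \<equiv> \<one>\<^bsub>T\<^esub> a"
abbreviation "\<Phi> \<equiv> Phi F"
abbreviation "\<Psi> a b \<equiv> inv_arrow C (Phi F a b)"
abbreviation "\<Phi>0 \<equiv> Phi0 F"
abbreviation "\<Psi>0 \<equiv> inv_arrow C (Phi0 F)"

lemma FObj_Obj [simp]: "a \<in> Obj T \<Longrightarrow> FObj F a \<in> Obj C"
  by (rule FObj_in_Obj)

lemma FArr_simps [simp]:
  assumes "f \<in> Arr T"
  shows "FArr F f \<in> Arr C" "Dom C (FArr F f) = FObj F (Dom T f)" "Cod C (FArr F f) = FObj F (Cod T f)"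
  using FArr_in_Hom[of f "Dom T f" "Cod T f"] assms by (simp_all add: Hom_iff)

lemma FArr_Ident_simp [simp]: "a \<in> Obj T \<Longrightarrow> FArr F (\<one>' a) = \<one> (FObj F a)"
  by (rule FArr_Ident)

lemma FArr_Comp_Arr:
  "\<lbrakk>f \<in> Arr T; g \<in> Arr T; Dom T g = Cod T f\<rbrakk> \<Longrightarrow> FArr F (g \<cdot>' f) = FArr F g \<cdot> FArr F f"
  by (rule FArr_Comp) (auto simp: Hom_iff)

lemma Phi_simps [simp]:
  assumes "a \<in> Obj T" "b \<in> Obj T"
  shows "\<Phi> a b \<in> Arr C" "Dom C (\<Phi> a b) = FObj F a \<otimes> FObj F b" "Cod C (\<Phi> a b) = FObj F (a \<otimes>' b)"
    "iso_arrow C (\<Phi> a b)"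
  using Phi_in_Hom[OF assms] Phi_iso[OF assms] by (simp_all add: Hom_iff)

lemma Phi0_simps [simp]:
  "\<Phi>0 \<in> Arr C" "Dom C \<Phi>0 = \<I>" "Cod C \<Phi>0 = FObj F \<I>\<^bsub>T\<^esub>" "iso_arrow C \<Phi>0"
  using Phi0_in_Hom Phi0_iso by (simp_all add: Hom_iff)

lemma Phi_natural_Arr:
  "\<lbrakk>f \<in> Arr T; g \<in> Arr T; a = Dom T f; b = Dom T g\<rbrakk>
    \<Longrightarrow> FArr F (f \<boxtimes>' g) \<cdot> \<Phi> a b = \<Phi> (Cod T f) (Cod T g) \<cdot> (FArr F f \<boxtimes> FArr F g)"
  by (rule Phi_natural[symmetric]) (auto simp: Hom_iff)

lemma inverse_arrows_FArr:
  assumes "iso_arrow T f"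
  shows "inverse_arrows C (FArr F f) (FArr F (inv_arrow T f))"
  using assms FArr_Comp_Arr[of f "inv_arrow T f"] FArr_Comp_Arr[of "inv_arrow T f" f]
  by (simp add: C.inverse_arrows_iff)

lemma FArr_iso [simp]: "iso_arrow T f \<Longrightarrow> iso_arrow C (FArr F f)"
  by (rule C.inverse_arrows_iso[OF inverse_arrows_FArr])

lemma FArr_inv: "iso_arrow T f \<Longrightarrow> FArr F (inv_arrow T f) = inv_arrow C (FArr F f)"
  by (rule C.inv_arrow_eq[OF inverse_arrows_FArr, symmetric])

text \<open>Each axiom is the image of the same axiom in \<open>T\<close>. Naturality of
  \<open>\<Phi>\<close> gathers the structure isomorphisms on the right, where the coherence law of
  \<open>F\<close> for the associator, unitor or symmetry exchanges the constraint of
  \<open>T\<close> for that of \<open>C\<close>.\<close>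

lemma image_commutative_monoid:
  assumes "commutative_monoid_in T A \<mu> \<eta>"
  shows "commutative_monoid_in C (FObj F A) (FArr F \<mu> \<cdot> \<Phi> A A) (FArr F \<eta> \<cdot> \<Phi>0)"
proof -
  interpret A: commutative_monoid_in T A \<mu> \<eta> by fact
  have [simp]: "A \<in> Obj T" "\<mu> \<in> Arr T" "Dom T \<mu> = A \<otimes>' A" "Cod T \<mu> = A"
    "\<eta> \<in> Arr T" "Dom T \<eta> = \<I>\<^bsub>T\<^esub>" "Cod T \<eta> = A"
    using A.carrier_in_Obj A.mult_in_Hom A.unit_in_Hom by (simp_all add: Hom_iff)
  show ?thesis
  proof unfold_locales
    let ?\<mu> = "FArr F \<mu> \<cdot> \<Phi> A A" and ?\<eta> = "FArr F \<eta> \<cdot> \<Phi>0"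
    show "?\<mu> \<cdot> (?\<mu> \<boxtimes> \<one> (FObj F A)) = ?\<mu> \<cdot> (\<one> (FObj F A) \<boxtimes> ?\<mu>) \<cdot> \<alpha> (FObj F A) (FObj F A) (FObj F A)"
    proof -
      have "?\<mu> \<cdot> (?\<mu> \<boxtimes> \<one> (FObj F A)) = FArr F (\<mu> \<cdot>' (\<mu> \<boxtimes>' \<one>' A)) \<cdot> \<Phi> (A \<otimes>' A) A \<cdot> (\<Phi> A A \<boxtimes> \<one> (FObj F A))"
        by (simp add: FArr_Comp_Arr C.Comp_chain[OF Phi_natural_Arr] C.TArr_Comp_Arr)
      also have "\<dots> = FArr F (\<mu> \<cdot>' (\<one>' A \<boxtimes>' \<mu>)) \<cdot> FArr F (\<alpha>\<^bsub>T\<^esub> A A A) \<cdot> \<Phi> (A \<otimes>' A) A \<cdot> (\<Phi> A A \<boxtimes> \<one> (FObj F A))"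
        by (simp add: FArr_Comp_Arr A.mult_assoc)
      also have "\<dots> = ?\<mu> \<cdot> (\<one> (FObj F A) \<boxtimes> ?\<mu>) \<cdot> \<alpha> (FObj F A) (FObj F A) (FObj F A)"
        by (simp add: FArr_Comp_Arr Phi_Assoc C.Comp_chain[OF Phi_natural_Arr] C.TArr_Comp_chain)
      finally show ?thesis .
    qed
    show "?\<mu> \<cdot> (?\<eta> \<boxtimes> \<one> (FObj F A)) = \<l> (FObj F A)"
    proof -
      have "?\<mu> \<cdot> (?\<eta> \<boxtimes> \<one> (FObj F A)) = FArr F (\<mu> \<cdot>' (\<eta> \<boxtimes>' \<one>' A)) \<cdot> \<Phi> \<I>\<^bsub>T\<^esub> A \<cdot> (\<Phi>0 \<boxtimes> \<one> (FObj F A))"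
        by (simp add: FArr_Comp_Arr C.Comp_chain[OF Phi_natural_Arr] C.TArr_Comp_Arr)
      then show ?thesis
        by (simp add: A.mult_unit_left Phi_LUnit)
    qed
    show "?\<mu> \<cdot> (\<one> (FObj F A) \<boxtimes> ?\<eta>) = \<r> (FObj F A)"
    proof -
      have "?\<mu> \<cdot> (\<one> (FObj F A) \<boxtimes> ?\<eta>) = FArr F (\<mu> \<cdot>' (\<one>' A \<boxtimes>' \<eta>)) \<cdot> \<Phi> A \<I>\<^bsub>T\<^esub> \<cdot> (\<one> (FObj F A) \<boxtimes> \<Phi>0)"
        by (simp add: FArr_Comp_Arr C.Comp_chain[OF Phi_natural_Arr] C.TArr_Comp_Arr)
      then show ?thesis
        by (simp add: A.mult_unit_right Phi_RUnit)
    qed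
    show "?\<mu> \<cdot> \<tau> (FObj F A) (FObj F A) = ?\<mu>"
    proof -
      have "?\<mu> \<cdot> \<tau> (FObj F A) (FObj F A) = FArr F (\<mu> \<cdot>' \<tau>\<^bsub>T\<^esub> A A) \<cdot> \<Phi> A A"
        by (simp add: FArr_Comp_Arr Phi_Symm)
      then show ?thesis by (simp add: A.mult_comm)
    qed
  qed (simp_all add: Hom_iff)
qed

lemma image_cocommutative_comonoid:
  assumes "cocommutative_comonoid_in T A \<Delta> \<epsilon>"
  shows "cocommutative_comonoid_in C (FObj F A) (\<Psi> A A \<cdot> FArr F \<Delta>) (\<Psi>0 \<cdot> FArr F \<epsilon>)"
proof -
  interpret A: cocommutative_comonoid_in T A \<Delta> \<epsilon> by fact
  have [simp]: "A \<in> Obj T" "\<Delta> \<in> Arr T" "Cod T \<Delta> = A \<otimes>' A" "Dom T \<Delta> = A"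
    "\<epsilon> \<in> Arr T" "Cod T \<epsilon> = \<I>\<^bsub>T\<^esub>" "Dom T \<epsilon> = A"
    using A.cocarrier_in_Obj A.comult_in_Hom A.counit_in_Hom by (simp_all add: Hom_iff)
  let ?\<Delta> = "\<Psi> A A \<cdot> FArr F \<Delta>" and ?\<epsilon> = "\<Psi>0 \<cdot> FArr F \<epsilon>"
  have \<Delta>: "\<Phi> A A \<cdot> ?\<Delta> = FArr F \<Delta>" and \<epsilon>: "\<Phi>0 \<cdot> ?\<epsilon> = FArr F \<epsilon>"
    by simp_all
  show ?thesis
  proof unfold_locales
    show "\<alpha> (FObj F A) (FObj F A) (FObj F A) \<cdot> (?\<Delta> \<boxtimes> \<one> (FObj F A)) \<cdot> ?\<Delta> = (\<one> (FObj F A) \<boxtimes> ?\<Delta>) \<cdot> ?\<Delta>"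
    \<comment> \<open>Composing with the invertible threefold comparison avoids naturality of the
      inverses \<open>\<Psi>\<close>: every \<open>?\<Delta>\<close> meets a
      \<open>\<Phi> A A\<close> and becomes \<open>FArr F \<Delta>\<close>.\<close>
    proof (rule C.iso_cancel_left)
      have "(\<Phi> A (A \<otimes>' A) \<cdot> (\<one> (FObj F A) \<boxtimes> \<Phi> A A)) \<cdot> \<alpha> (FObj F A) (FObj F A) (FObj F A) \<cdot> (?\<Delta> \<boxtimes> \<one> (FObj F A)) \<cdot> ?\<Delta>
        = (\<Phi> A (A \<otimes>' A) \<cdot> (\<one> (FObj F A) \<boxtimes> \<Phi> A A) \<cdot> \<alpha> (FObj F A) (FObj F A) (FObj F A)) \<cdot> (?\<Delta> \<boxtimes> \<one> (FObj F A)) \<cdot> ?\<Delta>"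
        by simp
      also have "\<dots> = FArr F (\<alpha>\<^bsub>T\<^esub> A A A) \<cdot> (\<Phi> (A \<otimes>' A) A \<cdot> (FArr F \<Delta> \<boxtimes> \<one> (FObj F A))) \<cdot> ?\<Delta>"
        by (simp flip: Phi_Assoc add: C.TArr_Comp_chain)
      also have "\<Phi> (A \<otimes>' A) A \<cdot> (FArr F \<Delta> \<boxtimes> \<one> (FObj F A)) = FArr F (\<Delta> \<boxtimes>' \<one>' A) \<cdot> \<Phi> A A"
        by (simp add: Phi_natural_Arr)
      also have "FArr F (\<alpha>\<^bsub>T\<^esub> A A A) \<cdot> (FArr F (\<Delta> \<boxtimes>' \<one>' A) \<cdot> \<Phi> A A) \<cdot> ?\<Delta> = FArr F (\<alpha>\<^bsub>T\<^esub> A A A \<cdot>' (\<Delta> \<boxtimes>' \<one>' A) \<cdot>' \<Delta>)"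
        by (simp add: FArr_Comp_Arr)
      also have "\<dots> = FArr F (\<one>' A \<boxtimes>' \<Delta>) \<cdot> \<Phi> A A \<cdot> ?\<Delta>"
        by (simp add: A.comult_coassoc FArr_Comp_Arr)
      also have "\<dots> = (\<Phi> A (A \<otimes>' A) \<cdot> (\<one> (FObj F A) \<boxtimes> FArr F \<Delta>)) \<cdot> ?\<Delta>"
        by (subst C.Comp_chain[OF Phi_natural_Arr]) simp_all
      also have "\<dots> = (\<Phi> A (A \<otimes>' A) \<cdot> (\<one> (FObj F A) \<boxtimes> \<Phi> A A)) \<cdot> (\<one> (FObj F A) \<boxtimes> ?\<Delta>) \<cdot> ?\<Delta>"
        by (simp add: C.TArr_Comp_chain)
      finally show "(\<Phi> A (A \<otimes>' A) \<cdot> (\<one> (FObj F A) \<boxtimes> \<Phi> A A)) \<cdot> \<alpha> (FObj F A) (FObj F A) (FObj F A) \<cdot> (?\<Delta> \<boxtimes> \<one> (FObj F A)) \<cdot> ?\<Delta>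
        = (\<Phi> A (A \<otimes>' A) \<cdot> (\<one> (FObj F A) \<boxtimes> \<Phi> A A)) \<cdot> (\<one> (FObj F A) \<boxtimes> ?\<Delta>) \<cdot> ?\<Delta>" .
    qed simp_all
    show "\<l> (FObj F A) \<cdot> (?\<epsilon> \<boxtimes> \<one> (FObj F A)) \<cdot> ?\<Delta> = \<one> (FObj F A)"
    proof -
      have "\<l> (FObj F A) \<cdot> (?\<epsilon> \<boxtimes> \<one> (FObj F A)) \<cdot> ?\<Delta>
        = FArr F (\<l>\<^bsub>T\<^esub> A) \<cdot> (\<Phi> \<I>\<^bsub>T\<^esub> A \<cdot> (FArr F \<epsilon> \<boxtimes> \<one> (FObj F A))) \<cdot> ?\<Delta>"
        by (simp flip: Phi_LUnit add: C.TArr_Comp_chain)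
      also have "\<Phi> \<I>\<^bsub>T\<^esub> A \<cdot> (FArr F \<epsilon> \<boxtimes> \<one> (FObj F A)) = FArr F (\<epsilon> \<boxtimes>' \<one>' A) \<cdot> \<Phi> A A"
        by (simp add: Phi_natural_Arr)
      also have "FArr F (\<l>\<^bsub>T\<^esub> A) \<cdot> (FArr F (\<epsilon> \<boxtimes>' \<one>' A) \<cdot> \<Phi> A A) \<cdot> ?\<Delta> = FArr F (\<l>\<^bsub>T\<^esub> A \<cdot>' (\<epsilon> \<boxtimes>' \<one>' A) \<cdot>' \<Delta>)"
        by (simp add: FArr_Comp_Arr)
      finally show ?thesis by (simp add: A.comult_counit_left)
    qed
    show "\<r> (FObj F A) \<cdot> (\<one> (FObj F A) \<boxtimes> ?\<epsilon>) \<cdot> ?\<Delta> = \<one> (FObj F A)"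
    proof -
      have "\<r> (FObj F A) \<cdot> (\<one> (FObj F A) \<boxtimes> ?\<epsilon>) \<cdot> ?\<Delta>
        = FArr F (\<r>\<^bsub>T\<^esub> A) \<cdot> (\<Phi> A \<I>\<^bsub>T\<^esub> \<cdot> (\<one> (FObj F A) \<boxtimes> FArr F \<epsilon>)) \<cdot> ?\<Delta>"
        by (simp flip: Phi_RUnit add: C.TArr_Comp_chain)
      also have "\<Phi> A \<I>\<^bsub>T\<^esub> \<cdot> (\<one> (FObj F A) \<boxtimes> FArr F \<epsilon>) = FArr F (\<one>' A \<boxtimes>' \<epsilon>) \<cdot> \<Phi> A A"
        by (simp add: Phi_natural_Arr)
      also have "FArr F (\<r>\<^bsub>T\<^esub> A) \<cdot> (FArr F (\<one>' A \<boxtimes>' \<epsilon>) \<cdot> \<Phi> A A) \<cdot> ?\<Delta> = FArr F (\<r>\<^bsub>T\<^esub> A \<cdot>' (\<one>' A \<boxtimes>' \<epsilon>) \<cdot>' \<Delta>)"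
        by (simp add: FArr_Comp_Arr)
      finally show ?thesis by (simp add: A.comult_counit_right)
    qed
    show "\<tau> (FObj F A) (FObj F A) \<cdot> ?\<Delta> = ?\<Delta>"
    proof (rule C.iso_cancel_left[of "\<Phi> A A"])
      have "(\<Phi> A A \<cdot> \<tau> (FObj F A) (FObj F A)) \<cdot> ?\<Delta> = FArr F (\<tau>\<^bsub>T\<^esub> A A \<cdot>' \<Delta>)"
        by (simp flip: Phi_Symm add: FArr_Comp_Arr)
      then show "\<Phi> A A \<cdot> \<tau> (FObj F A) (FObj F A) \<cdot> ?\<Delta> = \<Phi> A A \<cdot> ?\<Delta>"
        by (simp add: A.comult_cocomm)
    qed simp_all
  qed (simp_all add: Hom_iff)
qed

end

context strong_functor
begin

text \<open>\<open>middle_swap\<close> has five factors, passing between three bracketings of a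
  fourfold product. \<open>?L\<close>, \<open>?R2\<close> and \<open>?R1\<close> are the comparison
  maps for these bracketings; each factor gives a commuting square between two of them, and the five
  squares are pasted.\<close>

lemma Phi_middle_swap:
  assumes [simp]: "A \<in> Obj T"
  shows "FArr F (middle_swap T A) \<cdot> \<Phi> (A \<otimes>' A) (A \<otimes>' A) \<cdot> (\<Phi> A A \<boxtimes> \<Phi> A A)
    = (\<Phi> (A \<otimes>' A) (A \<otimes>' A) \<cdot> (\<Phi> A A \<boxtimes> \<Phi> A A)) \<cdot> middle_swap C (FObj F A)"
proof -
  let ?A = "FObj F A" and ?AA = "A \<otimes>' A"
  let ?\<alpha>T = "\<alpha>\<^bsub>T\<^esub> A A A" and ?\<alpha> = "\<alpha> ?A ?A ?A"
    and ?\<beta>T = "\<alpha>\<^bsub>T\<^esub> A A ?AA" and ?\<beta> = "\<alpha> ?A ?A (?A \<otimes> ?A)"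
  let ?K1 = "\<Phi> ?AA A \<cdot> (\<Phi> A A \<boxtimes> \<one> ?A)" and ?K2 = "\<Phi> A ?AA \<cdot> (\<one> ?A \<boxtimes> \<Phi> A A)"
  let ?L = "\<Phi> ?AA ?AA \<cdot> (\<Phi> A A \<boxtimes> \<Phi> A A)"
  let ?R2 = "\<Phi> A (A \<otimes>' ?AA) \<cdot> (\<one> ?A \<boxtimes> ?K2)" and ?R1 = "\<Phi> A (?AA \<otimes>' A) \<cdot> (\<one> ?A \<boxtimes> ?K1)"
  have \<alpha>: "FArr F ?\<alpha>T \<cdot> ?K1 = ?K2 \<cdot> ?\<alpha>"
    by (simp add: Phi_Assoc)
  \<comment> \<open>A commuting square with invertible \<open>f\<close> and \<open>g\<close> can be
    read backwards; this supplies the squares for the inverse associators.\<close>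
  have conj_inv: "FArr F (inv_arrow T f) \<cdot> q = p \<cdot> inv_arrow C g"
    if "FArr F f \<cdot> p = q \<cdot> g" "iso_arrow T f" "iso_arrow C g" "p \<in> Arr C" "q \<in> Arr C"
      "Cod C p = FObj F (Dom T f)" "Cod C q = FObj F (Cod T f)" "Dom C p = Dom C g" "Dom C q = Cod C g"
    for f g p q
  proof -
    have "FArr F (inv_arrow T f) \<cdot> q = inv_arrow C (FArr F f) \<cdot> (q \<cdot> g) \<cdot> inv_arrow C g"
      using that(2-) by (simp add: FArr_inv)
    also have "\<dots> = p \<cdot> inv_arrow C g"
      using that(2-) by (simp flip: that(1))
    finally show ?thesis .
  qed
  have \<alpha>_inv: "FArr F (inv_arrow T ?\<alpha>T) \<cdot> ?K2 = ?K1 \<cdot> inv_arrow C ?\<alpha>"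
    by (rule conj_inv[OF \<alpha>]) simp_all
  have \<tau>: "FArr F (\<tau>\<^bsub>T\<^esub> A A \<boxtimes>' \<one>' A) \<cdot> ?K1 = ?K1 \<cdot> (\<tau> ?A ?A \<boxtimes> \<one> ?A)"
    by (simp add: C.Comp_chain[OF Phi_natural_Arr] C.TArr_Comp_Arr Phi_Symm)
  have \<beta>: "FArr F ?\<beta>T \<cdot> ?L = ?R2 \<cdot> ?\<beta>"
  proof -
    have "FArr F ?\<beta>T \<cdot> ?L = (FArr F ?\<beta>T \<cdot> \<Phi> ?AA ?AA \<cdot> (\<Phi> A A \<boxtimes> \<one> (FObj F ?AA))) \<cdot> ((\<one> ?A \<boxtimes> \<one> ?A) \<boxtimes> \<Phi> A A)"
      by (simp add: C.TArr_Comp_Arr)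
    also have "\<dots> = \<Phi> A (A \<otimes>' ?AA) \<cdot> (\<one> ?A \<boxtimes> \<Phi> A ?AA) \<cdot> (\<alpha> ?A ?A (FObj F ?AA) \<cdot> ((\<one> ?A \<boxtimes> \<one> ?A) \<boxtimes> \<Phi> A A))"
      by (simp add: Phi_Assoc del: C.TArr_Ident_simp)
    also have "\<dots> = ?R2 \<cdot> ?\<beta>"
      by (subst C.Assoc_natural_Arr) (simp_all add: C.TArr_Comp_chain)
    finally show ?thesis .
  qed
  have \<beta>_inv: "FArr F (inv_arrow T ?\<beta>T) \<cdot> ?R2 = ?L \<cdot> inv_arrow C ?\<beta>"
    by (rule conj_inv[OF \<beta>]) simp_all
  \<comment> \<open>Tensoring a square with \<open>A\<close> on the left, using naturality of
    \<open>\<Phi>\<close>; three of the five factors act inside such a product.\<close>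
  have whisker: "FArr F (\<one>' A \<boxtimes>' f) \<cdot> \<Phi> A b \<cdot> (\<one> ?A \<boxtimes> p) = (\<Phi> A b' \<cdot> (\<one> ?A \<boxtimes> q)) \<cdot> (\<one> ?A \<boxtimes> g)"
    if "FArr F f \<cdot> p = q \<cdot> g" "f \<in> Arr T" "p \<in> Arr C" "q \<in> Arr C" "g \<in> Arr C" "Dom T f = b" "Cod T f = b'"
      "Cod C p = FObj F b" "Cod C q = FObj F b'" "Dom C q = Cod C g" for f g p q b b'
    using that by (auto simp: C.Comp_chain[OF Phi_natural_Arr] C.TArr_Comp_Arr)
  have 1: "FArr F (\<one>' A \<boxtimes>' inv_arrow T ?\<alpha>T) \<cdot> ?R2 = ?R1 \<cdot> (\<one> ?A \<boxtimes> inv_arrow C ?\<alpha>)"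
    by (rule whisker[OF \<alpha>_inv]) simp_all
  have 2: "FArr F (\<one>' A \<boxtimes>' (\<tau>\<^bsub>T\<^esub> A A \<boxtimes>' \<one>' A)) \<cdot> ?R1 = ?R1 \<cdot> (\<one> ?A \<boxtimes> (\<tau> ?A ?A \<boxtimes> \<one> ?A))"
    by (rule whisker[OF \<tau>]) simp_all
  have 3: "FArr F (\<one>' A \<boxtimes>' ?\<alpha>T) \<cdot> ?R1 = ?R2 \<cdot> (\<one> ?A \<boxtimes> ?\<alpha>)"
    by (rule whisker[OF \<alpha>]) simp_all
  have paste: "(x \<cdot> y) \<cdot> p = r \<cdot> (v \<cdot> u)"
    if "y \<cdot> p = q \<cdot> u" "x \<cdot> q = r \<cdot> v"
      "x \<in> Arr C" "y \<in> Arr C" "p \<in> Arr C" "q \<in> Arr C" "r \<in> Arr C" "u \<in> Arr C" "v \<in> Arr C"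
      "Dom C x = Cod C y" "Dom C y = Cod C p" "Dom C q = Cod C u" "Dom C r = Cod C v" "Dom C v = Cod C u"
      "Dom C x = Cod C q" for x y p q r u v
  proof -
    have "(x \<cdot> y) \<cdot> p = (x \<cdot> q) \<cdot> u" using that(1,3-) by simp
    then show ?thesis using that(2-) by simp
  qed
  have "FArr F (middle_swap T A) = FArr F (inv_arrow T ?\<beta>T) \<cdot> FArr F (\<one>' A \<boxtimes>' ?\<alpha>T)
      \<cdot> FArr F (\<one>' A \<boxtimes>' (\<tau>\<^bsub>T\<^esub> A A \<boxtimes>' \<one>' A)) \<cdot> FArr F (\<one>' A \<boxtimes>' inv_arrow T ?\<alpha>T) \<cdot> FArr F ?\<beta>T"
    by (simp add: middle_swap_def FArr_Comp_Arr)
  moreover have "(FArr F (inv_arrow T ?\<beta>T) \<cdot> FArr F (\<one>' A \<boxtimes>' ?\<alpha>T)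
      \<cdot> FArr F (\<one>' A \<boxtimes>' (\<tau>\<^bsub>T\<^esub> A A \<boxtimes>' \<one>' A)) \<cdot> FArr F (\<one>' A \<boxtimes>' inv_arrow T ?\<alpha>T) \<cdot> FArr F ?\<beta>T) \<cdot> ?L
    = ?L \<cdot> middle_swap C ?A"
    unfolding middle_swap_def
    by (rule paste[OF paste[OF paste[OF paste[OF \<beta> 1] 2] 3] \<beta>_inv]) simp_all
  ultimately show ?thesis by simp
qed

theorem image_special_bicommutative_bimonoid:
  assumes "special_bicommutative_bimonoid T B"
  shows "special_bicommutative_bimonoid C (image_bimonoid C F B)"
proof -
  interpret B: special_bicommutative_bimonoid T B by fact
  let ?c = "Carrier B"
  have [simp]: "?c \<in> Obj T" "Mult B \<in> Arr T" "Dom T (Mult B) = ?c \<otimes>' ?c" "Cod T (Mult B) = ?c"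
    "Eta B \<in> Arr T" "Dom T (Eta B) = \<I>\<^bsub>T\<^esub>" "Cod T (Eta B) = ?c"
    "Comult B \<in> Arr T" "Cod T (Comult B) = ?c \<otimes>' ?c" "Dom T (Comult B) = ?c"
    "Counit B \<in> Arr T" "Cod T (Counit B) = \<I>\<^bsub>T\<^esub>" "Dom T (Counit B) = ?c"
    using B.carrier_in_Obj B.mult_in_Hom B.unit_in_Hom B.comult_in_Hom B.counit_in_Hom by (simp_all add: Hom_iff)
  have swap: "middle_swap T a \<in> Arr T" "Dom T (middle_swap T a) = (a \<otimes>' a) \<otimes>' (a \<otimes>' a)"
    "Cod T (middle_swap T a) = (a \<otimes>' a) \<otimes>' (a \<otimes>' a)" if "a \<in> Obj T" for a
    using that by (simp_all add: middle_swap_def)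
  have swapC: "middle_swap C a \<in> Arr C" "Dom C (middle_swap C a) = (a \<otimes> a) \<otimes> (a \<otimes> a)"
    "Cod C (middle_swap C a) = (a \<otimes> a) \<otimes> (a \<otimes> a)" if "a \<in> Obj C" for a
    using that by (simp_all add: middle_swap_def)
  let ?\<mu> = "FArr F (Mult B) \<cdot> \<Phi> ?c ?c" and ?\<Delta> = "\<Psi> ?c ?c \<cdot> FArr F (Comult B)"
  let ?L = "\<Phi> (?c \<otimes>' ?c) (?c \<otimes>' ?c) \<cdot> (\<Phi> ?c ?c \<boxtimes> \<Phi> ?c ?c)"
  \<comment> \<open>Two axioms contain \<open>\<l> \<I>\<close>, so the comparison at
    \<open>\<I> \<otimes> \<I>\<close> is needed with \<open>\<Phi>0\<close> on both factors. The
    coherence law has it on one factor only; the other is supplied by naturality of the left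
    unitor.\<close>
  have unit: "FArr F (\<l>\<^bsub>T\<^esub> \<I>\<^bsub>T\<^esub>) \<cdot> \<Phi> \<I>\<^bsub>T\<^esub> \<I>\<^bsub>T\<^esub> \<cdot> (\<Phi>0 \<boxtimes> \<Phi>0) = \<Phi>0 \<cdot> \<l> \<I>"
  proof -
    have "FArr F (\<l>\<^bsub>T\<^esub> \<I>\<^bsub>T\<^esub>) \<cdot> \<Phi> \<I>\<^bsub>T\<^esub> \<I>\<^bsub>T\<^esub> \<cdot> (\<Phi>0 \<boxtimes> \<Phi>0)
      = (FArr F (\<l>\<^bsub>T\<^esub> \<I>\<^bsub>T\<^esub>) \<cdot> \<Phi> \<I>\<^bsub>T\<^esub> \<I>\<^bsub>T\<^esub> \<cdot> (\<Phi>0 \<boxtimes> \<one> (FObj F \<I>\<^bsub>T\<^esub>))) \<cdot> (\<one> \<I> \<boxtimes> \<Phi>0)"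
      by (simp add: C.TArr_Comp_Arr)
    also have "\<dots> = \<Phi>0 \<cdot> \<l> \<I>"
      unfolding Phi_LUnit[OF T.Unit_in_Obj] by (simp add: C.LUnit_natural_Arr)
    finally show ?thesis .
  qed
  interpret M: commutative_monoid_in C "FObj F ?c" ?\<mu> "FArr F (Eta B) \<cdot> \<Phi>0"
    by (rule image_commutative_monoid) unfold_locales
  interpret D: cocommutative_comonoid_in C "FObj F ?c" ?\<Delta> "\<Psi>0 \<cdot> FArr F (Counit B)"
    by (rule image_cocommutative_comonoid) unfold_locales
  have "?\<Delta> \<cdot> ?\<mu> = (?\<mu> \<boxtimes> ?\<mu>) \<cdot> middle_swap C (FObj F ?c) \<cdot> (?\<Delta> \<boxtimes> ?\<Delta>)"
  proof -
    have "?\<Delta> \<cdot> ?\<mu> = \<Psi> ?c ?c \<cdot> FArr F (Comult B \<cdot>' Mult B) \<cdot> \<Phi> ?c ?c"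
      by (simp add: FArr_Comp_Arr)
    also have "\<dots> = \<Psi> ?c ?c \<cdot> FArr F (Mult B \<boxtimes>' Mult B) \<cdot> FArr F (middle_swap T ?c)
        \<cdot> FArr F (Comult B \<boxtimes>' Comult B) \<cdot> \<Phi> ?c ?c"
      unfolding B.comult_mult by (simp add: FArr_Comp_Arr swap)
    also have "FArr F (Comult B \<boxtimes>' Comult B) \<cdot> \<Phi> ?c ?c = ?L \<cdot> (?\<Delta> \<boxtimes> ?\<Delta>)"
      by (simp add: Phi_natural_Arr C.TArr_Comp_Arr)
    also have "\<Psi> ?c ?c \<cdot> FArr F (Mult B \<boxtimes>' Mult B) \<cdot> FArr F (middle_swap T ?c) \<cdot> ?L \<cdot> (?\<Delta> \<boxtimes> ?\<Delta>)
      = \<Psi> ?c ?c \<cdot> FArr F (Mult B \<boxtimes>' Mult B) \<cdot> (FArr F (middle_swap T ?c) \<cdot> ?L) \<cdot> (?\<Delta> \<boxtimes> ?\<Delta>)"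
      by (simp add: swap)
    also have "\<dots> = \<Psi> ?c ?c \<cdot> (FArr F (Mult B \<boxtimes>' Mult B) \<cdot> ?L) \<cdot> middle_swap C (FObj F ?c) \<cdot> (?\<Delta> \<boxtimes> ?\<Delta>)"
      by (subst Phi_middle_swap) (simp_all add: swapC)
    also have "FArr F (Mult B \<boxtimes>' Mult B) \<cdot> ?L = \<Phi> ?c ?c \<cdot> (?\<mu> \<boxtimes> ?\<mu>)"
      by (simp add: C.Comp_chain[OF Phi_natural_Arr] C.TArr_Comp_Arr)
    finally show ?thesis
      by (simp add: swapC)
  qed
  moreover have "?\<Delta> \<cdot> FArr F (Eta B) \<cdot> \<Phi>0
    = ((FArr F (Eta B) \<cdot> \<Phi>0) \<boxtimes> (FArr F (Eta B) \<cdot> \<Phi>0)) \<cdot> inv_arrow C (\<l> \<I>)"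
  proof (rule C.iso_cancel_left[of "\<Phi> ?c ?c"])
    have "FArr F (inv_arrow T (\<l>\<^bsub>T\<^esub> \<I>\<^bsub>T\<^esub>)) \<cdot> \<Phi>0 = \<Phi> \<I>\<^bsub>T\<^esub> \<I>\<^bsub>T\<^esub> \<cdot> (\<Phi>0 \<boxtimes> \<Phi>0) \<cdot> inv_arrow C (\<l> \<I>)"
    proof -
      have "FArr F (inv_arrow T (\<l>\<^bsub>T\<^esub> \<I>\<^bsub>T\<^esub>)) \<cdot> \<Phi>0
        = inv_arrow C (FArr F (\<l>\<^bsub>T\<^esub> \<I>\<^bsub>T\<^esub>)) \<cdot> (\<Phi>0 \<cdot> \<l> \<I>) \<cdot> inv_arrow C (\<l> \<I>)"
        by (simp add: FArr_inv)
      then show ?thesis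
        by (simp flip: unit)
    qed
    moreover have "\<Phi> ?c ?c \<cdot> ?\<Delta> \<cdot> FArr F (Eta B) \<cdot> \<Phi>0 = FArr F (Comult B \<cdot>' Eta B) \<cdot> \<Phi>0"
      by (simp add: FArr_Comp_Arr)
    ultimately show "\<Phi> ?c ?c \<cdot> ?\<Delta> \<cdot> FArr F (Eta B) \<cdot> \<Phi>0
      = \<Phi> ?c ?c \<cdot> ((FArr F (Eta B) \<cdot> \<Phi>0) \<boxtimes> (FArr F (Eta B) \<cdot> \<Phi>0)) \<cdot> inv_arrow C (\<l> \<I>)"
      by (simp add: B.comult_unit FArr_Comp_Arr C.Comp_chain[OF Phi_natural_Arr] C.TArr_Comp_chain)
  qed simp_all
  moreover have "(\<Psi>0 \<cdot> FArr F (Counit B)) \<cdot> ?\<mu>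
    = \<l> \<I> \<cdot> ((\<Psi>0 \<cdot> FArr F (Counit B)) \<boxtimes> (\<Psi>0 \<cdot> FArr F (Counit B)))"
  proof (rule C.iso_cancel_left[of \<Phi>0])
    have "\<Phi>0 \<cdot> (\<Psi>0 \<cdot> FArr F (Counit B)) \<cdot> ?\<mu> = FArr F (Counit B \<cdot>' Mult B) \<cdot> \<Phi> ?c ?c"
      by (simp add: FArr_Comp_Arr)
    also have "\<dots> = FArr F (\<l>\<^bsub>T\<^esub> \<I>\<^bsub>T\<^esub>) \<cdot> \<Phi> \<I>\<^bsub>T\<^esub> \<I>\<^bsub>T\<^esub> \<cdot> (FArr F (Counit B) \<boxtimes> FArr F (Counit B))"
      by (simp add: B.counit_mult FArr_Comp_Arr Phi_natural_Arr)
    also have "\<dots> = (FArr F (\<l>\<^bsub>T\<^esub> \<I>\<^bsub>T\<^esub>) \<cdot> \<Phi> \<I>\<^bsub>T\<^esub> \<I>\<^bsub>T\<^esub> \<cdot> (\<Phi>0 \<boxtimes> \<Phi>0))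
        \<cdot> ((\<Psi>0 \<cdot> FArr F (Counit B)) \<boxtimes> (\<Psi>0 \<cdot> FArr F (Counit B)))"
      by (simp add: C.TArr_Comp_Arr)
    finally show "\<Phi>0 \<cdot> (\<Psi>0 \<cdot> FArr F (Counit B)) \<cdot> ?\<mu>
      = \<Phi>0 \<cdot> \<l> \<I> \<cdot> ((\<Psi>0 \<cdot> FArr F (Counit B)) \<boxtimes> (\<Psi>0 \<cdot> FArr F (Counit B)))"
      unfolding unit by simp
  qed simp_all
  moreover have "(\<Psi>0 \<cdot> FArr F (Counit B)) \<cdot> FArr F (Eta B) \<cdot> \<Phi>0 = \<one> \<I>"
  proof -
    have "(\<Psi>0 \<cdot> FArr F (Counit B)) \<cdot> FArr F (Eta B) \<cdot> \<Phi>0 = \<Psi>0 \<cdot> FArr F (Counit B \<cdot>' Eta B) \<cdot> \<Phi>0"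
      by (simp add: FArr_Comp_Arr)
    then show ?thesis by (simp add: B.counit_unit)
  qed
  moreover have "?\<mu> \<cdot> ?\<Delta> = \<one> (FObj F ?c)"
  proof -
    have "?\<mu> \<cdot> ?\<Delta> = FArr F (Mult B \<cdot>' Comult B)"
      by (simp add: FArr_Comp_Arr)
    then show ?thesis by (simp add: B.special)
  qed
  ultimately show ?thesis
    unfolding special_bicommutative_bimonoid_def special_bicommutative_bimonoid_axioms_def
      bicommutative_bimonoid_def bicommutative_bimonoid_axioms_def image_bimonoid_def bimonoid.simps
    using M.commutative_monoid_in_axioms D.cocommutative_comonoid_in_axioms by blast
qed

end

section \<open>Categories of algebras and of bimonoids\<close>

lemma strong_functor_iff [simp]: "strong_functor T C F \<longleftrightarrow> symmetric_monoidal_functor T C F"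
  by (simp add: strong_functor_def)

lemma monoidal_natural_transformation_Ident:
  assumes "symmetric_monoidal_functor T C F"
  shows "monoidal_natural_transformation T C F F (\<lambda>a. \<one>\<^bsub>C\<^esub> (FObj F a))"
proof -
  interpret F: strong_functor T C F using assms by simp
  show ?thesis
    by unfold_locales (auto simp: Hom_iff)
qed

lemma monoidal_natural_transformation_Comp:
  fixes C (structure)
  assumes "monoidal_natural_transformation T C F G \<eta>" "monoidal_natural_transformation T C G H \<theta>"
  shows "monoidal_natural_transformation T C F H (\<lambda>a. \<theta> a \<cdot> \<eta> a)"
proof -
  interpret C: symmetric_monoidal_category C
    using assms(1) by (simp add: monoidal_natural_transformation_def symmetric_monoidal_functor_def)
  interpret \<eta>: monoidal_natural_transformation T C F G \<eta> by fact
  interpret \<theta>: monoidal_natural_transformation T C G H \<theta> by fact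
  interpret F: strong_functor T C F by simp unfold_locales
  interpret G: strong_functor T C G by simp unfold_locales
  interpret H: strong_functor T C H by simp unfold_locales
  have [simp]: "\<eta> a \<in> Arr C" "Dom C (\<eta> a) = FObj F a" "Cod C (\<eta> a) = FObj G a"
    "\<theta> a \<in> Arr C" "Dom C (\<theta> a) = FObj G a" "Cod C (\<theta> a) = FObj H a" if "a \<in> Obj T" for a
    using \<eta>.component_in_Hom[OF that] \<theta>.component_in_Hom[OF that] by (auto simp: Hom_iff)
  show ?thesis
  proof unfold_locales
    fix f a b assume f: "f \<in> Hom T a b"
    then have [simp]: "a \<in> Obj T" "b \<in> Obj T" "f \<in> Arr T" "Dom T f = a" "Cod T f = b" by (auto simp: Hom_iff)
    show "(\<theta> b \<cdot> \<eta> b) \<cdot> FArr F f = FArr H f \<cdot> \<theta> a \<cdot> \<eta> a"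
      using C.Comp_chain[OF \<theta>.naturality[OF f], of "\<eta> a"] by (simp add: \<eta>.naturality[OF f])
  next
    fix a b assume [simp]: "a \<in> Obj T" "b \<in> Obj T"
    show "(\<theta> (a \<otimes>\<^bsub>T\<^esub> b) \<cdot> \<eta> (a \<otimes>\<^bsub>T\<^esub> b)) \<cdot> Phi F a b = Phi H a b \<cdot> ((\<theta> a \<cdot> \<eta> a) \<boxtimes> (\<theta> b \<cdot> \<eta> b))"
      using C.Comp_chain[OF \<theta>.component_Phi[of a b], of "\<eta> a \<boxtimes> \<eta> b"]
      by (simp add: \<eta>.component_Phi C.TArr_Comp_Arr)
  qed (auto simp: Hom_iff \<eta>.component_Phi0 \<theta>.component_Phi0)
qed

lemma algebras_category:
  assumes "prop_category T" "symmetric_monoidal_category C"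
  shows "category (algebras T C)"
proof -
  interpret T: prop_category T by fact
  interpret C: symmetric_monoidal_category C by fact
  have comp: "\<eta> n \<in> Arr C \<and> Dom C (\<eta> n) = FObj F n \<and> Cod C (\<eta> n) = FObj G n"
    if "monoidal_natural_transformation T C F G \<eta>" for F G \<eta> n
  proof -
    interpret monoidal_natural_transformation T C F G \<eta> by fact
    show ?thesis using component_in_Hom[of n] by (simp add: Hom_iff)
  qed
  have dom: "symmetric_monoidal_functor T C F" "symmetric_monoidal_functor T C G"
    if "monoidal_natural_transformation T C F G \<eta>" for F G \<eta>
    using that by (simp_all add: monoidal_natural_transformation_def)
  show ?thesis
  proof unfold_locales
    fix x y z a b c d
    assume "x \<in> Hom (algebras T C) a b" "y \<in> Hom (algebras T C) b c" "z \<in> Hom (algebras T C) c d"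
    then show "Comp (algebras T C) (Comp (algebras T C) z y) x = Comp (algebras T C) z (Comp (algebras T C) y x)"
      by (cases x; cases y; cases z) (auto simp: algebras_def Hom_iff fun_eq_iff comp)
  next
    fix x a b
    assume "x \<in> Hom (algebras T C) a b"
    then show "Comp (algebras T C) (Ident (algebras T C) b) x = x"
      by (cases x) (auto simp: algebras_def Hom_iff fun_eq_iff comp)
  next
    fix x a b
    assume "x \<in> Hom (algebras T C) a b"
    then show "Comp (algebras T C) x (Ident (algebras T C) a) = x"
      by (cases x) (auto simp: algebras_def Hom_iff fun_eq_iff comp)
  qed (auto simp: algebras_def Hom_iff monoidal_natural_transformation_Ident
        dest: dom intro: monoidal_natural_transformation_Comp)
qed

lemma special_bicommutative_bimonoids_category:
  assumes "symmetric_monoidal_category C"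
  shows "category (special_bicommutative_bimonoids C)"
proof -
  interpret C: symmetric_monoidal_category C by fact
  have B: "Carrier A \<in> Obj C" "Mult A \<in> Arr C" "Dom C (Mult A) = Carrier A \<otimes>\<^bsub>C\<^esub> Carrier A" "Cod C (Mult A) = Carrier A"
    "Eta A \<in> Arr C" "Dom C (Eta A) = \<I>\<^bsub>C\<^esub>" "Cod C (Eta A) = Carrier A"
    "Comult A \<in> Arr C" "Cod C (Comult A) = Carrier A \<otimes>\<^bsub>C\<^esub> Carrier A" "Dom C (Comult A) = Carrier A"
    "Counit A \<in> Arr C" "Cod C (Counit A) = \<I>\<^bsub>C\<^esub>" "Dom C (Counit A) = Carrier A"
    if "special_bicommutative_bimonoid C A" for A
  proof -
    interpret special_bicommutative_bimonoid C A by fact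
    show "Carrier A \<in> Obj C" "Mult A \<in> Arr C" "Dom C (Mult A) = Carrier A \<otimes>\<^bsub>C\<^esub> Carrier A" "Cod C (Mult A) = Carrier A"
    "Eta A \<in> Arr C" "Dom C (Eta A) = \<I>\<^bsub>C\<^esub>" "Cod C (Eta A) = Carrier A"
    "Comult A \<in> Arr C" "Cod C (Comult A) = Carrier A \<otimes>\<^bsub>C\<^esub> Carrier A" "Dom C (Comult A) = Carrier A"
    "Counit A \<in> Arr C" "Cod C (Counit A) = \<I>\<^bsub>C\<^esub>" "Dom C (Counit A) = Carrier A"
      using carrier_in_Obj mult_in_Hom unit_in_Hom comult_in_Hom counit_in_Hom by (simp_all add: Hom_iff)
  qed
  have id: "bimonoid_hom C A A (\<one>\<^bsub>C\<^esub> (Carrier A))" if "special_bicommutative_bimonoid C A" for A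
    using B[OF that] by (simp add: bimonoid_hom_def Hom_iff)
  have comp: "bimonoid_hom C A E (g \<cdot>\<^bsub>C\<^esub> f)"
    if f: "bimonoid_hom C A D f" and g: "bimonoid_hom C D E g" and A: "special_bicommutative_bimonoid C A"
      and D: "special_bicommutative_bimonoid C D" and E: "special_bicommutative_bimonoid C E" for A D E f g
  proof -
    note [simp] = B[OF A] B[OF D] B[OF E]
    have [simp]: "f \<in> Arr C" "Dom C f = Carrier A" "Cod C f = Carrier D"
      "g \<in> Arr C" "Dom C g = Carrier D" "Cod C g = Carrier E"
      using f g by (simp_all add: bimonoid_hom_def Hom_iff)
    have f': "Mult D \<cdot>\<^bsub>C\<^esub> (f \<boxtimes>\<^bsub>C\<^esub> f) = f \<cdot>\<^bsub>C\<^esub> Mult A" "f \<cdot>\<^bsub>C\<^esub> Eta A = Eta D"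
      "Comult D \<cdot>\<^bsub>C\<^esub> f = (f \<boxtimes>\<^bsub>C\<^esub> f) \<cdot>\<^bsub>C\<^esub> Comult A" "Counit D \<cdot>\<^bsub>C\<^esub> f = Counit A"
      and g': "Mult E \<cdot>\<^bsub>C\<^esub> (g \<boxtimes>\<^bsub>C\<^esub> g) = g \<cdot>\<^bsub>C\<^esub> Mult D" "g \<cdot>\<^bsub>C\<^esub> Eta D = Eta E"
      "Comult E \<cdot>\<^bsub>C\<^esub> g = (g \<boxtimes>\<^bsub>C\<^esub> g) \<cdot>\<^bsub>C\<^esub> Comult D" "Counit E \<cdot>\<^bsub>C\<^esub> g = Counit D"
      using f g by (simp_all add: bimonoid_hom_def)
    have "Mult E \<cdot>\<^bsub>C\<^esub> ((g \<cdot>\<^bsub>C\<^esub> f) \<boxtimes>\<^bsub>C\<^esub> (g \<cdot>\<^bsub>C\<^esub> f)) = (Mult E \<cdot>\<^bsub>C\<^esub> (g \<boxtimes>\<^bsub>C\<^esub> g)) \<cdot>\<^bsub>C\<^esub> (f \<boxtimes>\<^bsub>C\<^esub> f)"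
      by (simp add: C.TArr_Comp_Arr)
    also have "\<dots> = (g \<cdot>\<^bsub>C\<^esub> f) \<cdot>\<^bsub>C\<^esub> Mult A"
      unfolding g' by (simp add: f')
    finally show ?thesis
      by (simp add: bimonoid_hom_def Hom_iff f' g' C.Comp_chain[OF g'(3)] C.Comp_chain[OF g'(4)]
          C.TArr_Comp_chain)
  qed
  show ?thesis
  proof unfold_locales
    fix x y a b c
    assume "x \<in> Hom (special_bicommutative_bimonoids C) a b" "y \<in> Hom (special_bicommutative_bimonoids C) b c"
    then show "Comp (special_bicommutative_bimonoids C) y x \<in> Hom (special_bicommutative_bimonoids C) a c"
      by (cases x; cases y) (auto simp: special_bicommutative_bimonoids_def Hom_iff intro: comp)
  qed (auto simp: special_bicommutative_bimonoids_def Hom_iff id, auto simp: bimonoid_hom_def Hom_iff)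
qed

text \<open>Naturality at the four structure maps, combined with the compatibility of
  \<open>\<theta>\<close> with \<open>Phi\<close> and \<open>Phi0\<close>. For the comonoid part the
  inverse comparisons are removed by composing with those of \<open>G\<close>.\<close>

lemma monoidal_natural_transformation_bimonoid_hom:
  fixes C (structure)
  assumes "monoidal_natural_transformation T C F G \<theta>" and B: "special_bicommutative_bimonoid T B"
  shows "bimonoid_hom C (image_bimonoid C F B) (image_bimonoid C G B) (\<theta> (Carrier B))"
proof -
  interpret C: symmetric_monoidal_category C
    using assms(1) by (simp add: monoidal_natural_transformation_def symmetric_monoidal_functor_def)
  interpret \<theta>: monoidal_natural_transformation T C F G \<theta> by fact
  interpret F: strong_functor T C F by simp unfold_locales
  interpret G: strong_functor T C G by simp unfold_locales
  interpret B: special_bicommutative_bimonoid T B by fact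
  let ?c = "Carrier B" and ?cc = "Carrier B \<otimes>\<^bsub>T\<^esub> Carrier B"
  have [simp]: "?c \<in> Obj T" "Mult B \<in> Arr T" "Dom T (Mult B) = ?cc" "Cod T (Mult B) = ?c"
    "Eta B \<in> Arr T" "Dom T (Eta B) = \<I>\<^bsub>T\<^esub>" "Cod T (Eta B) = ?c"
    "Comult B \<in> Arr T" "Cod T (Comult B) = ?cc" "Dom T (Comult B) = ?c"
    "Counit B \<in> Arr T" "Cod T (Counit B) = \<I>\<^bsub>T\<^esub>" "Dom T (Counit B) = ?c"
    using B.carrier_in_Obj B.mult_in_Hom B.unit_in_Hom B.comult_in_Hom B.counit_in_Hom by (simp_all add: Hom_iff)
  have [simp]: "\<theta> a \<in> Arr C" "Dom C (\<theta> a) = FObj F a" "Cod C (\<theta> a) = FObj G a" if "a \<in> Obj T" for a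
    using \<theta>.component_in_Hom[OF that] by (auto simp: Hom_iff)
  have nat: "\<theta> (Cod T f) \<cdot> FArr F f = FArr G f \<cdot> \<theta> (Dom T f)" if "f \<in> Arr T" for f
    using \<theta>.naturality[of f "Dom T f" "Cod T f"] that by (simp add: Hom_iff)
  have "Mult (image_bimonoid C G B) \<cdot> (\<theta> ?c \<boxtimes> \<theta> ?c) = \<theta> ?c \<cdot> Mult (image_bimonoid C F B)"
    using C.Comp_chain[OF nat[of "Mult B"], of "Phi F ?c ?c"]
    by (simp add: image_bimonoid_def \<theta>.component_Phi)
  moreover have "\<theta> ?c \<cdot> Eta (image_bimonoid C F B) = Eta (image_bimonoid C G B)"
    using C.Comp_chain[OF nat[of "Eta B"], of "Phi0 F"]
    by (simp add: image_bimonoid_def \<theta>.component_Phi0)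
  moreover have "Comult (image_bimonoid C G B) \<cdot> \<theta> ?c = (\<theta> ?c \<boxtimes> \<theta> ?c) \<cdot> Comult (image_bimonoid C F B)"
  proof (rule C.iso_cancel_left[of "Phi G ?c ?c"])
    show "Phi G ?c ?c \<cdot> Comult (image_bimonoid C G B) \<cdot> \<theta> ?c
      = Phi G ?c ?c \<cdot> (\<theta> ?c \<boxtimes> \<theta> ?c) \<cdot> Comult (image_bimonoid C F B)"
      using nat[of "Comult B"]
      by (simp add: image_bimonoid_def C.Comp_chain[OF \<theta>.component_Phi[symmetric]])
  qed (simp_all add: image_bimonoid_def)
  moreover have "Counit (image_bimonoid C G B) \<cdot> \<theta> ?c = Counit (image_bimonoid C F B)"
  proof (rule C.iso_cancel_left[of "Phi0 G"])
    show "Phi0 G \<cdot> Counit (image_bimonoid C G B) \<cdot> \<theta> ?c = Phi0 G \<cdot> Counit (image_bimonoid C F B)"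
    proof -
      have "Phi0 G \<cdot> Counit (image_bimonoid C F B) = (\<theta> \<I>\<^bsub>T\<^esub> \<cdot> Phi0 F) \<cdot> Counit (image_bimonoid C F B)"
        by (simp only: \<theta>.component_Phi0)
      then show ?thesis
        using nat[of "Counit B"] by (simp add: image_bimonoid_def)
    qed
  qed (simp_all add: image_bimonoid_def)
  moreover have "Carrier (image_bimonoid C F B) = FObj F ?c" "Carrier (image_bimonoid C G B) = FObj G ?c"
    by (simp_all add: image_bimonoid_def)
  ultimately show ?thesis
    by (simp add: bimonoid_hom_def Hom_iff)
qed

section \<open>Transformations of algebras: extension from the component at 1\<close>

locale algebra_pair = T: prop_category T + F: strong_functor T C F + G: strong_functor T C G
  for T :: "(nat, 'm1, 'z1) sm_category_scheme"
    and C :: "('o2, 'm2, 'z2) sm_category_scheme" (structure)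
    and F G :: "(nat, 'm1, 'o2, 'm2) mon_map"
begin

text \<open>Every object is a sum of ones, and the comparison maps are invertible. Compatibility
  with them can therefore be solved for the component at \<open>Suc n\<close>; the resulting
  recursion is also the definition of \<open>extension\<close>.\<close>

lemma transformation_unique:
  assumes "monoidal_natural_transformation T C F G \<theta>" "monoidal_natural_transformation T C F G \<theta>'"
    and "\<theta> 1 = \<theta>' 1"
  shows "\<theta> = \<theta>'"
proof
  fix n
  have step: "\<theta> 0 = Phi0 G \<cdot> inv_arrow C (Phi0 F)"
    "\<theta> (Suc n) = Phi G 1 n \<cdot> (\<theta> 1 \<boxtimes> \<theta> n) \<cdot> inv_arrow C (Phi F 1 n)"
    if "monoidal_natural_transformation T C F G \<theta>" for \<theta> n
  proof -
    interpret \<theta>: monoidal_natural_transformation T C F G \<theta> by fact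
    have [simp]: "\<theta> a \<in> Arr C" "Dom C (\<theta> a) = FObj F a" "Cod C (\<theta> a) = FObj G a" for a
      using \<theta>.component_in_Hom[of a] by (auto simp: Hom_iff)
    have "\<theta> 0 = (\<theta> 0 \<cdot> Phi0 F) \<cdot> inv_arrow C (Phi0 F)"
      by simp
    also have "\<theta> 0 \<cdot> Phi0 F = Phi0 G"
      using \<theta>.component_Phi0 by simp
    finally show "\<theta> 0 = Phi0 G \<cdot> inv_arrow C (Phi0 F)" .
    have "\<theta> (Suc n) = (\<theta> (1 + n) \<cdot> Phi F 1 n) \<cdot> inv_arrow C (Phi F 1 n)"
      by simp
    also have "\<theta> (1 + n) \<cdot> Phi F 1 n = Phi G 1 n \<cdot> (\<theta> 1 \<boxtimes> \<theta> n)"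
      using \<theta>.component_Phi[of 1 n] by simp
    finally show "\<theta> (Suc n) = Phi G 1 n \<cdot> (\<theta> 1 \<boxtimes> \<theta> n) \<cdot> inv_arrow C (Phi F 1 n)"
      by simp
  qed
  show "\<theta> n = \<theta>' n"
  proof (induction n)
    case 0
    show ?case by (simp only: step(1)[OF assms(1)] step(1)[OF assms(2)])
  next
    case (Suc n)
    then show ?case
      using step(2)[OF assms(1), of n] step(2)[OF assms(2), of n] assms(3) by metis
  qed
qed

primrec extension :: "'m2 \<Rightarrow> nat \<Rightarrow> 'm2" where
  "extension f 0 = Phi0 G \<cdot> inv_arrow C (Phi0 F)"
| "extension f (Suc n) = Phi G 1 n \<cdot> (f \<boxtimes> extension f n) \<cdot> inv_arrow C (Phi F 1 n)"

context
  fixes f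
  assumes f [simp]: "f \<in> Arr C" "Dom C f = FObj F (Suc 0)" "Cod C f = FObj G (Suc 0)"
begin

abbreviation "\<theta> \<equiv> extension f"

lemma extension_simps [simp]: "\<theta> n \<in> Arr C" "Dom C (\<theta> n) = FObj F n" "Cod C (\<theta> n) = FObj G n"
  by (induction n) simp_all

lemma Phi_Unit_left:
  "Phi F 0 n \<cdot> (Phi0 F \<boxtimes> \<one> (FObj F n)) = \<l> (FObj F n)" "Phi G 0 n \<cdot> (Phi0 G \<boxtimes> \<one> (FObj G n)) = \<l> (FObj G n)"
  using F.Phi_LUnit[of n] G.Phi_LUnit[of n] by simp_all

lemma Phi_Unit_right:
  "Phi F n 0 \<cdot> (\<one> (FObj F n) \<boxtimes> Phi0 F) = \<r> (FObj F n)" "Phi G n 0 \<cdot> (\<one> (FObj G n) \<boxtimes> Phi0 G) = \<r> (FObj G n)"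
  using F.Phi_RUnit[of n] G.Phi_RUnit[of n] by simp_all

lemma Phi_assoc:
  "Phi F (a + b) c \<cdot> (Phi F a b \<boxtimes> \<one> (FObj F c))
    = Phi F a (b + c) \<cdot> (\<one> (FObj F a) \<boxtimes> Phi F b c) \<cdot> \<alpha> (FObj F a) (FObj F b) (FObj F c)"
  "Phi G (a + b) c \<cdot> (Phi G a b \<boxtimes> \<one> (FObj G c))
    = Phi G a (b + c) \<cdot> (\<one> (FObj G a) \<boxtimes> Phi G b c) \<cdot> \<alpha> (FObj G a) (FObj G b) (FObj G c)"
  using F.Phi_Assoc[of a b c] G.Phi_Assoc[of a b c] by (simp_all add: add.assoc)

text \<open>The recursion starts at 0, so its value at 1 is not \<open>f\<close> by definition: it
  is \<open>f\<close> tensored with the comparison of units and conjugated. The right unit laws of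
  \<open>F\<close> and \<open>G\<close> and naturality of the right unitor remove this.\<close>

lemma extension_1 [simp]: "\<theta> (Suc 0) = f"
proof (rule F.C.iso_cancel_right)
  let ?k = "Phi F (Suc 0) 0 \<cdot> (\<one> (FObj F (Suc 0)) \<boxtimes> Phi0 F)"
  have "\<theta> (Suc 0) \<cdot> ?k = (Phi G (Suc 0) 0 \<cdot> (\<one> (FObj G (Suc 0)) \<boxtimes> Phi0 G)) \<cdot> (f \<boxtimes> \<one> \<I>)"
    by (simp add: F.C.TArr_Comp_Arr)
  also have "\<dots> = f \<cdot> ?k"
    unfolding Phi_Unit_right by (simp add: F.C.RUnit_natural_Arr)
  finally show "\<theta> (Suc 0) \<cdot> ?k = f \<cdot> ?k" .
qed simp_all

text \<open>The recursion peels off single ones on the left. The case of a general left summand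
  follows from the left unit law of the comparison maps and, in the step, from their associativity
  together with naturality of the associator; each time an invertible comparison is
  cancelled.\<close>

lemma extension_Phi: "\<theta> (a + b) \<cdot> Phi F a b = Phi G a b \<cdot> (\<theta> a \<boxtimes> \<theta> b)"
proof (induction a)
  case 0
  show ?case
  proof (rule F.C.iso_cancel_right[of _ "Phi0 F \<boxtimes> \<one> (FObj F b)"])
    have "(Phi G 0 b \<cdot> (\<theta> 0 \<boxtimes> \<theta> b)) \<cdot> (Phi0 F \<boxtimes> \<one> (FObj F b))
      = (Phi G 0 b \<cdot> (Phi0 G \<boxtimes> \<one> (FObj G b))) \<cdot> (\<one> \<I> \<boxtimes> \<theta> b)"
      by (simp add: F.C.TArr_Comp_Arr)
    also have "\<dots> = (\<theta> (0 + b) \<cdot> Phi F 0 b) \<cdot> (Phi0 F \<boxtimes> \<one> (FObj F b))"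
      unfolding Phi_Unit_left by (simp add: F.C.LUnit_natural_Arr Phi_Unit_left)
    finally show "(\<theta> (0 + b) \<cdot> Phi F 0 b) \<cdot> (Phi0 F \<boxtimes> \<one> (FObj F b))
      = (Phi G 0 b \<cdot> (\<theta> 0 \<boxtimes> \<theta> b)) \<cdot> (Phi0 F \<boxtimes> \<one> (FObj F b))" ..
  qed simp_all
next
  case (Suc a)
  show ?case
  proof (rule F.C.iso_cancel_right[of _ "Phi F 1 a \<boxtimes> \<one> (FObj F b)"])
    have "(\<theta> (Suc a + b) \<cdot> Phi F (Suc a) b) \<cdot> (Phi F 1 a \<boxtimes> \<one> (FObj F b))
      = \<theta> (Suc (a + b)) \<cdot> (Phi F (1 + a) b \<cdot> (Phi F 1 a \<boxtimes> \<one> (FObj F b)))"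
      by simp
    also have "\<dots> = Phi G 1 (a + b) \<cdot> (f \<boxtimes> (\<theta> (a + b) \<cdot> Phi F a b)) \<cdot> \<alpha> (FObj F 1) (FObj F a) (FObj F b)"
      unfolding Phi_assoc by (simp add: F.C.TArr_Comp_chain)
    also have "\<dots> = Phi G 1 (a + b) \<cdot> (\<one> (FObj G 1) \<boxtimes> Phi G a b) \<cdot> ((f \<boxtimes> \<theta> a \<boxtimes> \<theta> b) \<cdot> \<alpha> (FObj F 1) (FObj F a) (FObj F b))"
      by (simp add: Suc.IH F.C.TArr_Comp_chain)
    also have "(f \<boxtimes> \<theta> a \<boxtimes> \<theta> b) \<cdot> \<alpha> (FObj F 1) (FObj F a) (FObj F b)
      = \<alpha> (FObj G 1) (FObj G a) (FObj G b) \<cdot> ((f \<boxtimes> \<theta> a) \<boxtimes> \<theta> b)"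
      by (simp add: F.C.Assoc_natural_Arr)
    also have "Phi G 1 (a + b) \<cdot> (\<one> (FObj G 1) \<boxtimes> Phi G a b) \<cdot> \<alpha> (FObj G 1) (FObj G a) (FObj G b) \<cdot> ((f \<boxtimes> \<theta> a) \<boxtimes> \<theta> b)
      = (Phi G (1 + a) b \<cdot> (Phi G 1 a \<boxtimes> \<one> (FObj G b))) \<cdot> ((f \<boxtimes> \<theta> a) \<boxtimes> \<theta> b)"
      unfolding Phi_assoc by simp
    also have "\<dots> = (Phi G (Suc a) b \<cdot> (\<theta> (Suc a) \<boxtimes> \<theta> b)) \<cdot> (Phi F 1 a \<boxtimes> \<one> (FObj F b))"
      by (simp add: F.C.TArr_Comp_Arr)
    finally show "(\<theta> (Suc a + b) \<cdot> Phi F (Suc a) b) \<cdot> (Phi F 1 a \<boxtimes> \<one> (FObj F b))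
      = (Phi G (Suc a) b \<cdot> (\<theta> (Suc a) \<boxtimes> \<theta> b)) \<cdot> (Phi F 1 a \<boxtimes> \<one> (FObj F b))" .
  qed simp_all
qed

lemma extension_Phi0: "\<theta> 0 \<cdot> Phi0 F = Phi0 G"
  by simp

text \<open>Monoidality of the extension holds for every arrow \<open>f\<close> of the right type.
  Naturality is isolated at single arrows so that it can be proved by induction over generators;
  that \<open>f\<close> is a bimonoid homomorphism enters only at the four structure maps.\<close>

definition natural_at :: "'m1 \<Rightarrow> bool" where
  "natural_at h \<longleftrightarrow> \<theta> (Cod T h) \<cdot> FArr F h = FArr G h \<cdot> \<theta> (Dom T h)"

lemma natural_at_Comp:
  assumes [simp]: "g \<in> Arr T" "h \<in> Arr T" "Dom T h = Cod T g" and g: "natural_at g" and h: "natural_at h"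
  shows "natural_at (h \<cdot>\<^bsub>T\<^esub> g)"
proof -
  have "\<theta> (Cod T h) \<cdot> FArr F (h \<cdot>\<^bsub>T\<^esub> g) = (\<theta> (Cod T h) \<cdot> FArr F h) \<cdot> FArr F g"
    by (simp add: F.FArr_Comp_Arr)
  also have "\<dots> = FArr G h \<cdot> \<theta> (Cod T g) \<cdot> FArr F g"
    using h by (simp add: natural_at_def)
  also have "\<dots> = FArr G (h \<cdot>\<^bsub>T\<^esub> g) \<cdot> \<theta> (Dom T g)"
    using g by (simp add: natural_at_def G.FArr_Comp_Arr)
  finally show ?thesis by (simp add: natural_at_def)
qed

lemma natural_at_TArr:
  assumes [simp]: "g \<in> Arr T" "h \<in> Arr T" and g: "natural_at g" and h: "natural_at h"
  shows "natural_at (g \<boxtimes>\<^bsub>T\<^esub> h)"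
proof -
  have "\<theta> (Cod T g + Cod T h) \<cdot> FArr F (g \<boxtimes>\<^bsub>T\<^esub> h) = FArr G (g \<boxtimes>\<^bsub>T\<^esub> h) \<cdot> \<theta> (Dom T g + Dom T h)"
  proof (rule F.C.iso_cancel_right[of _ "Phi F (Dom T g) (Dom T h)"])
    have "(\<theta> (Cod T g + Cod T h) \<cdot> FArr F (g \<boxtimes>\<^bsub>T\<^esub> h)) \<cdot> Phi F (Dom T g) (Dom T h)
      = (\<theta> (Cod T g + Cod T h) \<cdot> Phi F (Cod T g) (Cod T h)) \<cdot> (FArr F g \<boxtimes> FArr F h)"
      by (simp add: F.Phi_natural_Arr)
    also have "\<dots> = Phi G (Cod T g) (Cod T h) \<cdot> ((\<theta> (Cod T g) \<cdot> FArr F g) \<boxtimes> (\<theta> (Cod T h) \<cdot> FArr F h))"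
      unfolding extension_Phi by (simp add: F.C.TArr_Comp_Arr)
    also have "\<dots> = (Phi G (Cod T g) (Cod T h) \<cdot> (FArr G g \<boxtimes> FArr G h)) \<cdot> (\<theta> (Dom T g) \<boxtimes> \<theta> (Dom T h))"
      using g h by (simp add: natural_at_def F.C.TArr_Comp_Arr)
    also have "Phi G (Cod T g) (Cod T h) \<cdot> (FArr G g \<boxtimes> FArr G h) = FArr G (g \<boxtimes>\<^bsub>T\<^esub> h) \<cdot> Phi G (Dom T g) (Dom T h)"
      by (simp add: G.Phi_natural_Arr)
    finally show "(\<theta> (Cod T g + Cod T h) \<cdot> FArr F (g \<boxtimes>\<^bsub>T\<^esub> h)) \<cdot> Phi F (Dom T g) (Dom T h)
      = (FArr G (g \<boxtimes>\<^bsub>T\<^esub> h) \<cdot> \<theta> (Dom T g + Dom T h)) \<cdot> Phi F (Dom T g) (Dom T h)"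
      by (simp add: extension_Phi)
  qed simp_all
  then show ?thesis by (simp add: natural_at_def)
qed

lemma natural_at_Symm: "natural_at (\<tau>\<^bsub>T\<^esub> m n)"
proof -
  have "\<theta> (n + m) \<cdot> FArr F (\<tau>\<^bsub>T\<^esub> m n) = FArr G (\<tau>\<^bsub>T\<^esub> m n) \<cdot> \<theta> (m + n)"
  proof (rule F.C.iso_cancel_right[of _ "Phi F m n"])
    have "(\<theta> (n + m) \<cdot> FArr F (\<tau>\<^bsub>T\<^esub> m n)) \<cdot> Phi F m n = (\<theta> (n + m) \<cdot> Phi F n m) \<cdot> \<tau> (FObj F m) (FObj F n)"
      by (simp add: F.Phi_Symm)
    also have "\<dots> = Phi G n m \<cdot> \<tau> (FObj G m) (FObj G n) \<cdot> (\<theta> m \<boxtimes> \<theta> n)"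
      unfolding extension_Phi by (simp add: F.C.Symm_natural_Arr)
    also have "\<dots> = (FArr G (\<tau>\<^bsub>T\<^esub> m n) \<cdot> Phi G m n) \<cdot> (\<theta> m \<boxtimes> \<theta> n)"
      by (simp add: G.Phi_Symm)
    finally show "(\<theta> (n + m) \<cdot> FArr F (\<tau>\<^bsub>T\<^esub> m n)) \<cdot> Phi F m n
      = (FArr G (\<tau>\<^bsub>T\<^esub> m n) \<cdot> \<theta> (m + n)) \<cdot> Phi F m n"
      by (simp add: extension_Phi)
  qed simp_all
  then show ?thesis by (simp add: natural_at_def)
qed

lemma natural_at_Ident: "natural_at (\<one>\<^bsub>T\<^esub> n)"
  by (simp add: natural_at_def)

lemma natural_at_bimonoid:
  assumes "special_bicommutative_bimonoid T B" "Carrier B = 1"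
    and "bimonoid_hom C (image_bimonoid C F B) (image_bimonoid C G B) f"
  shows "natural_at (Mult B)" "natural_at (Eta B)" "natural_at (Comult B)" "natural_at (Counit B)"
proof -
  interpret B: special_bicommutative_bimonoid T B by fact
  have [simp]: "Mult B \<in> Arr T" "Dom T (Mult B) = Suc (Suc 0)" "Cod T (Mult B) = Suc 0"
    "Eta B \<in> Arr T" "Dom T (Eta B) = 0" "Cod T (Eta B) = Suc 0"
    "Comult B \<in> Arr T" "Cod T (Comult B) = Suc (Suc 0)" "Dom T (Comult B) = Suc 0"
    "Counit B \<in> Arr T" "Cod T (Counit B) = 0" "Dom T (Counit B) = Suc 0"
    using assms(2) B.mult_in_Hom B.unit_in_Hom B.comult_in_Hom B.counit_in_Hom by (simp_all add: Hom_iff)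
  have hom:
    "FArr G (Mult B) \<cdot> Phi G (Suc 0) (Suc 0) \<cdot> (f \<boxtimes> f) = f \<cdot> FArr F (Mult B) \<cdot> Phi F (Suc 0) (Suc 0)"
    "f \<cdot> FArr F (Eta B) \<cdot> Phi0 F = FArr G (Eta B) \<cdot> Phi0 G"
    "inv_arrow C (Phi G (Suc 0) (Suc 0)) \<cdot> FArr G (Comult B) \<cdot> f
      = (f \<boxtimes> f) \<cdot> inv_arrow C (Phi F (Suc 0) (Suc 0)) \<cdot> FArr F (Comult B)"
    "inv_arrow C (Phi0 G) \<cdot> FArr G (Counit B) \<cdot> f = inv_arrow C (Phi0 F) \<cdot> FArr F (Counit B)"
    using assms(3) by (simp_all add: bimonoid_hom_def image_bimonoid_def assms(2))
  have \<theta>2: "\<theta> (Suc (Suc 0)) \<cdot> Phi F (Suc 0) (Suc 0) = Phi G (Suc 0) (Suc 0) \<cdot> (f \<boxtimes> f)"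
    using extension_Phi[of 1 1] by (simp del: extension.simps)
  have "f \<cdot> FArr F (Mult B) = FArr G (Mult B) \<cdot> \<theta> (Suc (Suc 0))"
    by (rule F.C.iso_cancel_right[of _ "Phi F (Suc 0) (Suc 0)"]) (use hom(1) \<theta>2 in \<open>simp_all del: extension.simps\<close>)
  then show "natural_at (Mult B)"
    by (simp add: natural_at_def del: extension.simps)
  have "f \<cdot> FArr F (Eta B) = FArr G (Eta B) \<cdot> \<theta> 0"
    by (rule F.C.iso_cancel_right[of _ "Phi0 F"]) (use hom(2) extension_Phi0 in \<open>simp_all del: extension.simps\<close>)
  then show "natural_at (Eta B)"
    by (simp add: natural_at_def del: extension.simps)
  have "\<theta> (Suc (Suc 0)) \<cdot> FArr F (Comult B) = (\<theta> (Suc (Suc 0)) \<cdot> Phi F (Suc 0) (Suc 0))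
      \<cdot> inv_arrow C (Phi F (Suc 0) (Suc 0)) \<cdot> FArr F (Comult B)"
    by (simp del: extension.simps)
  also have "\<dots> = FArr G (Comult B) \<cdot> f"
    unfolding \<theta>2 by (simp flip: hom(3))
  finally show "natural_at (Comult B)"
    by (simp add: natural_at_def del: extension.simps)
  have "\<theta> 0 \<cdot> FArr F (Counit B) = FArr G (Counit B) \<cdot> f"
    by (simp flip: hom(4))
  then show "natural_at (Counit B)"
    by (simp add: natural_at_def del: extension.simps)
qed

end

end

lemma FinRel_transformation_exists:
  fixes F G :: "(nat, nat \<times> (nat \<times> nat) set \<times> nat, 'o, 'm) mon_map"
  assumes F: "symmetric_monoidal_functor FinRel C F" and G: "symmetric_monoidal_functor FinRel C G"
    and f: "bimonoid_hom C (image_bimonoid C F FinRel_bimonoid) (image_bimonoid C G FinRel_bimonoid) f"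
  shows "\<exists>\<theta>. monoidal_natural_transformation FinRel C F G \<theta> \<and> \<theta> 1 = f"
proof -
  interpret algebra_pair FinRel C F G
    using F G by (simp add: algebra_pair_def FinRel_prop_category)
  have fs: "f \<in> Arr C" "Dom C f = FObj F (Suc 0)" "Cod C f = FObj G (Suc 0)"
    using f by (simp_all add: bimonoid_hom_def image_bimonoid_def Hom_iff)
  note [simp] = extension_simps[OF fs]
  have nat: "natural_at f h" if "h \<in> Arr FinRel" for h
    using that natural_at_Ident[OF fs] natural_at_Symm[OF fs] natural_at_bimonoid[OF fs FinRel_bimonoid _ f]
      natural_at_Comp[OF fs] natural_at_TArr[OF fs]
    by (rule FinRel_induct) simp_all
  have "monoidal_natural_transformation FinRel C F G (extension f)"
  proof unfold_locales
    fix h a b assume "h \<in> Hom FinRel a b"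
    then show "extension f b \<cdot>\<^bsub>C\<^esub> FArr F h = FArr G h \<cdot>\<^bsub>C\<^esub> extension f a"
      using nat[of h] by (auto simp: natural_at_def[OF fs] Hom_iff)
  qed (use extension_Phi[OF fs] extension_Phi0[OF fs] in \<open>auto simp: Hom_iff\<close>)
  then show ?thesis
    using extension_1[OF fs] by (intro exI[of _ "extension f"]) simp
qed

section \<open>From bimonoids to algebras\<close>

definition comp_mon ::
  "('o3, 'm3, 'z3) sm_category_scheme \<Rightarrow> ('o2, 'm2, 'o3, 'm3, 'y2) mon_map_scheme
    \<Rightarrow> ('o1, 'm1, 'o2, 'm2, 'y1) mon_map_scheme \<Rightarrow> ('o1, 'm1, 'o3, 'm3) mon_map" where
  "comp_mon D G F =
     \<lparr>FObj = (\<lambda>a. FObj G (FObj F a)), FArr = (\<lambda>f. FArr G (FArr F f)),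
      Phi = (\<lambda>a b. FArr G (Phi F a b) \<cdot>\<^bsub>D\<^esub> Phi G (FObj F a) (FObj F b)),
      Phi0 = FArr G (Phi0 F) \<cdot>\<^bsub>D\<^esub> Phi0 G\<rparr>"

lemma comp_mon_simps [simp]:
  "FObj (comp_mon D G F) a = FObj G (FObj F a)" "FArr (comp_mon D G F) f = FArr G (FArr F f)"
  "Phi (comp_mon D G F) a b = FArr G (Phi F a b) \<cdot>\<^bsub>D\<^esub> Phi G (FObj F a) (FObj F b)"
  "Phi0 (comp_mon D G F) = FArr G (Phi0 F) \<cdot>\<^bsub>D\<^esub> Phi0 G"
  by (simp_all add: comp_mon_def)

text \<open>In each coherence law, naturality of \<open>Phi G\<close> collects the maps coming from
  \<open>F\<close> under \<open>FArr G\<close>. The law of \<open>F\<close> applies there and the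
  law of \<open>G\<close> to what remains. The composite of interest runs from relations through the
  strict PROP of powers to the given category.\<close>

lemma comp_mon_symmetric_monoidal:
  fixes D (structure)
  assumes "symmetric_monoidal_functor T C F" "symmetric_monoidal_functor C D G"
  shows "symmetric_monoidal_functor T D (comp_mon D G F)"
proof -
  interpret D: symmetric_monoidal_category D
    using assms(2) by (simp add: symmetric_monoidal_functor_def)
  interpret C: symmetric_monoidal_category C
    using assms(2) by (simp add: symmetric_monoidal_functor_def)
  interpret T: symmetric_monoidal_category T
    using assms(1) by (simp add: symmetric_monoidal_functor_def)
  interpret F: strong_functor T C F using assms(1) by simp
  interpret G: strong_functor C D G using assms(2) by simp
  show ?thesis
  proof unfold_locales
    fix f g a b c assume "f \<in> Hom T a b" "g \<in> Hom T b c"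
    then show "FArr (comp_mon D G F) (g \<cdot>\<^bsub>T\<^esub> f) = FArr (comp_mon D G F) g \<cdot> FArr (comp_mon D G F) f"
      by (auto simp: Hom_iff F.FArr_Comp_Arr G.FArr_Comp_Arr)
  next
    fix f g a a' b b' assume "f \<in> Hom T a a'" "g \<in> Hom T b b'"
    then have [simp]: "f \<in> Arr T" "Dom T f = a" "Cod T f = a'" "g \<in> Arr T" "Dom T g = b" "Cod T g = b'"
      "a \<in> Obj T" "b \<in> Obj T" "a' \<in> Obj T" "b' \<in> Obj T"
      by (auto simp: Hom_iff)
    have "Phi G (FObj F a') (FObj F b') \<cdot> (FArr G (FArr F f) \<boxtimes> FArr G (FArr F g))
      = FArr G (FArr F f \<boxtimes>\<^bsub>C\<^esub> FArr F g) \<cdot> Phi G (FObj F a) (FObj F b)"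
      by (simp add: G.Phi_natural_Arr)
    then have "Phi (comp_mon D G F) a' b' \<cdot> (FArr G (FArr F f) \<boxtimes> FArr G (FArr F g))
      = FArr G (Phi F a' b' \<cdot>\<^bsub>C\<^esub> (FArr F f \<boxtimes>\<^bsub>C\<^esub> FArr F g)) \<cdot> Phi G (FObj F a) (FObj F b)"
      by (simp add: G.FArr_Comp_Arr)
    also have "Phi F a' b' \<cdot>\<^bsub>C\<^esub> (FArr F f \<boxtimes>\<^bsub>C\<^esub> FArr F g) = FArr F (f \<boxtimes>\<^bsub>T\<^esub> g) \<cdot>\<^bsub>C\<^esub> Phi F a b"
      by (simp add: F.Phi_natural_Arr)
    finally show "Phi (comp_mon D G F) a' b' \<cdot> (FArr (comp_mon D G F) f \<boxtimes> FArr (comp_mon D G F) g)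
      = FArr (comp_mon D G F) (f \<boxtimes>\<^bsub>T\<^esub> g) \<cdot> Phi (comp_mon D G F) a b"
      by (simp add: G.FArr_Comp_Arr)
  next
    fix a b c assume [simp]: "a \<in> Obj T" "b \<in> Obj T" "c \<in> Obj T"
    let ?a = "FObj F a" and ?b = "FObj F b" and ?c = "FObj F c"
    have "Phi G (FObj F (a \<otimes>\<^bsub>T\<^esub> b)) ?c \<cdot> (FArr G (Phi F a b) \<boxtimes> \<one> (FObj G ?c))
      = FArr G (Phi F a b \<boxtimes>\<^bsub>C\<^esub> \<one>\<^bsub>C\<^esub> ?c) \<cdot> Phi G (?a \<otimes>\<^bsub>C\<^esub> ?b) ?c"
      by (simp add: G.Phi_natural_Arr)
    note 1 = D.Comp_chain[OF this]
    have "Phi G ?a (FObj F (b \<otimes>\<^bsub>T\<^esub> c)) \<cdot> (\<one> (FObj G ?a) \<boxtimes> FArr G (Phi F b c))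
      = FArr G (\<one>\<^bsub>C\<^esub> ?a \<boxtimes>\<^bsub>C\<^esub> Phi F b c) \<cdot> Phi G ?a (?b \<otimes>\<^bsub>C\<^esub> ?c)"
      by (simp add: G.Phi_natural_Arr)
    note 2 = D.Comp_chain[OF this]
    have "FArr G (FArr F (\<alpha>\<^bsub>T\<^esub> a b c)) \<cdot> Phi (comp_mon D G F) (a \<otimes>\<^bsub>T\<^esub> b) c
        \<cdot> (Phi (comp_mon D G F) a b \<boxtimes> \<one> (FObj G ?c))
      = FArr G (FArr F (\<alpha>\<^bsub>T\<^esub> a b c)) \<cdot> FArr G (Phi F (a \<otimes>\<^bsub>T\<^esub> b) c) \<cdot> Phi G (FObj F (a \<otimes>\<^bsub>T\<^esub> b)) ?c
        \<cdot> (FArr G (Phi F a b) \<boxtimes> \<one> (FObj G ?c)) \<cdot> (Phi G ?a ?b \<boxtimes> \<one> (FObj G ?c))"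
      by (simp add: D.TArr_Comp_Arr)
    also have "\<dots> = FArr G (FArr F (\<alpha>\<^bsub>T\<^esub> a b c) \<cdot>\<^bsub>C\<^esub> Phi F (a \<otimes>\<^bsub>T\<^esub> b) c \<cdot>\<^bsub>C\<^esub> (Phi F a b \<boxtimes>\<^bsub>C\<^esub> \<one>\<^bsub>C\<^esub> ?c))
        \<cdot> Phi G (?a \<otimes>\<^bsub>C\<^esub> ?b) ?c \<cdot> (Phi G ?a ?b \<boxtimes> \<one> (FObj G ?c))"
      by (simp add: 1 G.FArr_Comp_Arr)
    also have "\<dots> = FArr G (Phi F a (b \<otimes>\<^bsub>T\<^esub> c)) \<cdot> FArr G (\<one>\<^bsub>C\<^esub> ?a \<boxtimes>\<^bsub>C\<^esub> Phi F b c)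
        \<cdot> (FArr G (\<alpha>\<^bsub>C\<^esub> ?a ?b ?c) \<cdot> Phi G (?a \<otimes>\<^bsub>C\<^esub> ?b) ?c \<cdot> (Phi G ?a ?b \<boxtimes> \<one> (FObj G ?c)))"
      by (simp add: F.Phi_Assoc G.FArr_Comp_Arr)
    also have "\<dots> = FArr G (Phi F a (b \<otimes>\<^bsub>T\<^esub> c)) \<cdot> Phi G ?a (FObj F (b \<otimes>\<^bsub>T\<^esub> c))
        \<cdot> (\<one> (FObj G ?a) \<boxtimes> FArr G (Phi F b c)) \<cdot> (\<one> (FObj G ?a) \<boxtimes> Phi G ?b ?c)
        \<cdot> \<alpha> (FObj G ?a) (FObj G ?b) (FObj G ?c)"
      by (simp add: 2 G.Phi_Assoc)
    also have "\<dots> = Phi (comp_mon D G F) a (b \<otimes>\<^bsub>T\<^esub> c) \<cdot> (\<one> (FObj G ?a) \<boxtimes> Phi (comp_mon D G F) b c)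
        \<cdot> \<alpha> (FObj G ?a) (FObj G ?b) (FObj G ?c)"
      by (simp add: D.TArr_Comp_chain)
    finally show "FArr (comp_mon D G F) (\<alpha>\<^bsub>T\<^esub> a b c) \<cdot> Phi (comp_mon D G F) (a \<otimes>\<^bsub>T\<^esub> b) c
        \<cdot> (Phi (comp_mon D G F) a b \<boxtimes> \<one> (FObj (comp_mon D G F) c))
      = Phi (comp_mon D G F) a (b \<otimes>\<^bsub>T\<^esub> c) \<cdot> (\<one> (FObj (comp_mon D G F) a) \<boxtimes> Phi (comp_mon D G F) b c)
        \<cdot> \<alpha> (FObj (comp_mon D G F) a) (FObj (comp_mon D G F) b) (FObj (comp_mon D G F) c)"
      by simp
  next
    fix a assume [simp]: "a \<in> Obj T"
    let ?a = "FObj F a" and ?i = "\<I>\<^bsub>T\<^esub>"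
    have "Phi G (FObj F ?i) ?a \<cdot> (FArr G (Phi0 F) \<boxtimes> \<one> (FObj G ?a))
      = FArr G (Phi0 F \<boxtimes>\<^bsub>C\<^esub> \<one>\<^bsub>C\<^esub> ?a) \<cdot> Phi G \<I>\<^bsub>C\<^esub> ?a"
      by (simp add: G.Phi_natural_Arr)
    note 1 = D.Comp_chain[OF this]
    have "FArr G (FArr F (\<l>\<^bsub>T\<^esub> a)) \<cdot> Phi (comp_mon D G F) ?i a \<cdot> (Phi0 (comp_mon D G F) \<boxtimes> \<one> (FObj G ?a))
      = FArr G (FArr F (\<l>\<^bsub>T\<^esub> a)) \<cdot> FArr G (Phi F ?i a) \<cdot> Phi G (FObj F ?i) ?a
        \<cdot> (FArr G (Phi0 F) \<boxtimes> \<one> (FObj G ?a)) \<cdot> (Phi0 G \<boxtimes> \<one> (FObj G ?a))"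
      by (simp add: D.TArr_Comp_Arr)
    also have "\<dots> = FArr G (FArr F (\<l>\<^bsub>T\<^esub> a) \<cdot>\<^bsub>C\<^esub> Phi F ?i a \<cdot>\<^bsub>C\<^esub> (Phi0 F \<boxtimes>\<^bsub>C\<^esub> \<one>\<^bsub>C\<^esub> ?a))
        \<cdot> Phi G \<I>\<^bsub>C\<^esub> ?a \<cdot> (Phi0 G \<boxtimes> \<one> (FObj G ?a))"
      by (simp add: 1 G.FArr_Comp_Arr)
    also have "\<dots> = \<l> (FObj G ?a)"
      by (simp add: F.Phi_LUnit G.Phi_LUnit)
    finally show "FArr (comp_mon D G F) (\<l>\<^bsub>T\<^esub> a) \<cdot> Phi (comp_mon D G F) ?i a
        \<cdot> (Phi0 (comp_mon D G F) \<boxtimes> \<one> (FObj (comp_mon D G F) a)) = \<l> (FObj (comp_mon D G F) a)"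
      by simp
  next
    fix a assume [simp]: "a \<in> Obj T"
    let ?a = "FObj F a" and ?i = "\<I>\<^bsub>T\<^esub>"
    have "Phi G ?a (FObj F ?i) \<cdot> (\<one> (FObj G ?a) \<boxtimes> FArr G (Phi0 F))
      = FArr G (\<one>\<^bsub>C\<^esub> ?a \<boxtimes>\<^bsub>C\<^esub> Phi0 F) \<cdot> Phi G ?a \<I>\<^bsub>C\<^esub>"
      by (simp add: G.Phi_natural_Arr)
    note 1 = D.Comp_chain[OF this]
    have "FArr G (FArr F (\<r>\<^bsub>T\<^esub> a)) \<cdot> Phi (comp_mon D G F) a ?i \<cdot> (\<one> (FObj G ?a) \<boxtimes> Phi0 (comp_mon D G F))
      = FArr G (FArr F (\<r>\<^bsub>T\<^esub> a)) \<cdot> FArr G (Phi F a ?i) \<cdot> Phi G ?a (FObj F ?i)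
        \<cdot> (\<one> (FObj G ?a) \<boxtimes> FArr G (Phi0 F)) \<cdot> (\<one> (FObj G ?a) \<boxtimes> Phi0 G)"
      by (simp add: D.TArr_Comp_Arr)
    also have "\<dots> = FArr G (FArr F (\<r>\<^bsub>T\<^esub> a) \<cdot>\<^bsub>C\<^esub> Phi F a ?i \<cdot>\<^bsub>C\<^esub> (\<one>\<^bsub>C\<^esub> ?a \<boxtimes>\<^bsub>C\<^esub> Phi0 F))
        \<cdot> Phi G ?a \<I>\<^bsub>C\<^esub> \<cdot> (\<one> (FObj G ?a) \<boxtimes> Phi0 G)"
      by (simp add: 1 G.FArr_Comp_Arr)
    also have "\<dots> = \<r> (FObj G ?a)"
      by (simp add: F.Phi_RUnit G.Phi_RUnit)
    finally show "FArr (comp_mon D G F) (\<r>\<^bsub>T\<^esub> a) \<cdot> Phi (comp_mon D G F) a ?i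
        \<cdot> (\<one> (FObj (comp_mon D G F) a) \<boxtimes> Phi0 (comp_mon D G F)) = \<r> (FObj (comp_mon D G F) a)"
      by simp
  next
    fix a b assume [simp]: "a \<in> Obj T" "b \<in> Obj T"
    let ?a = "FObj F a" and ?b = "FObj F b"
    have "FArr G (FArr F (\<tau>\<^bsub>T\<^esub> a b)) \<cdot> Phi (comp_mon D G F) a b
      = FArr G (FArr F (\<tau>\<^bsub>T\<^esub> a b) \<cdot>\<^bsub>C\<^esub> Phi F a b) \<cdot> Phi G ?a ?b"
      by (simp add: G.FArr_Comp_Arr)
    also have "\<dots> = FArr G (Phi F b a) \<cdot> (FArr G (\<tau>\<^bsub>C\<^esub> ?a ?b) \<cdot> Phi G ?a ?b)"
      by (simp add: F.Phi_Symm G.FArr_Comp_Arr)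
    also have "\<dots> = Phi (comp_mon D G F) b a \<cdot> \<tau> (FObj G ?a) (FObj G ?b)"
      by (simp add: G.Phi_Symm)
    finally show "FArr (comp_mon D G F) (\<tau>\<^bsub>T\<^esub> a b) \<cdot> Phi (comp_mon D G F) a b
      = Phi (comp_mon D G F) b a \<cdot> \<tau> (FObj (comp_mon D G F) a) (FObj (comp_mon D G F) b)"
      by simp
  qed (auto simp: Hom_iff)
qed

text \<open>Objects of the category of algebras are normalised off the arrows. The axioms evaluate
  \<open>FArr\<close> at arrows only, so truncation preserves them.\<close>

lemma restrict_FArr_symmetric_monoidal:
  fixes F :: "('o1, 'm1, 'o2, 'm2, 'z) mon_map_scheme"
  assumes "symmetric_monoidal_functor T C F"
  shows "symmetric_monoidal_functor T C (F\<lparr>FArr := restrict (FArr F) (Arr T)\<rparr>)"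
proof -
  interpret F: strong_functor T C F using assms by simp
  show ?thesis
    by unfold_locales
      (auto simp: Hom_iff F.FArr_Comp_Arr F.Phi_natural_Arr F.Phi_Assoc F.Phi_LUnit F.Phi_RUnit F.Phi_Symm)
qed

section \<open>The functor from relations to the PROP of a bimonoid\<close>

context prop_bimonoid
begin

text \<open>Having a representing arrow is preserved by composition and sum and holds for the
  generators, so induction yields it for all relations. No independence of the chosen decomposition
  has to be checked, because representing arrows are unique.\<close>

lemma represents_exists:
  assumes "h \<in> Arr FinRel"
  shows "\<exists>f\<in>Arr T. Dom T f = fst h \<and> Cod T f = snd (snd h) \<and> represents f (fst (snd h))"
  using assms
proof (rule FinRel_induct)
  fix f g assume f: "f \<in> Arr FinRel" and g: "g \<in> Arr FinRel" and eq: "Dom FinRel g = Cod FinRel f"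
    and "\<exists>x\<in>Arr T. Dom T x = fst f \<and> Cod T x = snd (snd f) \<and> represents x (fst (snd f))"
    and "\<exists>x\<in>Arr T. Dom T x = fst g \<and> Cod T x = snd (snd g) \<and> represents x (fst (snd g))"
  then obtain x y where "x \<in> Arr T" "Dom T x = fst f" "Cod T x = snd (snd f)" "represents x (fst (snd f))"
    "y \<in> Arr T" "Dom T y = fst g" "Cod T y = snd (snd g)" "represents y (fst (snd g))" by auto
  then show "\<exists>x\<in>Arr T. Dom T x = fst (Comp FinRel g f) \<and> Cod T x = snd (snd (Comp FinRel g f))
      \<and> represents x (fst (snd (Comp FinRel g f)))"
    using f g eq by (cases f; cases g) (auto intro!: bexI[of _ "y \<cdot> x"] represents_Comp)
next
  fix f g assume f: "f \<in> Arr FinRel" and g: "g \<in> Arr FinRel"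
    and "\<exists>x\<in>Arr T. Dom T x = fst f \<and> Cod T x = snd (snd f) \<and> represents x (fst (snd f))"
    and "\<exists>x\<in>Arr T. Dom T x = fst g \<and> Cod T x = snd (snd g) \<and> represents x (fst (snd g))"
  then obtain x y where "x \<in> Arr T" "Dom T x = fst f" "Cod T x = snd (snd f)" "represents x (fst (snd f))"
    "y \<in> Arr T" "Dom T y = fst g" "Cod T y = snd (snd g)" "represents y (fst (snd g))" by auto
  then show "\<exists>x\<in>Arr T. Dom T x = fst (TArr FinRel f g) \<and> Cod T x = snd (snd (TArr FinRel f g))
      \<and> represents x (fst (snd (TArr FinRel f g)))"
    using f g represents_TArr[of x "fst (snd f)" y "fst (snd g)"]
    by (cases f; cases g) (auto intro!: bexI[of _ "x \<boxtimes> y"])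
qed (use represents_Ident represents_Symm represents_\<mu> represents_\<eta> represents_\<Delta> represents_\<epsilon> in
    \<open>force simp: numeral_2_eq_2\<close>)+

definition relation_arrow :: "nat \<times> (nat \<times> nat) set \<times> nat \<Rightarrow> 'm" where
  "relation_arrow h = (THE f. f \<in> Arr T \<and> Dom T f = fst h \<and> Cod T f = snd (snd h) \<and> represents f (fst (snd h)))"

lemma relation_arrow:
  assumes "R \<subseteq> {..<m} \<times> {..<n}"
  shows "relation_arrow (m, R, n) \<in> Arr T" "Dom T (relation_arrow (m, R, n)) = m"
    "Cod T (relation_arrow (m, R, n)) = n" "represents (relation_arrow (m, R, n)) R"
proof -
  have "\<exists>!f. f \<in> Arr T \<and> Dom T f = m \<and> Cod T f = n \<and> represents f R"
    using represents_exists[of "(m, R, n)"] assms represents_unique by auto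
  from theI'[OF this] show "relation_arrow (m, R, n) \<in> Arr T" "Dom T (relation_arrow (m, R, n)) = m"
    "Cod T (relation_arrow (m, R, n)) = n" "represents (relation_arrow (m, R, n)) R"
    by (simp_all add: relation_arrow_def)
qed

text \<open>Through this lemma each functor law becomes the statement that the expected arrow
  represents the expected relation.\<close>

lemma relation_arrow_eq:
  assumes "R \<subseteq> {..<m} \<times> {..<n}" "represents f R" "Dom T f = m" "Cod T f = n"
  shows "relation_arrow (m, R, n) = f"
  using represents_unique[OF relation_arrow(4)[OF assms(1)] assms(2)] relation_arrow[OF assms(1)] assms by simp

definition relation_functor :: "(nat, nat \<times> (nat \<times> nat) set \<times> nat, nat, 'm) mon_map" where
  "relation_functor = \<lparr>FObj = (\<lambda>n. n), FArr = relation_arrow, Phi = (\<lambda>m n. \<one> (m + n)), Phi0 = \<one> 0\<rparr>"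

lemma relation_functor_simps [simp]:
  "FObj relation_functor n = n" "FArr relation_functor = relation_arrow"
  "Phi relation_functor m n = \<one> (m + n)" "Phi0 relation_functor = \<one> 0"
  by (simp_all add: relation_functor_def)

lemma relation_functor_symmetric_monoidal: "symmetric_monoidal_functor FinRel T relation_functor"
proof -
  have Ident: "relation_arrow (n, Id_on {..<n}, n) = \<one> n" for n
    by (rule relation_arrow_eq) (auto simp: represents_Ident)
  have Symm: "relation_arrow (m + n, rel_swap m n, n + m) = \<tau> m n" for m n
    by (rule relation_arrow_eq) (auto simp: represents_Symm rel_swap_iff)
  show ?thesis
  proof unfold_locales
    fix f g a b c assume "f \<in> Hom FinRel a b" "g \<in> Hom FinRel b c"
    then obtain R S where R: "f = (a, R, b)" "R \<subseteq> {..<a} \<times> {..<b}" and S: "g = (b, S, c)" "S \<subseteq> {..<b} \<times> {..<c}"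
      by (cases f; cases g) (auto simp: Hom_iff)
    note rel = relation_arrow[OF R(2)] relation_arrow[OF S(2)]
    have "relation_arrow (a, R O S, c) = relation_arrow (b, S, c) \<cdot> relation_arrow (a, R, b)"
    proof (rule relation_arrow_eq)
      show "represents (relation_arrow (b, S, c) \<cdot> relation_arrow (a, R, b)) (R O S)"
        by (rule represents_Comp) (use rel R(2) in auto)
    qed (use rel R(2) S(2) in auto)
    then show "FArr relation_functor (Comp FinRel g f) = FArr relation_functor g \<cdot> FArr relation_functor f"
      using R S by simp
  next
    fix f g a a' b b' assume "f \<in> Hom FinRel a a'" "g \<in> Hom FinRel b b'"
    then obtain R S where R: "f = (a, R, a')" "R \<subseteq> {..<a} \<times> {..<a'}" and S: "g = (b, S, b')" "S \<subseteq> {..<b} \<times> {..<b'}"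
      by (cases f; cases g) (auto simp: Hom_iff)
    note rel = relation_arrow[OF R(2)] relation_arrow[OF S(2)]
    have "relation_arrow (a + b, rel_sum a a' R S, a' + b') = relation_arrow (a, R, a') \<boxtimes> relation_arrow (b, S, b')"
    proof (rule relation_arrow_eq)
      show "represents (relation_arrow (a, R, a') \<boxtimes> relation_arrow (b, S, b')) (rel_sum a a' R S)"
        using represents_TArr[OF rel(4) rel(8)] rel R(2) by simp
    qed (use rel rel_sum_mono[OF R(2) S(2)] in auto)
    then show "Phi relation_functor a' b' \<cdot> (FArr relation_functor f \<boxtimes> FArr relation_functor g)
        = FArr relation_functor (TArr FinRel f g) \<cdot> Phi relation_functor a b"
      using R S rel by simp
  next
    fix f a b assume "f \<in> Hom FinRel a b"
    then show "FArr relation_functor f \<in> Hom T (FObj relation_functor a) (FObj relation_functor b)"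
      using relation_arrow by (cases f) (simp add: Hom_iff)
  qed (auto simp: Hom_iff Ident Symm add.assoc)
qed

lemma relation_functor_generators:
  "relation_arrow (2, {(0, 0), (1, 0)}, 1) = \<mu>" "relation_arrow (0, {}, 1) = \<eta>"
  "relation_arrow (1, {(0, 0), (0, 1)}, 2) = \<Delta>" "relation_arrow (1, {}, 0) = \<epsilon>"
  using represents_\<mu> represents_\<eta> represents_\<Delta> represents_\<epsilon>
  by (auto intro!: relation_arrow_eq simp: numeral_2_eq_2)

end

text \<open>On the small exponents involved, a join is an identity, a unitor or an associator. Each
  axiom in the PROP is thus the axiom in \<open>C\<close> with its constraint moved to the other
  side.\<close>

lemma endo_prop_bimonoid:
  assumes "special_bicommutative_bimonoid C B"
  shows "prop_bimonoid (endo_prop C (Carrier B)) (2, Mult B, 1) (0, Eta B, 1) (1, Comult B, 2) (1, Counit B, 0)"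
proof -
  interpret B: special_bicommutative_bimonoid C B by fact
  interpret sm_object C "Carrier B" by unfold_locales (rule B.carrier_in_Obj)
  have [simp]: "Mult B \<in> Arr C" "Dom C (Mult B) = Carrier B \<otimes>\<^bsub>C\<^esub> Carrier B" "Cod C (Mult B) = Carrier B"
    "Eta B \<in> Arr C" "Dom C (Eta B) = \<I>\<^bsub>C\<^esub>" "Cod C (Eta B) = Carrier B"
    "Comult B \<in> Arr C" "Cod C (Comult B) = Carrier B \<otimes>\<^bsub>C\<^esub> Carrier B" "Dom C (Comult B) = Carrier B"
    "Counit B \<in> Arr C" "Cod C (Counit B) = \<I>\<^bsub>C\<^esub>" "Dom C (Counit B) = Carrier B"
    using B.mult_in_Hom B.unit_in_Hom B.comult_in_Hom B.counit_in_Hom by (simp_all add: Hom_iff)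
  interpret T: prop_category T by (rule endo_prop_category)
  interpret Op: prop_category "opposite_prop T" by (rule T.opposite_prop_category)
  note [simp] = obj_power.simps power_join.simps numeral_eq_Suc
  interpret M: prop_monoid T "(2, Mult B, 1)" "(0, Eta B, 1)"
  proof unfold_locales
    show "Comp T (2, Mult B, 1) (TArr T (2, Mult B, 1) (Ident T 1)) = Comp T (2, Mult B, 1) (TArr T (Ident T 1) (2, Mult B, 1))"
      \<comment> \<open>The join at exponents 2 and 1 is the associator of \<open>Carrier B\<close>.
        It occurs inverted in the sum of the multiplication with \<open>Ident T 1\<close>, hence the
        composition with its inverse.\<close>
      using B.Comp_chain[OF B.mult_assoc, of "inv_arrow C (\<alpha>\<^bsub>C\<^esub> (Carrier B) (Carrier B) (Carrier B))"]
      by simp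
    show "Comp T (2, Mult B, 1) (TArr T (0, Eta B, 1) (Ident T 1)) = Ident T 1"
      using B.Comp_chain[OF B.mult_unit_left, of "inv_arrow C (\<l>\<^bsub>C\<^esub> (Carrier B))"] by simp
    show "Comp T (2, Mult B, 1) (TArr T (Ident T 1) (0, Eta B, 1)) = Ident T 1"
      using B.Comp_chain[OF B.mult_unit_right, of "inv_arrow C (\<r>\<^bsub>C\<^esub> (Carrier B))"] by simp
    show "Comp T (2, Mult B, 1) (Symm T 1 1) = (2, Mult B, 1)"
      using B.mult_comm by simp
  qed (simp_all add: Hom_iff)
  interpret D: prop_monoid "opposite_prop T" "(1, Comult B, 2)" "(1, Counit B, 0)"
  proof unfold_locales
    show "Comp (opposite_prop T) (1, Comult B, 2) (TArr (opposite_prop T) (1, Comult B, 2) (Ident (opposite_prop T) 1))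
      = Comp (opposite_prop T) (1, Comult B, 2) (TArr (opposite_prop T) (Ident (opposite_prop T) 1) (1, Comult B, 2))"
      using B.comult_coassoc by simp
    show "Comp (opposite_prop T) (1, Comult B, 2) (TArr (opposite_prop T) (1, Counit B, 0) (Ident (opposite_prop T) 1))
      = Ident (opposite_prop T) 1"
      using B.comult_counit_left by simp
    show "Comp (opposite_prop T) (1, Comult B, 2) (TArr (opposite_prop T) (Ident (opposite_prop T) 1) (1, Counit B, 0))
      = Ident (opposite_prop T) 1"
      using B.comult_counit_right by simp
    show "Comp (opposite_prop T) (1, Comult B, 2) (Symm (opposite_prop T) 1 1) = (1, Comult B, 2)"
      using B.comult_cocomm by simp
  qed (simp_all add: Hom_iff)
  show ?thesis
  proof unfold_locales
    \<comment> \<open>The outer associators of \<open>middle_swap\<close> are the joins at exponents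
      2 and 2 in the two flanking sums; the inner ones are the joins around the symmetry.\<close>
    show "Comp T (1, Comult B, 2) (2, Mult B, 1) = Comp T (TArr T (2, Mult B, 1) (2, Mult B, 1))
        (Comp T (TArr T (Ident T 1) (TArr T (Symm T 1 1) (Ident T 1))) (TArr T (1, Comult B, 2) (1, Comult B, 2)))"
      using B.comult_mult by (simp add: middle_swap_def B.TArr_Comp_Arr B.TArr_Comp_chain)
    show "Comp T (1, Comult B, 2) (0, Eta B, 1) = TArr T (0, Eta B, 1) (0, Eta B, 1)"
      using B.comult_unit by simp
    show "Comp T (1, Counit B, 0) (2, Mult B, 1) = TArr T (1, Counit B, 0) (1, Counit B, 0)"
      using B.counit_mult by simp
    show "Comp T (1, Counit B, 0) (0, Eta B, 1) = Ident T 0"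
      using B.counit_unit by simp
    show "Comp T (2, Mult B, 1) (1, Comult B, 2) = Ident T 1"
      using B.special by simp
  qed
qed

text \<open>The equation with \<open>B\<close> is strict: the power with exponent 1 is
  \<open>Carrier B\<close>, and the comparison maps at 1, 1 and at the unit are identities, so
  evaluation at 1 returns the original structure maps.\<close>

lemma FinRel_algebra_exists:
  fixes B :: "('o, 'm) bimonoid"
  assumes "special_bicommutative_bimonoid C B"
  shows "\<exists>F :: (nat, nat \<times> (nat \<times> nat) set \<times> nat, 'o, 'm) mon_map.
    symmetric_monoidal_functor FinRel C F \<and> FArr F \<in> extensional (Arr FinRel) \<and> image_bimonoid C F FinRel_bimonoid = B"
proof -
  interpret B: special_bicommutative_bimonoid C B by fact
  interpret sm_object C "Carrier B" by unfold_locales (rule B.carrier_in_Obj)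
  define \<mu> \<eta> \<Delta> \<epsilon> where gen: "\<mu> = (2 :: nat, Mult B, 1 :: nat)" "\<eta> = (0 :: nat, Eta B, 1 :: nat)"
    "\<Delta> = (1 :: nat, Comult B, 2 :: nat)" "\<epsilon> = (1 :: nat, Counit B, 0 :: nat)"
  interpret P: prop_bimonoid T \<mu> \<eta> \<Delta> \<epsilon>
    unfolding gen by (rule endo_prop_bimonoid) fact
  have [simp]: "FArr endo_functor \<mu> = Mult B" "FArr endo_functor \<eta> = Eta B"
    "FArr endo_functor \<Delta> = Comult B" "FArr endo_functor \<epsilon> = Counit B"
    by (simp_all add: gen)
  let ?F = "comp_mon C endo_functor P.relation_functor"
  let ?F' = "?F\<lparr>FArr := restrict (FArr ?F) (Arr FinRel)\<rparr>"
  have "symmetric_monoidal_functor FinRel C ?F'"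
    using P.relation_functor_symmetric_monoidal endo_functor_smf
    by (intro restrict_FArr_symmetric_monoidal comp_mon_symmetric_monoidal)
  moreover have "image_bimonoid C ?F' FinRel_bimonoid = B"
    using B.mult_in_Hom B.unit_in_Hom B.comult_in_Hom B.counit_in_Hom P.relation_functor_generators
    by (intro bimonoid.equality)
      (simp_all add: image_bimonoid_def Hom_iff obj_power.simps power_join.simps numeral_eq_Suc)
  ultimately show ?thesis
    by (intro exI[of _ ?F']) simp
qed

lemma Carrier_image_bimonoid: "Carrier (image_bimonoid C F B) = FObj F (Carrier B)"
  by (simp add: image_bimonoid_def)

theorem corollary6:
  fixes C :: "('o, 'm) sm_category"
  assumes "symmetric_monoidal_category C"
  shows "prop_category FinRel
    \<and> equivalent_categories (algebras FinRel C) (special_bicommutative_bimonoids C)"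
proof
  show "prop_category FinRel" by (rule FinRel_prop_category)
  interpret C: symmetric_monoidal_category C by fact
  let ?im = "\<lambda>F. image_bimonoid C F FinRel_bimonoid"
  let ?ev = "\<lparr>FObj = ?im, FArr = (\<lambda>(F, G, \<theta>). (?im F, ?im G, \<theta> 1))\<rparr>"
  have im: "special_bicommutative_bimonoid C (?im F)" if "symmetric_monoidal_functor FinRel C F"
    for F :: "(nat, nat \<times> (nat \<times> nat) set \<times> nat, 'o, 'm) mon_map"
  proof -
    interpret strong_functor FinRel C F using that by simp
    show ?thesis by (rule image_special_bicommutative_bimonoid) (rule FinRel_bimonoid)
  qed
  have dom: "symmetric_monoidal_functor FinRel C F" "symmetric_monoidal_functor FinRel C G"
    if "monoidal_natural_transformation FinRel C F G \<theta>"
    for F G :: "(nat, nat \<times> (nat \<times> nat) set \<times> nat, 'o, 'm) mon_map" and \<theta>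
    using that by (simp_all add: monoidal_natural_transformation_def)
  have hom: "bimonoid_hom C (?im F) (?im G) (\<theta> 1)"
    if "monoidal_natural_transformation FinRel C F G \<theta>"
    for F G :: "(nat, nat \<times> (nat \<times> nat) set \<times> nat, 'o, 'm) mon_map" and \<theta>
    using monoidal_natural_transformation_bimonoid_hom[OF that FinRel_bimonoid] by simp
  show "equivalent_categories (algebras FinRel C) (special_bicommutative_bimonoids C)"
  \<comment> \<open>Surjectivity is the construction of algebras from bimonoids. Faithfulness and
    fullness are uniqueness and existence of the extension of a homomorphism from its component at
    1.\<close>
  proof (rule equivalent_categoriesI[of _ _ ?ev])
    interpret A: category "algebras FinRel C"
      by (rule algebras_category) (rule FinRel_prop_category, fact)
    interpret S: category "special_bicommutative_bimonoids C"
      by (rule special_bicommutative_bimonoids_category) fact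
    show "cat_functor (algebras FinRel C) (special_bicommutative_bimonoids C) ?ev"
      by unfold_locales
        (auto simp: algebras_def special_bicommutative_bimonoids_def Hom_iff im dom[THEN im] hom[simplified]
          Carrier_image_bimonoid)
  next
    fix B assume "B \<in> Obj (special_bicommutative_bimonoids C)"
    then show "\<exists>F\<in>Obj (algebras FinRel C). FObj ?ev F = B"
      using FinRel_algebra_exists[of C B] by (auto simp: algebras_def special_bicommutative_bimonoids_def)
  next
    fix F G x y
    assume x: "x \<in> Hom (algebras FinRel C) F G" and y: "y \<in> Hom (algebras FinRel C) F G"
      and eq: "FArr ?ev x = FArr ?ev y"
    then obtain \<theta> \<theta>' where \<theta>: "x = (F, G, \<theta>)" "y = (F, G, \<theta>')" "\<theta> 1 = \<theta>' 1"
      "monoidal_natural_transformation FinRel C F G \<theta>" "monoidal_natural_transformation FinRel C F G \<theta>'"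
      by (cases x; cases y) (auto simp: algebras_def Hom_iff)
    interpret algebra_pair FinRel C F G
      using dom[OF \<theta>(4)] by (simp add: algebra_pair_def FinRel_prop_category)
    show "x = y"
      using transformation_unique[OF \<theta>(4,5,3)] \<theta>(1,2) by simp
  next
    fix F G g
    assume F: "F \<in> Obj (algebras FinRel C)" and G: "G \<in> Obj (algebras FinRel C)"
      and g: "g \<in> Hom (special_bicommutative_bimonoids C) (FObj ?ev F) (FObj ?ev G)"
    obtain f where f: "g = (?im F, ?im G, f)" "bimonoid_hom C (?im F) (?im G) f"
      using g by (cases g) (auto simp: special_bicommutative_bimonoids_def Hom_iff)
    obtain \<theta> where "monoidal_natural_transformation FinRel C F G \<theta>" "\<theta> 1 = f"
      using FinRel_transformation_exists[OF _ _ f(2)] F G by (auto simp: algebras_def)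
    then show "\<exists>x\<in>Hom (algebras FinRel C) F G. FArr ?ev x = g"
      using F G f(1) by (intro bexI[of _ "(F, G, \<theta>)"]) (auto simp: algebras_def Hom_iff)
  qed
qed

end
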